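(* For $k\in\mathbb{N}=\{1,2,3,\dots\}$ put $c_k:=\big((2k-1)\pi/2\big)^{-1}$ and $c_{-k}:=\big((2(-k)+1)\pi/2\big)^{-1}$ (so $c_{-k}=-c_k$), and define the discrete measures on $\mathbb{R}$ $$m(dx):=\sum_{k\in\mathbb{Z}\setminus\{0\}}\frac{x^2}{1+x^2}\,\delta_{c_k}(dx),\qquad M(dx):=\frac{1+x^2}{x^2}\,m(dx),$$ where $\delta_c$ is the Dirac measure at $c$. Then the following hold. (a) $m$ is a finite measure with total mass $m(\mathbb{R})=\tanh(1)\approx 0.76159$, and for all real $t\neq 0$ $$\int_{\mathbb{R}}\frac{1+itx}{it-x}\,m(dx)=\tan\!\Big(\frac{1}{it}\Big)=-i\tanh(1/t).$$ (b) $\int_{\mathbb{R}\setminus\{0\}}(x^2\wedge 1)\,M(dx)<\infty$, and therefore $\mu=[0,0,M]$ is a classical infinitely divisible probability measure with zero shift, zero Gaussian part and Lévy measure $M$. Let $\phi_\mu$ be its characteristic function and $\overline{\phi_\mu}$ the complex conjugate of $\phi_\mu$. Then for all $t>0$ $$it^2\,\mathfrak{L}\big[\log\overline{\phi_\mu}(s);t\big]=it\,\log\big(\phi_{\mathcal{K}(\mu)}(-t^{-1})\big)=\tan\!\Big(\frac{1}{it}\Big)=-i\tanh(1/t),$$ where the Laplace transform is taken in the variable $s$. (c) For the characteristic function $\phi_m$ of $m$ and all $w>1$, $$(w^2-1)\,\mathfrak{L}\big[\phi_m(x)-\tanh(1)\cosh(x);w\big]=-i\tan\!\Big(\frac{1}{iw}\Big)=-\tanh(1/w),$$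 where the Laplace transform is taken in the variable $x$. (d) Let $N_2,r_1,r_2,\dots$ be independent, where $N_2$ has the Poisson distribution with parameter $2$ and the $r_j$ are Rademacher variables, $P(r_j=1)=P(r_j=-1)=1/2$; let $Y=\sum_{j=1}^{N_2}r_j$ (with $Y=0$ if $N_2=0$), and let $Y_1,Y_2,\dots$ be i.i.d. copies of $Y$. Then the series $$X=\sum_{n=1}^{\infty}c_nY_n$$ converges almost surely, in distribution and in $L^2$, and the measure $\mu=[0,0,M]$ is the probability distribution of $X$.
   Context: For a finite Borel measure $\rho$ on $\mathbb{R}$, its characteristic function is $\phi_\rho(t)=\int_{\mathbb{R}}e^{itx}\,\rho(dx)$, $t\in\mathbb{R}$. For a Borel function $g$ on $[0,\infty)$, its Laplace transform is $\mathfrak{L}[g(x);w]=\int_0^\infty g(x)e^{-wx}\,dx$, for $w>0$ such that the integral exists. A probability measure $\mu$ on $\mathbb{R}$ is infinitely divisible if for each $k\ge 2$ there is a probability measure $\mu_k$ with $\mu_k^{*k}=\mu$ ($*$ is convolution); $(ID,* )$ denotes the convolution semigroup of all such measures. One writes $\mu=[a,\sigma^2,M]$ for $\mu\in ID$ with $$\phi_\mu(t)=\exp\Big[ita-\tfrac12\sigma^2t^2+\int_{\mathbb{R}\setminus\{0\}}\Big(e^{itx}-1-\frac{itx}{1+x^2}\Big)M(dx)\Big],\quad t\in\mathbb{R},$$ where $a\in\mathbb{R}$ (shift), $\sigma^2\ge 0$ (variance of the Gaussian part) and $M$ is a Lévy measure, i.e. $\int\min(1,x^2)\,M(dx)<\infty$;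 the triplet is uniquely determined by $\mu$. For $\mu\in ID$, $\log\phi_\mu$ denotes the exponent in this formula (the continuous logarithm vanishing at $0$). For $\mu\in ID$ let $(Y_\mu(t))_{t\ge 0}$ be a Lévy process (starting from $0$, stationary independent increments, continuous in probability, with right-continuous paths having left limits) such that $Y_\mu(1)$ has distribution $\mu$. The random integral mapping $\mathcal{K}$ is $$\mathcal{K}(\mu):=\mathcal{L}\Big(\int_0^\infty s\,dY_\mu(1-e^{-s})\Big),$$ where $\mathcal{L}(V)$ is the probability distribution of $V$; the integral over $(0,b]$ is understood pathwise by integration by parts, $\int_{(0,b]}s\,dY_\mu(1-e^{-s})=b\,Y_\mu(1-e^{-b})-\int_0^bY_\mu(1-e^{-s})\,ds$, and the integral over $(0,\infty)$ is the limit as $b\to\infty$ (in probability). $\mathcal{K}(\mu)$ is again infinitely divisible. *)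

theory Defs
  imports "HOL-Probability.Probability"
begin

section \<open>Infinitely divisible laws\<close>

fun conv_power :: "nat \<Rightarrow> real measure \<Rightarrow> real measure" where
  "conv_power 0 \<nu> = return borel 0"
| "conv_power (Suc k) \<nu> = convolution \<nu> (conv_power k \<nu>)"

definition infinitely_divisible :: "real measure \<Rightarrow> bool" where
  "infinitely_divisible \<mu> \<longleftrightarrow> real_distribution \<mu> \<and>
     (\<forall>k\<ge>2. \<exists>\<nu>. real_distribution \<nu> \<and> conv_power k \<nu> = \<mu>)"

text \<open>A measure on \<open>\<real> - {0}\<close> is represented by a Borel measure on the line without mass at \<open>0\<close>;
  this is what makes the triplet unique.\<close>

definition levy_measure :: "real measure \<Rightarrow> bool" where
  "levy_measure M \<longleftrightarrow> sets M = sets borel \<and> emeasure M {0} = 0 \<and>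
     (\<integral>\<^sup>+x\<in>-{0}. ennreal (min 1 (x\<^sup>2)) \<partial>M) < \<infinity>"

definition lk_exponent :: "real \<Rightarrow> real \<Rightarrow> real measure \<Rightarrow> real \<Rightarrow> complex" where
  "lk_exponent a v M t =
     \<i> * of_real (t * a) - of_real (v * t\<^sup>2 / 2) +
     (LINT x:-{0}|M. iexp (t * x) - 1 - \<i> * of_real (t * x / (1 + x\<^sup>2)))"

definition has_lk_triplet :: "real measure \<Rightarrow> real \<Rightarrow> real \<Rightarrow> real measure \<Rightarrow> bool" where
  "has_lk_triplet \<mu> a v M \<longleftrightarrow> infinitely_divisible \<mu> \<and> v \<ge> 0 \<and> levy_measure M \<and>
     (\<forall>t. char \<mu> t = exp (lk_exponent a v M t))"

text \<open>The law \<open>[a, v, M]\<close>, where \<open>v\<close> is the variance of the Gaussian part. It is only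
  meaningful when some law has this triplet.\<close>

definition lk_law :: "real \<Rightarrow> real \<Rightarrow> real measure \<Rightarrow> real measure" where
  "lk_law a v M = (THE \<mu>. has_lk_triplet \<mu> a v M)"

text \<open>The continuous logarithm vanishing at \<open>0\<close>. There is at most one, since the line is
  connected, and for a law with triplet \<open>(a, v, M)\<close> it is \<open>lk_exponent a v M\<close>.\<close>

definition clog :: "(real \<Rightarrow> complex) \<Rightarrow> real \<Rightarrow> complex" where
  "clog f = (THE \<psi>. continuous_on UNIV \<psi> \<and> \<psi> 0 = 0 \<and> (\<forall>t. exp (\<psi> t) = f t))"

definition laplace :: "(real \<Rightarrow> complex) \<Rightarrow> real \<Rightarrow> complex" where
  "laplace g w = (LINT x:{0..}|lborel. g x * of_real (exp (- w * x)))"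

definition laplace_exists :: "(real \<Rightarrow> complex) \<Rightarrow> real \<Rightarrow> bool" where
  "laplace_exists g w \<longleftrightarrow> set_integrable lborel {0..} (\<lambda>x. g x * of_real (exp (- w * x)))"


section \<open>Levy processes and the random integral mapping\<close>

definition levy_process :: "'p measure \<Rightarrow> (real \<Rightarrow> 'p \<Rightarrow> real) \<Rightarrow> bool" where
  "levy_process P Y \<longleftrightarrow> prob_space P \<and>
     (\<forall>t\<ge>0. Y t \<in> borel_measurable P) \<and>
     (\<forall>\<omega>\<in>space P. Y 0 \<omega> = 0) \<and>
     (\<forall>n (t :: nat \<Rightarrow> real). 0 \<le> t 0 \<and> (\<forall>i<n. t i \<le> t (Suc i)) \<longrightarrow>
        prob_space.indep_vars P (\<lambda>_. borel) (\<lambda>i \<omega>. Y (t (Suc i)) \<omega> - Y (t i) \<omega>) {..<n}) \<and>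
     (\<forall>s\<ge>0. \<forall>h\<ge>0. distr P borel (\<lambda>\<omega>. Y (s + h) \<omega> - Y s \<omega>) = distr P borel (Y h)) \<and>
     (\<forall>t\<ge>0. \<forall>\<epsilon>>0.
        ((\<lambda>s. measure P {\<omega>\<in>space P. \<bar>Y s \<omega> - Y t \<omega>\<bar> > \<epsilon>}) \<longlongrightarrow> 0) (at t within {0..})) \<and>
     (\<forall>\<omega>\<in>space P.
        (\<forall>t\<ge>0. ((\<lambda>s. Y s \<omega>) \<longlongrightarrow> Y t \<omega>) (at_right t)) \<and>
        (\<forall>t>0. \<exists>l. ((\<lambda>s. Y s \<omega>) \<longlongrightarrow> l) (at_left t)))"

text \<open>The pathwise integral of \<open>s\<close> over \<open>(0, b]\<close> with respect to \<open>dY(1 - exp (-s))\<close>, through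
  integration by parts.\<close>

definition K_integral_upto :: "(real \<Rightarrow> 'p \<Rightarrow> real) \<Rightarrow> real \<Rightarrow> 'p \<Rightarrow> real" where
  "K_integral_upto Y b \<omega> =
     b * Y (1 - exp (- b)) \<omega> - (LINT s:{0..b}|lborel. Y (1 - exp (- s)) \<omega>)"

text \<open>\<open>V\<close> is (a version of) the integral over \<open>(0, \<infinity>)\<close>, a limit in probability. If \<open>Y\<close> is a
  Levy process on \<open>P\<close> and \<open>Y 1\<close> has law \<open>\<mu>\<close>, then \<open>\<K>(\<mu>)\<close> is the law of \<open>V\<close>.\<close>

definition is_K_integral :: "'p measure \<Rightarrow> (real \<Rightarrow> 'p \<Rightarrow> real) \<Rightarrow> ('p \<Rightarrow> real) \<Rightarrow> bool" where
  "is_K_integral P Y V \<longleftrightarrow> V \<in> borel_measurable P \<and>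
     (\<forall>\<epsilon>>0. ((\<lambda>b. measure P {\<omega>\<in>space P. \<bar>K_integral_upto Y b \<omega> - V \<omega>\<bar> > \<epsilon>}) \<longlongrightarrow> 0) at_top)"


section \<open>The discrete measures\<close>

definition c_seq :: "int \<Rightarrow> real" where
  "c_seq k = (if k > 0 then inverse ((2 * of_int k - 1) * pi / 2)
              else inverse ((2 * of_int k + 1) * pi / 2))"

lemma c_seq_minus: "k \<noteq> 0 \<Longrightarrow> c_seq (- k) = - c_seq k"
proof -
  have *: "c_seq (- k) = - c_seq k" if "k > 0" for k
  proof -
    have "(2 * of_int (- k) + 1) * pi / 2 = - ((2 * of_int k - 1) * pi / 2)"
      by (simp add: field_simps)
    then show ?thesis
      using that by (simp only: c_seq_def inverse_minus_eq) (simp add: inverse_minus_eq)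
  qed
  show "k \<noteq> 0 \<Longrightarrow> c_seq (- k) = - c_seq k"
    using *[of k] *[of "- k"] by (cases "k > 0") auto
qed

text \<open>Pushing counting measure forward along \<open>c_seq\<close> gives the sum of the Dirac measures at
  \<open>c_seq k\<close> for \<open>k \<noteq> 0\<close>.\<close>

definition m_meas :: "real measure" where
  "m_meas = density (distr (count_space (- {0})) borel c_seq) (\<lambda>x. ennreal (x\<^sup>2 / (1 + x\<^sup>2)))"

definition M_meas :: "real measure" where
  "M_meas = density m_meas (\<lambda>x. ennreal ((1 + x\<^sup>2) / x\<^sup>2))"

lemma emeasure_m_meas:
  assumes "A \<in> sets borel"
  shows "emeasure m_meas A =
    (\<integral>\<^sup>+k. ennreal ((c_seq k)\<^sup>2 / (1 + (c_seq k)\<^sup>2)) * emeasure (return borel (c_seq k)) A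
       \<partial>count_space (- {0}))"
  using assms unfolding m_meas_def
  by (subst emeasure_density) (auto simp: nn_integral_distr)

definition \<mu>_law :: "real measure" where
  "\<mu>_law = lk_law 0 0 M_meas"

end

theory Submission
  imports Defs
begin

text \<open>Everything rests on the expansion \<open>tanh x = (\<Sum>k\<ge>1. 2 x c\<^sub>k\<^sup>2 / (1 + x\<^sup>2 c\<^sub>k\<^sup>2))\<close>, which is the
  reflection formula of the Digamma function on the line \<open>Re z = 1/2\<close>. The exponent of \<open>\<mu>\<close> is
  \<open>\<psi> u = (\<Sum>k\<ge>1. 2 (cos (u c\<^sub>k) - 1))\<close>, and integrating it termwise gives
  \<open>\<integral>\<psi> (u s) exp (- t s) ds = - u tanh (u / t) / t\<^sup>2\<close>.

  The function \<open>exp (l (2 (cos u - 1)))\<close> is the characteristic function of a difference of two independent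
  Poisson variables, so the laws with exponents \<open>l \<psi>\<close> are obtained from a series of independent
  variables; \<open>l = 1\<close> gives \<open>\<mu>\<close> and \<open>l = 1/k\<close> its convolution roots. For the Levy process, summation
  by parts turns the random integral over \<open>(a, b]\<close> into a limit of weighted sums of increments, whose
  exponents are Riemann sums of \<open>\<integral>\<psi> (u s) exp (- s) ds\<close>. Hence \<open>\<K>(\<mu>)\<close> has exponent
  \<open>- u tanh u\<close>. Second moments are read off from characteristic functions by Fatou's lemma.\<close>

section \<open>The partial fraction expansion of tanh and the measures m and M\<close>

text \<open>The identity in (b) is one integral read twice: \<open>u = 1\<close> with arbitrary
  \<open>t\<close> is the Laplace transform of the logarithm, while \<open>t = 1\<close> with
  \<open>u = - 1/t\<close> is the exponent of K(mu). This is why \<open>laplace_mu_exponent\<close>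
  carries two parameters. Since \<open>M_meas\<close> is symmetric, all exponents are real.
  Continuous logarithms can therefore be exhibited outright, and complex conjugation has no effect.
  The claim about K(mu) concerns every Levy process with \<open>Y 1\<close> distributed as mu, so
  only the law at time 1 is given. At time \<open>1/n\<close> the characteristic function is an n-th
  root of a known function, and continuity in \<open>u\<close> selects the root; right-continuity of
  the paths then reaches all real times. All quantitative convergence goes back to
  \<open>1 - cos x \<le> x^2 / 2\<close>: it bounds exponents quadratically, a quadratic bound on an
  exponent bounds a second moment, and second moments give almost sure convergence through summable
  expectations and convergence in probability through Chebyshev's inequality.\<close>

lemma Digamma_reflection_complex:
  fixes z :: complex
  assumes "z \<notin> \<int>"
  shows "Digamma (1 - z) - Digamma z = of_real pi * cot (of_real pi * z)"
proof -
  have z: "z \<notin> \<int>\<^sub>\<le>\<^sub>0" "1 - z \<notin> \<int>\<^sub>\<le>\<^sub>0"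
    using assms nonpos_Ints_subset_Ints by (auto dest: Ints_diff[OF Ints_1])
  \<comment> \<open>Both sides of \<open>rGamma z * rGamma (1 - z) = sin (pi z) / pi\<close> are
    differentiated. Dividing by the product, which has no zero off the integers, leaves the
    difference of Digamma values.\<close>
  have "((\<lambda>z. rGamma z * rGamma (1 - z)) has_field_derivative
     rGamma z * rGamma (1 - z) * (Digamma (1 - z) - Digamma z)) (at z)"
    using z
    by (auto intro!: derivative_eq_intros has_field_derivative_rGamma_no_nonpos_int
          DERIV_chain'[of "\<lambda>z. 1 - z" _ _ _ rGamma] simp: algebra_simps)
  moreover have "((\<lambda>z. sin (of_real pi * z) / of_real pi) has_field_derivative
     cos (of_real pi * z)) (at z)"
    by (auto intro!: derivative_eq_intros)
  ultimately have "rGamma z * rGamma (1 - z) * (Digamma (1 - z) - Digamma z) = cos (of_real pi * z)"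
    unfolding rGamma_reflection_complex by (rule DERIV_unique)
  moreover have "rGamma z * rGamma (1 - z) \<noteq> 0"
    using z by (auto simp: rGamma_eq_zero_iff)
  ultimately show ?thesis
    by (simp add: rGamma_reflection_complex cot_def field_simps)
qed

text \<open>On the line \<open>Re z = 1/2\<close> one has \<open>1 - z = cnj z\<close>, so
  corresponding terms of the two Digamma series are conjugate and their difference is purely
  imaginary.\<close>

lemma inverse_real_plus_imaginary_diff:
  fixes u y :: real
  assumes "u > 0"
  shows "inverse (Complex u y) - inverse (Complex u (- y)) = - \<i> * of_real (2 * y / (u\<^sup>2 + y\<^sup>2))"
  using assms by (simp add: complex_eq_iff)

lemma tan_of_imaginary: "tan (\<i> * complex_of_real x) = \<i> * of_real (tanh x)"
proof -
  have "sin (\<i> * complex_of_real x) = \<i> * of_real (sinh x)"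
    by (simp add: sin_exp_eq sinh_def exp_of_real exp_minus field_simps flip: exp_of_real)
  moreover have "cos (\<i> * complex_of_real x) = of_real (cosh x)"
    by (simp add: cos_exp_eq cosh_def exp_of_real exp_minus field_simps flip: exp_of_real)
  ultimately show ?thesis
    by (simp add: tan_def tanh_def)
qed

lemma tan_one_over_imaginary:
  "tan (1 / (\<i> * complex_of_real t)) = - \<i> * of_real (tanh (1 / t))"
proof -
  have "1 / (\<i> * complex_of_real t) = - (\<i> * of_real (1 / t))"
    \<comment> \<open>At \<open>t = 0\<close> both sides are \<open>0\<close> by the convention on
      division.\<close>
    by (cases "t = 0") (auto simp: field_simps)
  then show ?thesis
    by (simp only: tan_minus tan_of_imaginary mult_minus_left)
qed

text \<open>Zero-based enumeration of the positive atoms. By symmetry a sum over all nonzero indices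
  becomes a series of \<open>f (c_nat n) + f (- c_nat n)\<close>.\<close>

definition c_nat :: "nat \<Rightarrow> real" where
  "c_nat n = c_seq (int (Suc n))"

lemma c_nat_eq: "c_nat n = 2 / ((2 * real n + 1) * pi)"
  by (simp add: c_nat_def c_seq_def field_simps)

lemma c_nat_pos: "c_nat n > 0"
  by (auto simp: c_nat_eq intro!: divide_pos_pos mult_pos_pos)

text \<open>With \<open>y = x / pi\<close> one has \<open>pi * z = pi/2 + i x\<close>, so the
  cotangent becomes \<open>- tan (i x)\<close>. The shifts \<open>n + 1/2\<close> in the Digamma
  series are \<open>1 / (pi * c_nat n)\<close>; this is where the points \<open>c_nat n\<close> come
  from.\<close>

lemma tanh_sums: "(\<lambda>n. 2 * x * (c_nat n)\<^sup>2 / (1 + x\<^sup>2 * (c_nat n)\<^sup>2)) sums tanh x"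
proof -
  define y where "y = x / pi"
  define z where "z = Complex (1/2) y"
  have z1: "1 - z = Complex (1/2) (- y)"
    by (simp add: z_def complex_eq_iff)
  have zn: "z \<notin> \<int>"
  proof
    assume "z \<in> \<int>"
    then obtain m where "z = of_int m" by (auto elim: Ints_cases)
    then have "real_of_int (2 * m) = real_of_int 1" by (simp add: z_def complex_eq_iff)
    then have "2 * m = 1" by (simp only: of_int_eq_iff)
    then show False by presburger
  qed
  have "\<And>w::complex. w \<notin> \<int> \<Longrightarrow> w \<notin> \<int>\<^sub>\<le>\<^sub>0" using nonpos_Ints_subset_Ints by auto
  have z_ne: "z \<noteq> 0" "1 - z \<noteq> 0" using zn by auto
  \<comment> \<open>The logarithms in the two limit formulas for Digamma cancel, which leaves a
    convergent series.\<close>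
  have "(\<lambda>m. (of_real (ln (real m)) - (\<Sum>n<m. inverse (1 - z + of_nat n))) -
     (of_real (ln (real m)) - (\<Sum>n<m. inverse (z + of_nat n)))) \<longlonglongrightarrow> Digamma (1 - z) - Digamma z"
    by (intro tendsto_diff Digamma_LIMSEQ z_ne)
  then have "(\<lambda>n. inverse (z + of_nat n) - inverse (1 - z + of_nat n)) sums
     (of_real pi * cot (of_real pi * z))"
    by (simp add: sums_def Digamma_reflection_complex zn sum_subtractf)
  moreover have "inverse (z + of_nat n) - inverse (1 - z + of_nat n) =
      - \<i> * of_real (2 * y / ((real n + 1/2)\<^sup>2 + y\<^sup>2))" for n
  proof -
    have "z + of_nat n = Complex (real n + 1/2) y" "1 - z + of_nat n = Complex (real n + 1/2) (- y)"
      unfolding z1 by (simp_all add: z_def complex_eq_iff)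
    then show ?thesis by (simp only: inverse_real_plus_imaginary_diff)
  qed
  moreover have "of_real pi * cot (of_real pi * z) = - \<i> * of_real (pi * tanh x)"
  proof -
    have *: "of_real pi * z = of_real pi / 2 + \<i> * of_real x"
      by (simp add: z_def complex_eq_iff y_def)
    have "cot (of_real pi * z) = - tan (\<i> * of_real x)"
      unfolding * by (simp add: cot_def tan_def sin_add cos_add)
    then show ?thesis by (simp only: tan_of_imaginary) simp
  qed
  ultimately have "(\<lambda>n. - \<i> * of_real (2 * y / ((real n + 1/2)\<^sup>2 + y\<^sup>2))) sums (- \<i> * of_real (pi * tanh x))"
    by simp
  from sums_mult[OF this, of \<i>]
  have "(\<lambda>n. complex_of_real (2 * y / ((real n + 1/2)\<^sup>2 + y\<^sup>2))) sums of_real (pi * tanh x)"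
    by (simp flip: mult.assoc)
  then have "(\<lambda>n. 2 * y / ((real n + 1/2)\<^sup>2 + y\<^sup>2)) sums (pi * tanh x)"
    by (simp only: sums_of_real_iff)
  from sums_divide[OF this, of pi]
  have "(\<lambda>n. 2 * y / ((real n + 1/2)\<^sup>2 + y\<^sup>2) / pi) sums tanh x" by simp
  moreover have "2 * y / ((real n + 1/2)\<^sup>2 + y\<^sup>2) / pi = 2 * x * (c_nat n)\<^sup>2 / (1 + x\<^sup>2 * (c_nat n)\<^sup>2)" for n
  proof -
    have c: "real n + 1/2 = 1 / (pi * c_nat n)"
      using c_nat_pos[of n] by (auto simp: c_nat_eq field_simps)
    have "A + (x / pi)\<^sup>2 = (pi\<^sup>2 * A + x\<^sup>2) / pi\<^sup>2" for A
      by (simp add: field_simps power2_eq_square)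
    then have "2 * (x / pi) / (A + (x / pi)\<^sup>2) / pi = 2 * x / (pi\<^sup>2 * A + x\<^sup>2)" for A
      by (simp add: power2_eq_square)
    then have "2 * y / ((real n + 1/2)\<^sup>2 + y\<^sup>2) / pi = 2 * x / (pi\<^sup>2 * (1 / (pi * c_nat n))\<^sup>2 + x\<^sup>2)"
      unfolding c y_def .
    also have "pi\<^sup>2 * (1 / (pi * c_nat n))\<^sup>2 = 1 / (c_nat n)\<^sup>2"
      by (simp add: field_simps power2_eq_square)
    also have "2 * x / (1 / (c_nat n)\<^sup>2 + x\<^sup>2) = 2 * x * (c_nat n)\<^sup>2 / (1 + x\<^sup>2 * (c_nat n)\<^sup>2)"
      using c_nat_pos[of n] by (simp add: divide_simps)
    finally show ?thesis .
  qed
  ultimately show ?thesis by simp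
qed

text \<open>The form \<open>1 / (n + 1)\<close> is the one that matches the variance condition of
  \<open>orthogonal_sequence\<close>.\<close>

lemma c_nat_le: "c_nat n \<le> 1 / (real n + 1)"
proof -
  have "2 * (real n + 1) \<le> (2 * real n + 1) * pi"
    using pi_gt3 mult_left_mono[of 3 pi "2 * real n + 1"] by (simp add: field_simps)
  then show ?thesis
    by (simp add: c_nat_eq field_simps)
qed

lemma summable_c_nat_sq: "summable (\<lambda>n. (c_nat n)\<^sup>2)"
proof (rule summable_comparison_test')
  show "summable (\<lambda>n. inverse (real (Suc n) ^ 2))"
    using inverse_power_summable[of 2, where ?'a = real] by (subst summable_Suc_iff) simp_all
  show "norm ((c_nat n)\<^sup>2) \<le> inverse (real (Suc n) ^ 2)" for n
    using power_mono[OF c_nat_le[of n], of 2] c_nat_pos[of n]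
    by (simp add: power_one_over inverse_eq_divide add.commute)
qed

lemma c_seq_minus_int_Suc: "c_seq (- int (Suc n)) = - c_nat n"
  unfolding c_nat_def by (rule c_seq_minus) simp

lemma c_seq_nonzero: "c_seq k \<noteq> 0"
proof -
  have "2 * k - 1 \<noteq> 0" "2 * k + 1 \<noteq> 0" by presburger+
  then have "real_of_int (2 * k - 1) \<noteq> 0" "real_of_int (2 * k + 1) \<noteq> 0"
    by (simp_all only: of_int_eq_0_iff not_False_eq_True)
  then show ?thesis by (auto simp: c_seq_def)
qed

section \<open>Integration against the discrete measures\<close>

lemma has_bochner_integral_count_space_nonzero_int:
  fixes f :: "int \<Rightarrow> 'a::{banach, second_countable_topology}"
  assumes 1: "summable (\<lambda>n. norm (f (int (Suc n))))" and 2: "summable (\<lambda>n. norm (f (- int (Suc n))))"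
  shows "has_bochner_integral (count_space (- {0})) f
    (\<Sum>n. f (int (Suc n)) + f (- int (Suc n)))"
proof -
  \<comment> \<open>The nonzero integers split into two half-lines, each enumerated by the naturals.
    Adding the two series termwise pairs \<open>k\<close> with \<open>- k\<close>.\<close>
  have bij: "bij_betw (\<lambda>n. int (Suc n)) UNIV {0<..}" "bij_betw (\<lambda>n. - int (Suc n)) UNIV {..<0}"
    by (rule bij_betw_byWitness[where f' = "\<lambda>k. nat (k - 1)"]; force)
      (rule bij_betw_byWitness[where f' = "\<lambda>k. nat (- k - 1)"]; force)
  have abs: "Infinite_Set_Sum.abs_summable_on f {0<..}" "Infinite_Set_Sum.abs_summable_on f {..<0}"
    using 1 2 by (auto simp: abs_summable_on_nat_iff'
        simp flip: abs_summable_on_reindex_bij_betw[OF bij(1)] abs_summable_on_reindex_bij_betw[OF bij(2)])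
  have un: "- {0} = {0<..} \<union> {..<0::int}" by auto
  have "infsetsum f {0<..} = (\<Sum>n. f (int (Suc n)))"
    using 1 by (subst infsetsum_reindex_bij_betw[OF bij(1), symmetric])
      (simp add: infsetsum_nat' abs_summable_on_nat_iff')
  moreover have "infsetsum f {..<0} = (\<Sum>n. f (- int (Suc n)))"
    using 2 by (subst infsetsum_reindex_bij_betw[OF bij(2), symmetric])
      (simp add: infsetsum_nat' abs_summable_on_nat_iff')
  ultimately have "infsetsum f (- {0}) = (\<Sum>n. f (int (Suc n)) + f (- int (Suc n)))"
    using abs 1 2 unfolding un
    by (subst infsetsum_Un_disjoint) (auto simp: suminf_add summable_norm_cancel)
  moreover have "Infinite_Set_Sum.abs_summable_on f (- {0})"
    unfolding un using abs by (rule abs_summable_on_union)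
  ultimately show ?thesis
    by (simp add: has_bochner_integral_iff abs_summable_on_def infsetsum_def)
qed

lemma sets_m_meas [simp, measurable_cong]: "sets m_meas = sets borel"
  by (simp add: m_meas_def)

lemma sets_M_meas [simp, measurable_cong]: "sets M_meas = sets borel"
  by (simp add: M_meas_def)

lemma space_m_meas [simp]: "space m_meas = UNIV"
  by (simp add: m_meas_def)

text \<open>The densities in the definitions of \<open>m_meas\<close> and \<open>M_meas\<close> are
  reciprocal away from \<open>0\<close>, and no atom sits at \<open>0\<close>.\<close>

lemma M_meas_eq: "M_meas = distr (count_space (- {0})) borel c_seq"
proof -
  let ?Z = "distr (count_space (- {0})) borel c_seq"
  have "AE x in ?Z. x \<noteq> 0"
    by (subst AE_distr_iff) (auto simp: AE_count_space c_seq_nonzero)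
  then have "AE x in ?Z. ennreal (x\<^sup>2 / (1 + x\<^sup>2)) * ennreal ((1 + x\<^sup>2) / x\<^sup>2) = 1"
  proof (rule AE_mp, intro AE_I2 impI)
    fix x :: real assume "x \<noteq> 0"
    moreover have "1 + x\<^sup>2 > 0" by (simp add: add_pos_nonneg)
    ultimately have "x\<^sup>2 / (1 + x\<^sup>2) * ((1 + x\<^sup>2) / x\<^sup>2) = 1" by simp
    then show "ennreal (x\<^sup>2 / (1 + x\<^sup>2)) * ennreal ((1 + x\<^sup>2) / x\<^sup>2) = 1"
      by (simp flip: ennreal_mult')
  qed
  then have "density ?Z (\<lambda>x. ennreal (x\<^sup>2 / (1 + x\<^sup>2)) * ennreal ((1 + x\<^sup>2) / x\<^sup>2)) = density ?Z (\<lambda>x. 1)"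
    by (intro density_cong) auto
  then show ?thesis
    unfolding M_meas_def m_meas_def by (simp add: density_density_eq density_1)
qed

lemma has_bochner_integral_M_meas:
  fixes f :: "real \<Rightarrow> 'a::{banach, second_countable_topology}"
  assumes [measurable]: "f \<in> borel_measurable borel"
    and "summable (\<lambda>n. norm (f (c_nat n)))" "summable (\<lambda>n. norm (f (- c_nat n)))"
  shows "has_bochner_integral M_meas f (\<Sum>n. f (c_nat n) + f (- c_nat n))"
  using has_bochner_integral_count_space_nonzero_int[of "\<lambda>k. f (c_seq k)"] assms
  unfolding M_meas_eq by (simp only: c_seq_minus_int_Suc flip: c_nat_def)
    (auto simp: has_bochner_integral_iff integrable_distr_eq integral_distr)

definition m_weight :: "nat \<Rightarrow> real" where
  "m_weight n = (c_nat n)\<^sup>2 / (1 + (c_nat n)\<^sup>2)"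

lemma m_weight_nonneg: "m_weight n \<ge> 0"
  by (simp add: m_weight_def)

text \<open>The expansion of tanh at \<open>1\<close>. The factor 2 counts the atoms
  \<open>c_nat n\<close> and \<open>- c_nat n\<close>, so the sum is the total mass of
  \<open>m_meas\<close>.\<close>

lemma m_weight_sums: "(\<lambda>n. 2 * m_weight n) sums tanh 1"
  using tanh_sums[of 1] by (simp add: m_weight_def)

lemma summable_m_weight: "summable m_weight"
  using sums_summable[OF m_weight_sums] by simp

text \<open>The weights are summable, so boundedness of \<open>f\<close> supplies the summability
  that integration against the atoms asks for.\<close>

lemma has_bochner_integral_m_meas:
  fixes f :: "real \<Rightarrow> 'a::{banach, second_countable_topology}"
  assumes [measurable]: "f \<in> borel_measurable borel" and bd: "\<And>x. norm (f x) \<le> B"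
  shows "has_bochner_integral m_meas f (\<Sum>n. m_weight n *\<^sub>R (f (c_nat n) + f (- c_nat n)))"
proof -
  have "summable (\<lambda>n. norm (m_weight n *\<^sub>R f (x n)))" for x
    by (rule summable_comparison_test'[OF summable_mult2[OF summable_m_weight, of B]])
      (auto simp: m_weight_nonneg intro!: mult_left_mono bd)
  from this[of c_nat] this[of "\<lambda>n. - c_nat n"]
  have "has_bochner_integral (distr (count_space (- {0})) borel c_seq) (\<lambda>x. (x\<^sup>2 / (1 + x\<^sup>2)) *\<^sub>R f x)
     (\<Sum>n. m_weight n *\<^sub>R f (c_nat n) + m_weight n *\<^sub>R f (- c_nat n))"
    using has_bochner_integral_M_meas[of "\<lambda>x. (x\<^sup>2 / (1 + x\<^sup>2)) *\<^sub>R f x"]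
    unfolding M_meas_eq by (simp add: m_weight_def)
  then show ?thesis
    unfolding m_meas_def by (intro has_bochner_integral_density) (auto simp: scaleR_add_right)
qed

lemma finite_measure_m_meas: "finite_measure m_meas" and measure_m_meas: "measure m_meas UNIV = tanh 1"
proof -
  have *: "has_bochner_integral m_meas (\<lambda>x. 1 :: real) (tanh 1)"
    using has_bochner_integral_m_meas[of "\<lambda>x. 1 :: real" 1] sums_unique[OF m_weight_sums]
    by (simp add: mult.commute)
  then have "integrable m_meas (\<lambda>x. 1 :: real)" by (simp add: has_bochner_integral_iff)
  then show "finite_measure m_meas"
    by (intro finite_measureI) (simp add: integrable_iff_bounded)
  show "measure m_meas UNIV = tanh 1"
    using * by (simp add: has_bochner_integral_iff)
qed

text \<open>Adding the values at \<open>c\<close> and \<open>- c\<close> leaves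
  \<open>- 2 i t (1 + c^2) / (t^2 + c^2)\<close>. The factor \<open>1 + c^2\<close> cancels the
  denominator of \<open>m_weight\<close>, and a term of the expansion of \<open>tanh (1/t)\<close>
  remains.\<close>

lemma has_bochner_integral_m_meas_tan:
  fixes t :: real
  assumes "t \<noteq> 0"
  shows "has_bochner_integral m_meas (\<lambda>x. (1 + \<i> * of_real t * of_real x) / (\<i> * of_real t - of_real x))
    (- \<i> * of_real (tanh (1 / t)))"
proof -
  let ?f = "\<lambda>x. (1 + \<i> * of_real t * of_real x) / (\<i> * complex_of_real t - of_real x)"
  have den: "\<i> * complex_of_real t - of_real x \<noteq> 0" for x
    using assms by (simp add: complex_eq_iff)
  \<comment> \<open>The modulus is \<open>1 / \<bar>t\<bar>\<close> at \<open>x = 0\<close> and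
    tends to \<open>\<bar>t\<bar>\<close> at infinity; the larger of the two is a global
    bound.\<close>
  have "norm (?f x) \<le> max \<bar>t\<bar> (1 / \<bar>t\<bar>)" for x
  proof -
    have "cmod (1 + \<i> * of_real t * of_real x) = sqrt (1 + t\<^sup>2 * x\<^sup>2)"
      by (simp add: cmod_def power_mult_distrib)
    moreover have "cmod (\<i> * complex_of_real t - of_real x) = sqrt (t\<^sup>2 + x\<^sup>2)"
      by (simp add: cmod_def add.commute)
    ultimately have eq: "norm (?f x) = sqrt ((1 + t\<^sup>2 * x\<^sup>2) / (t\<^sup>2 + x\<^sup>2))"
      by (simp add: norm_divide real_sqrt_divide)
    have "(1 + t\<^sup>2 * x\<^sup>2) \<le> (max \<bar>t\<bar> (1 / \<bar>t\<bar>))\<^sup>2 * (t\<^sup>2 + x\<^sup>2)"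
    proof -
      have "t\<^sup>2 \<le> (max \<bar>t\<bar> (1 / \<bar>t\<bar>))\<^sup>2"
        by (simp add: abs_le_square_iff[symmetric])
      moreover have "(1 / t)\<^sup>2 \<le> (max \<bar>t\<bar> (1 / \<bar>t\<bar>))\<^sup>2"
        by (simp add: abs_le_square_iff[symmetric])
      ultimately have "(1/t)\<^sup>2 * t\<^sup>2 + t\<^sup>2 * x\<^sup>2 \<le> (max \<bar>t\<bar> (1 / \<bar>t\<bar>))\<^sup>2 * t\<^sup>2 + (max \<bar>t\<bar> (1 / \<bar>t\<bar>))\<^sup>2 * x\<^sup>2"
        by (intro add_mono mult_right_mono) auto
      then show ?thesis using assms by (simp add: power_divide distrib_left)
    qed
    moreover have "t\<^sup>2 + x\<^sup>2 > 0" using assms by (simp add: add_pos_nonneg)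
    ultimately show ?thesis
      unfolding eq by (intro real_le_lsqrt) (auto simp: pos_divide_le_eq)
  qed
  then have "has_bochner_integral m_meas ?f (\<Sum>n. m_weight n *\<^sub>R (?f (c_nat n) + ?f (- c_nat n)))"
    by (intro has_bochner_integral_m_meas) auto
  moreover have "(\<lambda>n. m_weight n *\<^sub>R (?f (c_nat n) + ?f (- c_nat n))) sums (- \<i> * of_real (tanh (1 / t)))"
  proof -
    have "m_weight n *\<^sub>R (?f (c_nat n) + ?f (- c_nat n)) =
      - \<i> * of_real (2 * (1/t) * (c_nat n)\<^sup>2 / (1 + (1/t)\<^sup>2 * (c_nat n)\<^sup>2))" for n
    proof -
      define c where "c = c_nat n"
      have nz: "t\<^sup>2 + c\<^sup>2 \<noteq> 0" "1 + c\<^sup>2 \<noteq> 0"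
        using assms by (auto simp: add_nonneg_eq_0_iff)
      then have nzc: "(of_real t)\<^sup>2 + (of_real c)\<^sup>2 \<noteq> (0::complex)"
        by (metis of_real_add of_real_eq_0_iff of_real_power)
      have "?f c + ?f (- c) = - 2 * \<i> * of_real t * (1 + (of_real c)\<^sup>2) / ((of_real t)\<^sup>2 + (of_real c)\<^sup>2)"
      proof -
        have "(\<i> * complex_of_real t - of_real c) * (\<i> * complex_of_real t - of_real (- c))
          = - ((of_real t)\<^sup>2 + (of_real c)\<^sup>2)"
          by (simp add: algebra_simps power2_eq_square)
        moreover have "(1 + \<i> * of_real t * of_real c) * (\<i> * complex_of_real t - of_real (- c))
          + (1 + \<i> * of_real t * of_real (- c)) * (\<i> * complex_of_real t - of_real c)
          = 2 * \<i> * of_real t * (1 + (of_real c)\<^sup>2)"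
          by (simp add: algebra_simps power2_eq_square)
        ultimately show ?thesis
          using den[of c] den[of "- c"]
          by (subst add_frac_eq) (simp_all only: not_False_eq_True minus_divide_right[symmetric] minus_divide_left mult_minus_left)
      qed
      also have "\<dots> = - \<i> * of_real (2 * t * (1 + c\<^sup>2) / (t\<^sup>2 + c\<^sup>2))" by simp
      finally have "m_weight n *\<^sub>R (?f c + ?f (- c)) = - \<i> * of_real (m_weight n * (2 * t * (1 + c\<^sup>2) / (t\<^sup>2 + c\<^sup>2)))"
        by (simp add: scaleR_conv_of_real)
      also have "m_weight n * (2 * t * (1 + c\<^sup>2) / (t\<^sup>2 + c\<^sup>2)) = 2 * t * c\<^sup>2 / (t\<^sup>2 + c\<^sup>2)"
        using nz by (simp add: m_weight_def c_def)
      also have "\<dots> = 2 * (1/t) * c\<^sup>2 / (1 + (1/t)\<^sup>2 * c\<^sup>2)"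
      proof -
        have "t\<^sup>2 + c\<^sup>2 = t\<^sup>2 * (1 + (1/t)\<^sup>2 * c\<^sup>2)"
          using assms by (simp add: distrib_left power_divide)
        then show ?thesis using assms by (simp only:) (simp add: power2_eq_square)
      qed
      finally show ?thesis by (simp only: c_def)
    qed
    then show ?thesis
      using sums_mult[OF sums_of_real[OF tanh_sums[of "1/t"]], of "- \<i>"] by simp
  qed
  ultimately show ?thesis by (simp add: sums_iff)
qed

section \<open>The exponent of the law and Laplace transforms\<close>

text \<open>Two continuous logarithms differ by a continuous function with values in the multiples
  of \<open>2 pi i\<close>. Distinct values are at distance at least \<open>2 * pi\<close>, so the
  difference is constant, and it vanishes at \<open>0\<close>.\<close>

lemma clog_eqI:
  assumes "continuous_on UNIV \<psi>" "\<psi> 0 = 0" "\<And>t. exp (\<psi> t) = f t"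
  shows "clog f = \<psi>"
  unfolding clog_def
proof (rule the_equality)
  show "continuous_on UNIV \<psi> \<and> \<psi> 0 = 0 \<and> (\<forall>t. exp (\<psi> t) = f t)"
    using assms by blast
next
  fix \<eta> assume \<eta>: "continuous_on UNIV \<eta> \<and> \<eta> 0 = 0 \<and> (\<forall>t. exp (\<eta> t) = f t)"
  define d where "d t = \<eta> t - \<psi> t" for t
  have "exp (d t) = 1" for t
    using \<eta> assms(3)[of t] by (simp add: d_def exp_diff) (metis divide_self exp_not_eq_zero)
  have "d constant_on UNIV"
  proof (rule continuous_discrete_range_constant)
    show "continuous_on UNIV d"
      unfolding d_def using \<eta> assms(1) by (intro continuous_intros) auto
    show "\<exists>e>0. \<forall>y. y \<in> UNIV \<and> d y \<noteq> d x \<longrightarrow> e \<le> norm (d y - d x)" for x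
    proof (intro exI[of _ "2 * pi"] conjI allI impI)
      fix y assume "y \<in> UNIV \<and> d y \<noteq> d x"
      moreover have "exp (d y - d x) = 1"
        using \<open>exp (d x) = 1\<close> \<open>exp (d y) = 1\<close> by (simp add: exp_diff)
      then obtain n :: int where n: "Re (d y - d x) = 0" "Im (d y - d x) = of_int (2 * n) * pi"
        unfolding exp_eq_1 by blast
      ultimately have "n \<noteq> 0" by (auto simp: complex_eq_iff)
      then have "1 \<le> \<bar>real_of_int n\<bar>" by (metis of_int_1_le_iff of_int_abs zero_less_abs_iff zless_imp_add1_zle add_0)
      then have "2 * pi \<le> \<bar>Im (d y - d x)\<bar>"
        unfolding n(2) by (simp add: abs_mult)
      then show "2 * pi \<le> norm (d y - d x)"
        using abs_Im_le_cmod order_trans by blast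
    qed simp
  qed simp
  then have "d t = d 0" for t by (metis UNIV_I constant_on_def)
  then show "\<eta> = \<psi>"
    using \<eta> assms(2) by (auto simp: d_def)
qed

text \<open>For nonnegative terms the integrals of the norms are the \<open>I n\<close> themselves,
  so convergence of their sum already provides the summability behind termwise integration.\<close>

lemma has_bochner_integral_suminf_nonneg:
  fixes f :: "nat \<Rightarrow> 'a \<Rightarrow> real"
  assumes f: "\<And>n. has_bochner_integral M (f n) (I n)" and nn: "\<And>n x. f n x \<ge> 0"
    and g: "\<And>x. (\<lambda>n. f n x) sums g x" and J: "I sums J"
  shows "has_bochner_integral M g J"
proof -
  have eq: "g = (\<lambda>x. \<Sum>n. f n x)" using g by (auto simp: sums_iff)
  have int: "integrable M (f n)" "integral\<^sup>L M (f n) = I n" for n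
    using f[of n] by (auto simp: has_bochner_integral_iff)
  have *: "AE x in M. summable (\<lambda>i. norm (f i x))" "summable (\<lambda>i. \<integral>x. norm (f i x) \<partial>M)"
    using g J nn by (auto simp: sums_iff int)
  show ?thesis
    unfolding eq has_bochner_integral_iff
    using integrable_suminf[OF int(1) *] integral_suminf[OF int(1) *] J by (simp add: int sums_iff)
qed

section \<open>Elementary Laplace integrals\<close>

lemma has_bochner_integral_FTC_atLeast:
  fixes f :: "real \<Rightarrow> real"
  assumes f_borel: "f \<in> borel_measurable borel"
    and f: "\<And>x. a \<le> x \<Longrightarrow> DERIV F x :> f x" and nonneg: "\<And>x. a \<le> x \<Longrightarrow> 0 \<le> f x"
    and lim: "(F \<longlongrightarrow> T) at_top"
  shows "has_bochner_integral lborel (\<lambda>x. indicator {a..} x * f x) (T - F a)"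
proof (rule has_bochner_integral_nn_integral)
  \<comment> \<open>Monotonicity gives \<open>F a \<le> T\<close>; this sign is required for reading
    the real value off the extended nonnegative integral.\<close>
  have "mono_on {a..} F"
    by (rule mono_onI) (metis DERIV_nonneg_imp_nondecreasing atLeast_iff f nonneg order_trans)
  then have "F a \<le> F x" if "x \<ge> a" for x
    using that by (auto simp: mono_on_def)
  then have "F a \<le> T"
    by (intro tendsto_lowerbound[OF lim] eventually_mono[OF eventually_ge_at_top[of a]]) auto
  then show "0 \<le> T - F a" by simp
  have "(\<integral>\<^sup>+x. ennreal (indicator {a..} x * f x) \<partial>lborel) = (\<integral>\<^sup>+x. ennreal (f x) * indicator {a..} x \<partial>lborel)"
    by (intro nn_integral_cong) (auto split: split_indicator)
  also have "\<dots> = ennreal (T - F a)"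
    by (rule nn_integral_FTC_atLeast[OF f_borel f nonneg lim])
  finally show "(\<integral>\<^sup>+x. ennreal (indicator {a..} x * f x) \<partial>lborel) = ennreal (T - F a)" .
qed (use f_borel nonneg in \<open>auto split: split_indicator\<close>)

lemma tendsto_bounded_mult_exp_at_top:
  fixes g :: "real \<Rightarrow> real"
  assumes "\<And>s. \<bar>g s\<bar> \<le> B" and "t > 0"
  shows "((\<lambda>s. exp (- t * s) * g s) \<longlongrightarrow> 0) at_top"
proof (rule Lim_null_comparison)
  show "\<forall>\<^sub>F s in at_top. norm (exp (- t * s) * g s) \<le> exp (- t * s) * B"
    using assms(1) by (auto simp: abs_mult)
  show "((\<lambda>s. exp (- t * s) * B) \<longlongrightarrow> 0) at_top"
    using assms(2) by real_asymp
qed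

lemma has_bochner_integral_exp:
  fixes a :: real
  assumes "a > 0"
  shows "has_bochner_integral lborel (\<lambda>s. indicator {0..} s * exp (- a * s)) (1 / a)"
proof -
  have "has_bochner_integral lborel (\<lambda>s. indicator {0..} s * exp (- a * s)) (0 - (- (exp (- a * 0) * (1 / a))))"
  proof (rule has_bochner_integral_FTC_atLeast)
    show "((\<lambda>s. - (exp (- a * s) * (1 / a))) \<longlongrightarrow> 0) at_top"
      using tendsto_minus[OF tendsto_bounded_mult_exp_at_top[of "\<lambda>s. 1 / a" "\<bar>1 / a\<bar>", OF _ assms]] by simp
  qed (use assms in \<open>auto intro!: derivative_eq_intros\<close>)
  then show ?thesis by simp
qed

lemma has_bochner_integral_one_minus_cos_exp:
  fixes a t :: real
  assumes "t > 0"
  shows "has_bochner_integral lborel (\<lambda>s. indicator {0..} s * ((1 - cos (a * s)) * exp (- t * s)))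
    (a\<^sup>2 / (t * (t\<^sup>2 + a\<^sup>2)))"
proof -
  define d where "d = t\<^sup>2 + a\<^sup>2"
  have d: "d > 0" using assms by (simp add: d_def add_pos_nonneg)
  \<comment> \<open>\<open>- exp (- t * s) * ?g s\<close> is a primitive of the integrand: the first
    summand of \<open>?g\<close> comes from the primitive of
    \<open>cos (a * s) * exp (- t * s)\<close>, the second from that of
    \<open>exp (- t * s)\<close>.\<close>
  let ?g = "\<lambda>s. (a * sin (a * s) - t * cos (a * s)) / d + 1 / t"
  have "has_bochner_integral lborel (\<lambda>s. indicator {0..} s * ((1 - cos (a * s)) * exp (- t * s)))
    (0 - (- (exp (- t * 0) * ?g 0)))"
  proof (rule has_bochner_integral_FTC_atLeast)
    have "\<bar>?g s\<bar> \<le> (\<bar>a\<bar> + t) / d + 1 / t" for s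
    proof -
      have "\<bar>a * sin (a * s)\<bar> \<le> \<bar>a\<bar> * 1" "\<bar>t * cos (a * s)\<bar> \<le> t * 1"
        unfolding abs_mult using assms mult_left_mono[OF abs_sin_le_one, of "\<bar>a\<bar>" "a * s"] by simp_all
      then have "\<bar>a * sin (a * s) - t * cos (a * s)\<bar> \<le> \<bar>a\<bar> + t" by linarith
      then have "\<bar>(a * sin (a * s) - t * cos (a * s)) / d\<bar> \<le> (\<bar>a\<bar> + t) / d"
        using d by (simp add: abs_divide divide_right_mono)
      then show ?thesis using assms by (intro order_trans[OF abs_triangle_ineq] add_mono) auto
    qed
    from tendsto_minus[OF tendsto_bounded_mult_exp_at_top[OF this assms]]
    show "((\<lambda>s. - (exp (- t * s) * ?g s)) \<longlongrightarrow> 0) at_top" by simp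
    fix s :: real
    have "((\<lambda>s. - (exp (- t * s) * ?g s)) has_field_derivative
      - (exp (- t * s) * ((a * (a * cos (a * s)) + t * (a * sin (a * s))) / d) - t * exp (- t * s) * ?g s)) (at s)"
      using d by (auto intro!: derivative_eq_intros simp: algebra_simps add_divide_distrib diff_divide_distrib)
    also have "- (exp (- t * s) * ((a * (a * cos (a * s)) + t * (a * sin (a * s))) / d) - t * exp (- t * s) * ?g s)
      = exp (- t * s) * (1 - (t\<^sup>2 + a\<^sup>2) * cos (a * s) / d)"
      using assms d by (simp add: field_simps power2_eq_square)
    also have "\<dots> = (1 - cos (a * s)) * exp (- t * s)"
      using d by (simp add: d_def[symmetric])
    finally show "((\<lambda>s. - (exp (- t * s) * ?g s)) has_field_derivative (1 - cos (a * s)) * exp (- t * s)) (at s)" .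
  qed auto
  moreover have "?g 0 = a\<^sup>2 / (t * (t\<^sup>2 + a\<^sup>2))"
    using assms d unfolding d_def by (simp add: field_simps power2_eq_square)
  ultimately show ?thesis by simp
qed

lemma laplace_of_real:
  assumes "has_bochner_integral lborel (\<lambda>x. indicator {0..} x * (g x * exp (- w * x))) I"
  shows "laplace_exists (\<lambda>x. complex_of_real (g x)) w" "laplace (\<lambda>x. complex_of_real (g x)) w = of_real I"
proof -
  have eq: "(\<lambda>x. indicator {0..} x *\<^sub>R (complex_of_real (g x) * complex_of_real (exp (- w * x)))) =
     (\<lambda>x. of_real (indicator {0..} x * (g x * exp (- w * x))))"
    by (auto simp: scaleR_conv_of_real)
  have "has_bochner_integral lborel
    (\<lambda>x. indicator {0..} x *\<^sub>R (complex_of_real (g x) * complex_of_real (exp (- w * x)))) (of_real I)"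
    unfolding eq by (rule has_bochner_integral_of_real[OF assms])
  then show "laplace_exists (\<lambda>x. complex_of_real (g x)) w" "laplace (\<lambda>x. complex_of_real (g x)) w = of_real I"
    unfolding laplace_exists_def laplace_def set_integrable_def set_lebesgue_integral_def
    by (simp_all only: has_bochner_integral_iff)
qed

section \<open>The exponent of the law and its bounds\<close>

lemma one_minus_cos_le: "1 - cos x \<le> x\<^sup>2 / 2" for x :: real
proof -
  have "1 - cos x = 2 * (sin (x / 2))\<^sup>2"
    using cos_double_sin[of "x / 2"] by simp
  also have "\<dots> \<le> 2 * (x / 2)\<^sup>2"
    using abs_sin_x_le_abs_x[of "x / 2"] by (intro mult_left_mono) (simp only: abs_le_square_iff, simp)
  finally show ?thesis by (simp add: power_divide)
qed

text \<open>For the atoms at \<open>c\<close> and \<open>- c\<close> the compensators of the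
  Levy-Khintchine integrand cancel and the exponentials add up to
  \<open>2 * (cos (u * c) - 1)\<close>.\<close>

definition mu_exponent :: "real \<Rightarrow> real" where
  "mu_exponent u = (\<Sum>n. 2 * (cos (u * c_nat n) - 1))"

lemma mu_exponent_term_bound: "\<bar>2 * (cos (u * c_nat n) - 1)\<bar> \<le> u\<^sup>2 * (c_nat n)\<^sup>2"
  using one_minus_cos_le[of "u * c_nat n"] by (simp add: power_mult_distrib)

lemma mu_exponent_sums: "(\<lambda>n. 2 * (cos (u * c_nat n) - 1)) sums mu_exponent u"
  unfolding mu_exponent_def
  by (intro summable_sums summable_comparison_test'[OF summable_mult[OF summable_c_nat_sq, of "u\<^sup>2"]])
    (use mu_exponent_term_bound in \<open>simp only: real_norm_def\<close>)

text \<open>Minus the second derivative at \<open>0\<close> that termwise differentiation of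
  \<open>mu_exponent\<close> would give. It serves as the constant in second moment bounds.\<close>

definition mu_variance :: real where
  "mu_variance = (\<Sum>n. 2 * (c_nat n)\<^sup>2)"

lemma mu_variance_sums: "(\<lambda>n. 2 * (c_nat n)\<^sup>2) sums mu_variance"
  unfolding mu_variance_def by (intro summable_sums summable_mult summable_c_nat_sq)

lemma mu_variance_nonneg: "mu_variance \<ge> 0"
  using mu_variance_sums by (rule sums_le[OF _ sums_zero, rotated]) simp

lemma mu_exponent_nonpos: "mu_exponent u \<le> 0"
  by (rule sums_le[OF _ mu_exponent_sums sums_zero]) simp

text \<open>The bound from which the second moments of the random integrals are controlled.\<close>

lemma mu_exponent_bound: "- mu_exponent u \<le> mu_variance * (u\<^sup>2 / 2)"
proof (rule sums_le[OF _ sums_minus[OF mu_exponent_sums] sums_mult2[OF mu_variance_sums]])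
  show "- (2 * (cos (u * c_nat n) - 1)) \<le> 2 * (c_nat n)\<^sup>2 * (u\<^sup>2 / 2)" for n
    using one_minus_cos_le[of "u * c_nat n"] by (simp add: power_mult_distrib mult.commute)
qed

lemma mu_exponent_0 [simp]: "mu_exponent 0 = 0"
  by (simp add: mu_exponent_def)

text \<open>The majorant of the terms grows with \<open>u\<close>, so the M-test is applied on
  bounded intervals; these are open in order to give continuity at each point.\<close>

lemma continuous_on_mu_exponent: "continuous_on UNIV mu_exponent"
proof -
  have "continuous_on {-R<..<R} mu_exponent" for R
  proof (rule uniform_limit_theorem)
    show "uniform_limit {-R<..<R} (\<lambda>n u. \<Sum>i<n. 2 * (cos (u * c_nat i) - 1)) mu_exponent sequentially"
      unfolding mu_exponent_def
    proof (rule Weierstrass_m_test)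
      show "summable (\<lambda>n. R\<^sup>2 * (c_nat n)\<^sup>2)" by (intro summable_mult summable_c_nat_sq)
      fix n u assume "u \<in> {-R<..<R}"
      then have "u\<^sup>2 \<le> R\<^sup>2" by (subst abs_le_square_iff[symmetric]) auto
      then show "norm (2 * (cos (u * c_nat n) - 1)) \<le> R\<^sup>2 * (c_nat n)\<^sup>2"
        using order_trans[OF mu_exponent_term_bound mult_right_mono] by (simp only: real_norm_def) simp
    qed
  qed (auto intro!: always_eventually continuous_intros)
  then have "isCont mu_exponent u" for u
    by (rule continuous_on_interior[of "{-(\<bar>u\<bar>+1)<..<\<bar>u\<bar>+1}"]) (auto simp: interior_open)
  then show ?thesis by (simp add: continuous_at_imp_continuous_on)
qed

lemma borel_measurable_mu_exponent [measurable]: "mu_exponent \<in> borel_measurable borel"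
  using continuous_on_mu_exponent by (rule borel_measurable_continuous_onI)

text \<open>The sign is reversed first, so that the terms are nonnegative and may be integrated one
  by one. Each gives \<open>u / t^2\<close> times a term of the expansion of
  \<open>tanh (u / t)\<close>.\<close>

lemma laplace_mu_exponent:
  assumes t: "t > 0"
  shows "has_bochner_integral lborel (\<lambda>s. indicator {0..} s * (mu_exponent (u * s) * exp (- t * s)))
    (- (u / t\<^sup>2 * tanh (u / t)))"
proof -
  have "has_bochner_integral lborel (\<lambda>s. indicator {0..} s * (- mu_exponent (u * s) * exp (- t * s)))
    (u / t\<^sup>2 * tanh (u / t))"
  proof (rule has_bochner_integral_suminf_nonneg)
    show "has_bochner_integral lborel
      (\<lambda>s. 2 * (indicator {0..} s * ((1 - cos (u * c_nat n * s)) * exp (- t * s))))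
      (2 * ((u * c_nat n)\<^sup>2 / (t * (t\<^sup>2 + (u * c_nat n)\<^sup>2))))" for n
      by (intro has_bochner_integral_mult_right has_bochner_integral_one_minus_cos_exp t)
    show "(\<lambda>n. 2 * (indicator {0..} s * ((1 - cos (u * c_nat n * s)) * exp (- t * s)))) sums
       (indicator {0..} s * (- mu_exponent (u * s) * exp (- t * s)))" for s
      using sums_mult[OF sums_minus[OF mu_exponent_sums[of "u * s"]], of "indicator {0..} s * exp (- t * s)"]
      by (simp add: algebra_simps)
    have "2 * (u / t) * (c_nat n)\<^sup>2 / (1 + (u / t)\<^sup>2 * (c_nat n)\<^sup>2) * (u / t\<^sup>2) =
       2 * ((u * c_nat n)\<^sup>2 / (t * (t\<^sup>2 + (u * c_nat n)\<^sup>2)))" for n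
    proof -
      have "1 + (u / t)\<^sup>2 * (c_nat n)\<^sup>2 = (t\<^sup>2 + (u * c_nat n)\<^sup>2) / t\<^sup>2"
        using t by (simp add: field_simps)
      then show ?thesis using t by (simp add: power2_eq_square mult_ac)
    qed
    then show "(\<lambda>n. 2 * ((u * c_nat n)\<^sup>2 / (t * (t\<^sup>2 + (u * c_nat n)\<^sup>2)))) sums (u / t\<^sup>2 * tanh (u / t))"
      using sums_mult2[OF tanh_sums[of "u / t"], of "u / t\<^sup>2"] by (simp add: mult.commute)
  qed auto
  from has_bochner_integral_minus[OF this] show ?thesis by simp
qed

section \<open>The characteristic function of m and its transform\<close>

lemma char_m_meas: "char m_meas x = of_real (\<Sum>n. 2 * m_weight n * cos (x * c_nat n))"
proof -
  have "char m_meas x = (\<Sum>n. m_weight n *\<^sub>R (iexp (x * c_nat n) + iexp (x * - c_nat n)))"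
    unfolding char_def
    using has_bochner_integral_m_meas[of "\<lambda>y. iexp (x * y)" 1] by (simp add: has_bochner_integral_iff)
  also have "\<dots> = (\<Sum>n. of_real (2 * m_weight n * cos (x * c_nat n)))"
    by (intro suminf_cong) (simp add: complex_eq_iff Re_exp Im_exp)
  also have "\<dots> = of_real (\<Sum>n. 2 * m_weight n * cos (x * c_nat n))"
  proof (rule suminf_of_real[symmetric])
    show "summable (\<lambda>n. 2 * m_weight n * cos (x * c_nat n))"
      by (rule summable_comparison_test'[OF sums_summable[OF m_weight_sums]])
        (use m_weight_nonneg in \<open>auto simp: abs_mult intro!: mult_left_le\<close>)
  qed
  finally show ?thesis .
qed

text \<open>Writing \<open>tanh 1\<close> as the total mass turns the integrand into a series of
  terms proportional to \<open>cosh x - cos (x * c)\<close>, which are nonnegative. Their transforms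
  \<open>w / (w^2 - 1) - w / (w^2 + c^2)\<close> carry a factor \<open>1 + c^2\<close> that cancels
  the weight; what is left is the expansion of \<open>tanh (1/w)\<close> over
  \<open>w^2 - 1\<close>.\<close>

lemma laplace_char_m_meas:
  assumes w: "w > 1"
  shows "has_bochner_integral lborel
    (\<lambda>x. indicator {0..} x * ((tanh 1 * cosh x - (\<Sum>n. 2 * m_weight n * cos (x * c_nat n))) * exp (- w * x)))
    (tanh (1 / w) / (w\<^sup>2 - 1))"
proof (rule has_bochner_integral_suminf_nonneg)
  fix n
  have w2: "w\<^sup>2 > 1" using w by (simp add: one_less_power)
  \<comment> \<open>Here \<open>w > 1\<close> enters: both exponentials that make up
    \<open>cosh x * exp (- w * x)\<close> must decay.\<close>
  have cosh: "has_bochner_integral lborel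
      (\<lambda>x. (indicator {0..} x * exp (- (w - 1) * x) + indicator {0..} x * exp (- (w + 1) * x)) / 2)
      ((1 / (w - 1) + 1 / (w + 1)) / 2)"
    using w by (intro has_bochner_integral_divide has_bochner_integral_add has_bochner_integral_exp) auto
  have cos: "has_bochner_integral lborel
      (\<lambda>x. indicator {0..} x * exp (- w * x) - indicator {0..} x * ((1 - cos (c_nat n * x)) * exp (- w * x)))
      (1 / w - (c_nat n)\<^sup>2 / (w * (w\<^sup>2 + (c_nat n)\<^sup>2)))"
    using w by (intro has_bochner_integral_diff has_bochner_integral_exp has_bochner_integral_one_minus_cos_exp) auto
  have eq: "2 * m_weight n * ((1 / (w - 1) + 1 / (w + 1)) / 2 - (1 / w - (c_nat n)\<^sup>2 / (w * (w\<^sup>2 + (c_nat n)\<^sup>2)))) =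
     2 * (1 / w) * (c_nat n)\<^sup>2 / (1 + (1 / w)\<^sup>2 * (c_nat n)\<^sup>2) * (1 / (w\<^sup>2 - 1))"
  proof -
    define c where "c = (c_nat n)\<^sup>2"
    have c: "c > 0" using c_nat_pos[of n] by (simp add: c_def)
    have pos: "w\<^sup>2 + c > 0" "1 + c > 0" using w2 c by auto
    have 1: "(1 / (w - 1) + 1 / (w + 1)) / 2 = w / (w\<^sup>2 - 1)"
    proof -
      have "w\<^sup>2 - 1 = (w - 1) * (w + 1)" by (simp add: algebra_simps power2_eq_square)
      then show ?thesis using w by (simp add: divide_simps)
    qed
    have 2: "1 / w - c / (w * (w\<^sup>2 + c)) = w / (w\<^sup>2 + c)"
      using w pos by (simp add: divide_simps) (simp add: algebra_simps power2_eq_square)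
    have 3: "w / (w\<^sup>2 - 1) - w / (w\<^sup>2 + c) = w * (1 + c) / ((w\<^sup>2 + c) * (w\<^sup>2 - 1))"
      using w2 pos by (simp add: divide_simps) (simp add: algebra_simps)
    have 4: "1 + (1 / w)\<^sup>2 * c = (w\<^sup>2 + c) / w\<^sup>2"
      using w by (simp add: field_simps)
    have "2 * (c / (1 + c)) * (w * (1 + c) / ((w\<^sup>2 + c) * (w\<^sup>2 - 1))) = 2 * w * c / ((w\<^sup>2 + c) * (w\<^sup>2 - 1))"
      using pos by simp
    also have "\<dots> = 2 * (1 / w) * c / ((w\<^sup>2 + c) / w\<^sup>2) * (1 / (w\<^sup>2 - 1))"
      using w by (simp add: power2_eq_square)
    finally show ?thesis unfolding m_weight_def c_def[symmetric] 1 2 3 4 .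
  qed
  show "has_bochner_integral lborel
    (\<lambda>x. indicator {0..} x * (2 * m_weight n * (cosh x - cos (x * c_nat n)) * exp (- w * x)))
    (2 * (1 / w) * (c_nat n)\<^sup>2 / (1 + (1 / w)\<^sup>2 * (c_nat n)\<^sup>2) * (1 / (w\<^sup>2 - 1)))"
  proof -
    have "(\<lambda>x. indicator {0..} x * (2 * m_weight n * (cosh x - cos (x * c_nat n)) * exp (- w * x))) =
      (\<lambda>x. 2 * m_weight n * ((indicator {0..} x * exp (- (w - 1) * x) + indicator {0..} x * exp (- (w + 1) * x)) / 2 -
       (indicator {0..} x * exp (- w * x) - indicator {0..} x * ((1 - cos (c_nat n * x)) * exp (- w * x)))))"
    proof
      fix x
      have "exp (- (w - 1) * x) = exp x * exp (- w * x)" "exp (- (w + 1) * x) = exp (- x) * exp (- w * x)"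
        by (simp_all add: algebra_simps flip: exp_add)
      then show "indicator {0..} x * (2 * m_weight n * (cosh x - cos (x * c_nat n)) * exp (- w * x)) =
        2 * m_weight n * ((indicator {0..} x * exp (- (w - 1) * x) + indicator {0..} x * exp (- (w + 1) * x)) / 2 -
       (indicator {0..} x * exp (- w * x) - indicator {0..} x * ((1 - cos (c_nat n * x)) * exp (- w * x))))"
        by (simp add: cosh_def algebra_simps add_divide_distrib)
    qed
    then show ?thesis
      using has_bochner_integral_mult_right[OF has_bochner_integral_diff[OF cosh cos], of "2 * m_weight n"]
      unfolding eq by simp
  qed
next
  show "0 \<le> indicator {0..} x * (2 * m_weight n * (cosh x - cos (x * c_nat n)) * exp (- w * x))" for n x
    using m_weight_nonneg[of n] order_trans[OF cos_le_one cosh_real_ge_1]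
    by (intro mult_nonneg_nonneg) auto
  show "(\<lambda>n. indicator {0..} x * (2 * m_weight n * (cosh x - cos (x * c_nat n)) * exp (- w * x))) sums
     (indicator {0..} x * ((tanh 1 * cosh x - (\<Sum>n. 2 * m_weight n * cos (x * c_nat n))) * exp (- w * x)))" for x
  proof -
    have "summable (\<lambda>n. 2 * m_weight n * cos (x * c_nat n))"
      by (rule summable_comparison_test'[OF sums_summable[OF m_weight_sums]])
        (use m_weight_nonneg in \<open>auto simp: abs_mult intro!: mult_left_le\<close>)
    from sums_mult[OF sums_mult2[OF sums_diff[OF sums_mult2[OF m_weight_sums, of "cosh x"] summable_sums[OF this]],
      of "exp (- w * x)"], of "indicator {0..} x"]
    show ?thesis by (simp add: algebra_simps)
  qed
  show "(\<lambda>n. 2 * (1 / w) * (c_nat n)\<^sup>2 / (1 + (1 / w)\<^sup>2 * (c_nat n)\<^sup>2) * (1 / (w\<^sup>2 - 1))) sums (tanh (1 / w) / (w\<^sup>2 - 1))"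
    using sums_mult2[OF tanh_sums[of "1 / w"], of "1 / (w\<^sup>2 - 1)"] by simp
qed

section \<open>The Levy-Khintchine exponent of M\<close>

lemma c_nat_le_1: "c_nat n \<le> 1"
  using c_nat_le[of n] by (rule order_trans) simp

lemma lk_exponent_M_meas: "lk_exponent 0 0 M_meas u = of_real (mu_exponent u)"
proof -
  let ?f = "\<lambda>x. indicator (- {0}) x *\<^sub>R (iexp (u * x) - 1 - \<i> * of_real (u * x / (1 + x\<^sup>2)))"
  have *: "norm (?f x) \<le> (u\<^sup>2 / 2 + \<bar>u\<bar>) * x\<^sup>2" if "\<bar>x\<bar> \<le> 1" for x
  proof -
    have pos: "1 + x\<^sup>2 > 0" by (simp add: add_pos_nonneg)
    \<comment> \<open>The compensator is compared with the Taylor term \<open>i u x\<close>. Their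
      difference is of third order, hence at most a multiple of \<open>x^2\<close> on
      \<open>[-1, 1]\<close>, where all atoms lie.\<close>
    have "u * x - u * x / (1 + x\<^sup>2) = u * x * (x\<^sup>2 / (1 + x\<^sup>2))"
      using pos by (simp add: field_simps)
    then have "\<i> * of_real (u * x) - \<i> * of_real (u * x / (1 + x\<^sup>2)) = \<i> * complex_of_real (u * x * (x\<^sup>2 / (1 + x\<^sup>2)))"
      by (simp only: of_real_diff[symmetric] right_diff_distrib[symmetric])
    then have eq: "iexp (u * x) - 1 - \<i> * of_real (u * x / (1 + x\<^sup>2)) =
       (iexp (u * x) - (1 + \<i> * of_real (u * x))) + \<i> * of_real (u * x * (x\<^sup>2 / (1 + x\<^sup>2)))"
      by (simp add: algebra_simps)
    have "cmod (iexp (u * x) - (1 + \<i> * of_real (u * x))) \<le> (u\<^sup>2 / 2) * x\<^sup>2"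
      using iexp_approx1[of "u * x" 1] by (simp add: power_mult_distrib flip: numeral_2_eq_2)
    moreover have "cmod (\<i> * of_real (u * x * (x\<^sup>2 / (1 + x\<^sup>2)))) \<le> \<bar>u\<bar> * x\<^sup>2"
    proof -
      have "x\<^sup>2 / (1 + x\<^sup>2) \<le> x\<^sup>2" using pos by (simp add: field_simps)
      then have "\<bar>u\<bar> * \<bar>x\<bar> * (x\<^sup>2 / (1 + x\<^sup>2)) \<le> \<bar>u\<bar> * 1 * x\<^sup>2"
        using that pos by (intro mult_mono) auto
      then show ?thesis using pos by (simp only: norm_mult norm_of_real) (simp add: abs_mult)
    qed
    ultimately have "cmod (iexp (u * x) - 1 - \<i> * of_real (u * x / (1 + x\<^sup>2))) \<le> (u\<^sup>2 / 2 + \<bar>u\<bar>) * x\<^sup>2"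
      unfolding eq distrib_right by (intro order_trans[OF norm_triangle_ineq] add_mono)
    then show ?thesis by (auto split: split_indicator)
  qed
  have sum: "summable (\<lambda>n. norm (?f (x n)))" if "\<And>n. \<bar>x n\<bar> = c_nat n" for x
  proof (rule summable_comparison_test'[OF summable_mult[OF summable_c_nat_sq, of "u\<^sup>2 / 2 + \<bar>u\<bar>"]])
    fix n show "norm (norm (?f (x n))) \<le> (u\<^sup>2 / 2 + \<bar>u\<bar>) * (c_nat n)\<^sup>2"
      using *[of "x n"] that[of n] c_nat_le_1[of n] by (metis norm_ge_zero abs_of_nonneg real_norm_def power2_abs)
  qed
  have "has_bochner_integral M_meas ?f (\<Sum>n. ?f (c_nat n) + ?f (- c_nat n))"
    by (rule has_bochner_integral_M_meas[OF _ sum sum]) (simp_all add: less_imp_le[OF c_nat_pos])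
  moreover have "(\<Sum>n. ?f (c_nat n) + ?f (- c_nat n)) = (\<Sum>n. of_real (2 * (cos (u * c_nat n) - 1)))"
    using c_nat_pos by (intro suminf_cong)
      (auto simp: complex_eq_iff Re_exp Im_exp less_le algebra_simps split: split_indicator)
  moreover have "\<dots> = of_real (mu_exponent u)"
    unfolding mu_exponent_def by (rule suminf_of_real[symmetric]) (rule sums_summable[OF mu_exponent_sums])
  ultimately show ?thesis
    by (simp add: lk_exponent_def set_lebesgue_integral_def has_bochner_integral_iff)
qed

lemma nn_integral_min_M_meas: "(\<integral>\<^sup>+x\<in>-{0}. ennreal (min 1 (x\<^sup>2)) \<partial>M_meas) < \<infinity>"
proof -
  let ?f = "\<lambda>x::real. indicator (- {0}) x * min 1 (x\<^sup>2)"
  have sum: "summable (\<lambda>n. norm (?f (x n)))" if "\<And>n. \<bar>x n\<bar> = c_nat n" for x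
  proof (rule summable_comparison_test'[OF summable_c_nat_sq])
    fix n show "norm (norm (?f (x n))) \<le> (c_nat n)\<^sup>2"
      using that[of n, symmetric] by (auto split: split_indicator)
  qed
  have "has_bochner_integral M_meas ?f (\<Sum>n. ?f (c_nat n) + ?f (- c_nat n))"
    by (rule has_bochner_integral_M_meas[OF _ sum sum]) (simp_all add: less_imp_le[OF c_nat_pos])
  then have "(\<integral>\<^sup>+x. ennreal (norm (?f x)) \<partial>M_meas) < \<infinity>"
    by (simp only: has_bochner_integral_iff integrable_iff_bounded)
  also have "(\<integral>\<^sup>+x. ennreal (norm (?f x)) \<partial>M_meas) = (\<integral>\<^sup>+x\<in>-{0}. ennreal (min 1 (x\<^sup>2)) \<partial>M_meas)"
    by (intro nn_integral_cong) (auto split: split_indicator)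
  finally show ?thesis .
qed

lemma levy_measure_M_meas: "levy_measure M_meas"
proof -
  have "emeasure M_meas {0} = 0"
    unfolding M_meas_eq by (subst emeasure_distr) (auto simp: vimage_def c_seq_nonzero)
  then show ?thesis
    using nn_integral_min_M_meas by (simp add: levy_measure_def)
qed

text \<open>\<open>tanh 1\<close> exceeds 0.76159 by about 4.2e-6, so little room remains below
  5e-6: in \<open>tanh 1 = 1 - 2 / (exp 2 + 1)\<close> the value of \<open>exp 2\<close> must be
  known to within about 3e-5. Fourteen Taylor terms with remainder factor
  \<open>exp 2 \<le> 9\<close> are accurate enough.\<close>

lemma tanh_1_approx: "\<bar>tanh 1 - (0.76159 :: real)\<bar> < 0.000005"
proof -
  have e: "\<bar>exp 2 - (\<Sum>m<14. 2 ^ m / fact m :: real)\<bar> \<le> 9 * 2 ^ 14 / fact 14"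
  proof -
    obtain t :: real where t: "\<bar>t\<bar> \<le> \<bar>2\<bar>" "exp 2 = (\<Sum>m<14. 2 ^ m / fact m) + exp t / fact 14 * 2 ^ 14"
      using Maclaurin_exp_le[of 2 14] by blast
    have "exp t \<le> exp 2" using t(1) by simp
    also have "exp 2 = exp 1 * exp (1 :: real)" by (simp flip: exp_add)
    also have "\<dots> \<le> 3 * 3" using exp_le by (intro mult_mono) auto
    finally have "exp t \<le> 9" by simp
    have "exp 2 - (\<Sum>m<14. 2 ^ m / fact m) = exp t / fact 14 * 2 ^ 14"
      using t(2) by linarith
    also have "\<bar>\<dots>\<bar> \<le> 9 * 2 ^ 14 / fact 14"
      using \<open>exp t \<le> 9\<close> by (simp add: divide_right_mono)
    finally show ?thesis .
  qed
  have "\<bar>exp 2 - (7.389056 :: real)\<bar> \<le> 0.00001"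
    using e unfolding abs_le_iff by (simp add: eval_nat_numeral lessThan_Suc fact_numeral)
  then have "exp 2 \<ge> (7.38904 :: real)" "exp 2 \<le> (7.38907 :: real)"
    unfolding abs_le_iff by simp_all
  moreover have "tanh 1 = 1 - 2 / (exp 2 + 1 :: real)"
  proof -
    have "exp (2 :: real) + 1 > 0" by (simp add: add_pos_pos)
    moreover have "exp (- 2) = 1 / exp (2 :: real)" by (simp add: exp_minus field_simps)
    moreover have "1 + exp (- 2 :: real) > 0" by (simp add: add_pos_pos)
    ultimately show ?thesis by (simp add: tanh_real_altdef divide_simps) (simp add: algebra_simps)
  qed
  moreover have "2 / (exp 2 + 1 :: real) \<le> 2 / 8.38904" "2 / (exp 2 + 1 :: real) \<ge> 2 / 8.38907"
    using calculation(1,2) by (simp_all add: pos_divide_le_eq pos_le_divide_eq)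
  ultimately show ?thesis by (simp add: abs_less_iff)
qed

section \<open>Characteristic functions and moments\<close>

text \<open>Fatou's lemma in the form in which moment bounds pass to limits: from difference
  quotients of characteristic functions, from partial sums, and from the integrals up to integer
  times.\<close>

lemma nn_integral_le_of_AE_lim:
  fixes f :: "nat \<Rightarrow> 'a \<Rightarrow> real"
  assumes [measurable]: "\<And>k. f k \<in> borel_measurable M"
    and lim: "AE x in M. (\<lambda>k. f k x) \<longlonglongrightarrow> g x"
    and le: "\<forall>\<^sub>F k in sequentially. (\<integral>\<^sup>+x. ennreal (f k x) \<partial>M) \<le> B"
  shows "(\<integral>\<^sup>+x. ennreal (g x) \<partial>M) \<le> B"
proof -
  have "(\<integral>\<^sup>+x. ennreal (g x) \<partial>M) = (\<integral>\<^sup>+x. liminf (\<lambda>k. ennreal (f k x)) \<partial>M)"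
    using lim
    by (intro nn_integral_cong_AE, elim AE_mp)
      (auto intro!: AE_I2 lim_imp_Liminf[symmetric] tendsto_ennrealI)
  also have "\<dots> \<le> liminf (\<lambda>k. \<integral>\<^sup>+x. ennreal (f k x) \<partial>M)"
    by (intro nn_integral_liminf) auto
  also have "\<dots> \<le> liminf (\<lambda>k::nat. B)"
    by (rule Liminf_mono[OF le])
  also have "\<dots> = B"
    by (rule Liminf_const) simp
  finally show ?thesis .
qed

text \<open>The sum of the functions has finite integral by monotone convergence, hence is finite
  almost everywhere.\<close>

lemma AE_summable_of_summable_integral:
  fixes f :: "nat \<Rightarrow> 'a \<Rightarrow> real"
  assumes [measurable]: "\<And>k. f k \<in> borel_measurable M" and nn: "\<And>k x. f k x \<ge> 0"
    and le: "\<And>k. (\<integral>\<^sup>+x. ennreal (f k x) \<partial>M) \<le> ennreal (b k)" and b: "\<And>k. b k \<ge> 0" "summable b"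
  shows "AE x in M. summable (\<lambda>k. f k x)"
proof -
  have "(\<integral>\<^sup>+x. (\<Sum>k. ennreal (f k x)) \<partial>M) = (\<Sum>k. \<integral>\<^sup>+x. ennreal (f k x) \<partial>M)"
    by (intro nn_integral_suminf) auto
  also have "\<dots> \<le> (\<Sum>k. ennreal (b k))"
    by (intro suminf_le le) auto
  also have "\<dots> < \<infinity>"
    using b by (simp add: suminf_ennreal2)
  finally have "AE x in M. (\<Sum>k. ennreal (f k x)) \<noteq> \<infinity>"
    by (intro nn_integral_PInf_AE) (auto simp: top_unique)
  then show ?thesis
    by (rule AE_mp) (auto intro!: AE_I2 summable_suminf_not_top nn)
qed

lemma LIMSEQ_of_subseq_gaps:
  fixes S :: "nat \<Rightarrow> real"
  assumes g: "strict_mono g" and S: "(\<lambda>m. S (g m)) \<longlonglongrightarrow> L" and T: "T \<longlonglongrightarrow> 0"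
    and gap: "\<And>m n. g m \<le> n \<Longrightarrow> n < g (Suc m) \<Longrightarrow> \<bar>S n - S (g m)\<bar> \<le> T m"
  shows "S \<longlonglongrightarrow> L"
proof (rule LIMSEQ_I)
  fix e :: real assume "e > 0"
  then have "\<forall>\<^sub>F m in sequentially. \<bar>S (g m) - L\<bar> < e / 2" "\<forall>\<^sub>F m in sequentially. \<bar>T m\<bar> < e / 2"
    using tendstoD[OF S, of "e / 2"] tendstoD[OF T, of "e / 2"] by (auto simp: dist_real_def)
  then obtain M where M: "\<And>m. m \<ge> M \<Longrightarrow> \<bar>S (g m) - L\<bar> < e / 2" "\<And>m. m \<ge> M \<Longrightarrow> \<bar>T m\<bar> < e / 2"
    unfolding eventually_sequentially by (metis nat_le_linear order_trans)
  have "norm (S n - L) < e" if n: "n \<ge> g M" for n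
  proof -
    \<comment> \<open>The index of the block that contains \<open>n\<close>. Minimality gives
      \<open>g m \<le> n\<close>, except at the first block, where this is the assumption on
      \<open>n\<close>.\<close>
    define m where "m = (LEAST m. n < g (Suc m))"
    have "n < g (Suc n)" using strict_mono_imp_increasing[OF g, of "Suc n"] by simp
    then have m: "n < g (Suc m)" unfolding m_def by (rule LeastI)
    have "M \<le> m"
      using n m strict_mono_less[OF g, of M "Suc m"] by simp
    have "g m \<le> n"
    proof (cases "m = M")
      case False
      with \<open>M \<le> m\<close> have "m - 1 < m" by simp
      then have "\<not> n < g (Suc (m - 1))" unfolding m_def by (rule not_less_Least)
      then show ?thesis using \<open>m - 1 < m\<close> by simp
    qed (use n in simp)
    have "\<bar>S n - S (g m)\<bar> < e / 2"
      using gap[OF \<open>g m \<le> n\<close> m] M(2)[OF \<open>M \<le> m\<close>] by linarith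
    then show ?thesis
      using M(1)[OF \<open>M \<le> m\<close>] unfolding real_norm_def by linarith
  qed
  then show "\<exists>no. \<forall>n\<ge>no. norm (S n - L) < e" by blast
qed

text \<open>The integrands differ by at most \<open>\<bar>u\<bar> * e\<close> where the variables
  are \<open>e\<close>-close and by at most 2 elsewhere. Convergence in probability thus passes to
  characteristic functions without extracting subsequences.\<close>

lemma norm_char_diff_le:
  assumes "prob_space P" and [measurable]: "X \<in> borel_measurable P" "Y \<in> borel_measurable P" and e: "e \<ge> 0"
  shows "norm (char (distr P borel X) u - char (distr P borel Y) u)
    \<le> \<bar>u\<bar> * e + 2 * measure P {\<omega>\<in>space P. \<bar>X \<omega> - Y \<omega>\<bar> > e}"
proof -
  interpret prob_space P by fact
  let ?A = "{\<omega>\<in>space P. \<bar>X \<omega> - Y \<omega>\<bar> > e}"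
  have int: "integrable P (\<lambda>\<omega>. iexp (u * X \<omega>))" "integrable P (\<lambda>\<omega>. iexp (u * Y \<omega>))"
    by (auto intro!: integrable_const_bound[of _ 1])
  have "norm (char (distr P borel X) u - char (distr P borel Y) u) =
      norm (\<integral>\<omega>. iexp (u * X \<omega>) - iexp (u * Y \<omega>) \<partial>P)"
    using int by (simp add: char_def integral_distr)
  also have "\<dots> \<le> (\<integral>\<omega>. norm (iexp (u * X \<omega>) - iexp (u * Y \<omega>)) \<partial>P)"
    by (rule integral_norm_bound)
  also have "\<dots> \<le> (\<integral>\<omega>. \<bar>u\<bar> * e + 2 * indicator ?A \<omega> \<partial>P)"
  proof (rule integral_mono)
    show "integrable P (\<lambda>\<omega>. norm (iexp (u * X \<omega>) - iexp (u * Y \<omega>)))"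
      using int by auto
    show "integrable P (\<lambda>\<omega>. \<bar>u\<bar> * e + 2 * indicator ?A \<omega>)"
      by (auto intro!: integrable_real_indicator simp: emeasure_eq_measure)
    fix \<omega> assume \<omega>: "\<omega> \<in> space P"
    show "norm (iexp (u * X \<omega>) - iexp (u * Y \<omega>)) \<le> \<bar>u\<bar> * e + 2 * indicator ?A \<omega>"
    proof (cases "\<omega> \<in> ?A")
      case True
      have "norm (iexp (u * X \<omega>) - iexp (u * Y \<omega>)) \<le> 1 + 1"
        by (rule order_trans[OF norm_triangle_ineq4]) simp
      also have "\<dots> \<le> \<bar>u\<bar> * e + 2 * indicator ?A \<omega>" using True e by simp
      finally show ?thesis .
    next
      case False
      have "iexp (u * X \<omega>) - iexp (u * Y \<omega>) = iexp (u * Y \<omega>) * (iexp (u * (X \<omega> - Y \<omega>)) - 1)"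
        by (simp add: algebra_simps flip: exp_add)
      then have "norm (iexp (u * X \<omega>) - iexp (u * Y \<omega>)) = norm (iexp (u * (X \<omega> - Y \<omega>)) - 1)"
        by (simp add: norm_mult)
      also have "\<dots> \<le> \<bar>u * (X \<omega> - Y \<omega>)\<bar>"
        using iexp_approx1[of "u * (X \<omega> - Y \<omega>)" 0] by simp
      also have "\<dots> \<le> \<bar>u\<bar> * e"
        unfolding abs_mult using False \<omega> by (intro mult_left_mono) auto
      finally show ?thesis using False by simp
    qed
  qed
  also have "\<dots> = \<bar>u\<bar> * e + 2 * measure P ?A"
    by (subst Bochner_Integration.integral_add)
      (auto intro!: integrable_real_indicator simp: emeasure_eq_measure prob_space)
  finally show ?thesis .
qed

lemma char_tendsto_of_AE_tendsto:
  assumes "prob_space P" and [measurable]: "\<And>n. X n \<in> borel_measurable P" "Z \<in> borel_measurable P"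
    and lim: "AE \<omega> in P. (\<lambda>n. X n \<omega>) \<longlonglongrightarrow> Z \<omega>"
  shows "(\<lambda>n. char (distr P borel (X n)) u) \<longlonglongrightarrow> char (distr P borel Z) u"
proof -
  interpret prob_space P by fact
  have "(\<lambda>n. \<integral>\<omega>. iexp (u * X n \<omega>) \<partial>P) \<longlonglongrightarrow> (\<integral>\<omega>. iexp (u * Z \<omega>) \<partial>P)"
  proof (rule integral_dominated_convergence[where w = "\<lambda>_. 1"])
    show "AE \<omega> in P. (\<lambda>n. iexp (u * X n \<omega>)) \<longlonglongrightarrow> iexp (u * Z \<omega>)"
      using lim by (rule AE_mp) (auto intro!: AE_I2 tendsto_intros)
  qed auto
  then show ?thesis by (simp add: char_def integral_distr)
qed

text \<open>\<open>2 * n^2 * (1 - cos (x / n))\<close> tends to \<open>x^2\<close>, and its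
  expectation is expressed by the characteristic function at \<open>1/n\<close>. Fatou's lemma
  yields the bound together with finiteness of the moment.\<close>

lemma second_moment_le_of_char:
  assumes "real_distribution M" and le: "\<And>u. 1 - Re (char M u) \<le> C * (u\<^sup>2 / 2)" and C: "C \<ge> 0"
  shows "(\<integral>\<^sup>+x. ennreal (x\<^sup>2) \<partial>M) \<le> ennreal C"
proof (rule nn_integral_le_of_AE_lim)
  interpret real_distribution M by fact
  let ?f = "\<lambda>k x. 2 * (real (Suc k))\<^sup>2 * (1 - cos (x / real (Suc k)))"
  show "?f k \<in> borel_measurable M" for k by measurable
  show "AE x in M. (\<lambda>k. ?f k x) \<longlonglongrightarrow> x\<^sup>2"
  proof (rule AE_I2)
    fix x :: real
    consider "x > 0" | "x = 0" | "x < 0" by linarith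
    then show "(\<lambda>k. ?f k x) \<longlonglongrightarrow> x\<^sup>2"
    proof cases
      case 1
      then show ?thesis by real_asymp (simp add: power2_eq_square)
    next
      case 3
      then show ?thesis by real_asymp (simp add: power2_eq_square)
    qed simp
  qed
  have "(\<integral>\<^sup>+x. ennreal (?f k x) \<partial>M) \<le> ennreal C" for k
  proof -
    define u where "u = 1 / real (Suc k)"
    have int: "integrable M (\<lambda>x. iexp (u * x))" by (auto intro!: integrable_iexp)
    then have Re: "integrable M (\<lambda>x. cos (u * x))" "Re (char M u) = (\<integral>x. cos (u * x) \<partial>M)"
      using integrable_Re[OF int] integral_Re[OF int] by (simp_all add: char_def Re_exp)
    have f: "?f k x = 2 * (real (Suc k))\<^sup>2 * (1 - cos (u * x))" for x
      by (simp add: u_def)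
    have "(\<integral>\<^sup>+x. ennreal (?f k x) \<partial>M) = ennreal (\<integral>x. ?f k x \<partial>M)"
      unfolding f by (intro nn_integral_eq_integral) (use Re in auto)
    also have "(\<integral>x. ?f k x \<partial>M) = 2 * (real (Suc k))\<^sup>2 * (1 - Re (char M u))"
      unfolding f Re(2) using Re(1) prob_space by simp
    also have "\<dots> \<le> 2 * (real (Suc k))\<^sup>2 * (C * (u\<^sup>2 / 2))"
      by (intro mult_left_mono le) auto
    also have "\<dots> = C" by (simp add: u_def power_divide)
    finally show ?thesis by (simp add: ennreal_leI)
  qed
  then show "\<forall>\<^sub>F k in sequentially. (\<integral>\<^sup>+x. ennreal (?f k x) \<partial>M) \<le> ennreal C" by simp
qed

lemma real_distribution_distr_borel:
  assumes "prob_space P" "X \<in> borel_measurable P"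
  shows "real_distribution (distr P borel X)"
  using assms by (auto simp: real_distribution_def real_distribution_axioms_def intro: prob_space.prob_space_distr)

lemma char_minus: "char (distr M borel uminus) u = cnj (char M u)" if "real_distribution M"
proof -
  interpret real_distribution M by fact
  have "char (distr M borel uminus) u = (\<integral>x. cnj (iexp (u * x)) \<partial>M)"
    unfolding char_def by (subst integral_distr) (auto simp: exp_cnj)
  then show ?thesis by (simp add: char_def)
qed

text \<open>Reflection conjugates the characteristic function, so a real one belongs to a symmetric
  law, whose mean equals its own negative.\<close>

lemma mean_zero_of_char_real:
  assumes "real_distribution M" and real: "\<And>u. Im (char M u) = 0"
  shows "(\<integral>x. x \<partial>M) = 0"
proof -
  interpret real_distribution M by fact
  have "distr M borel uminus = M"
  proof (rule Levy_uniqueness)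
    show "real_distribution (distr M borel uminus)"
      by (rule real_distribution_distr_borel) (auto intro: prob_space_axioms)
    show "char (distr M borel uminus) = char M"
      using real by (auto simp: char_minus[OF assms(1)] complex_eq_iff)
  qed fact
  then have "(\<integral>x. x \<partial>M) = (\<integral>x. x \<partial>distr M borel uminus)" by simp
  also have "\<dots> = (\<integral>x. - x \<partial>M)" by (subst integral_distr) auto
  finally show ?thesis by simp
qed

section \<open>Convolutions and symmetrised Poisson laws\<close>

lemma char_convolution:
  assumes "real_distribution M" "real_distribution N"
  shows "real_distribution (convolution M N)" "char (convolution M N) u = char M u * char N u"
proof -
  interpret M: real_distribution M by fact
  interpret N: real_distribution N by fact
  interpret MN: pair_prob_space M N ..
  show "real_distribution (convolution M N)"
    unfolding convolution_def
    by (rule real_distribution_distr_borel) (auto intro: MN.prob_space_axioms)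
  have int: "integrable (M \<Otimes>\<^sub>M N) (\<lambda>(x, y). iexp (u * x) * iexp (u * y))"
    by (auto intro!: MN.integrable_const_bound[of _ 1] simp: split_beta norm_mult)
  have "char (convolution M N) u = (\<integral>z. (case z of (x, y) \<Rightarrow> iexp (u * x) * iexp (u * y)) \<partial>(M \<Otimes>\<^sub>M N))"
    unfolding char_def convolution_def
    by (subst integral_distr) (auto simp: split_beta distrib_left exp_add intro!: Bochner_Integration.integral_cong)
  also have "\<dots> = (\<integral>x. \<integral>y. iexp (u * x) * iexp (u * y) \<partial>N \<partial>M)"
    using MN.integral_fst'[OF int] by simp
  also have "\<dots> = char M u * char N u"
    unfolding char_def by (subst integral_mult_right_zero) (subst integral_mult_left_zero, rule refl)
  finally show "char (convolution M N) u = char M u * char N u" .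
qed

lemma char_conv_power:
  assumes "real_distribution M"
  shows "real_distribution (conv_power k M)" "char (conv_power k M) u = char M u ^ k"
proof -
  have "real_distribution (conv_power k M) \<and> char (conv_power k M) u = char M u ^ k"
  proof (induction k)
    case 0
    have "real_distribution (return borel (0 :: real))"
      by (auto simp: real_distribution_def real_distribution_axioms_def prob_space_return)
    then show ?case by (simp add: char_def integral_return)
  next
    case (Suc k)
    then show ?case using char_convolution[OF assms, of "conv_power k M"] by simp
  qed
  then show "real_distribution (conv_power k M)" "char (conv_power k M) u = char M u ^ k" by auto
qed

lemma char_poisson:
  assumes "l > 0"
  shows "char (distr (measure_pmf (poisson_pmf l)) borel real) u = exp (of_real l * (iexp u - 1))"
proof -
  let ?p = "measure_pmf (poisson_pmf l)"
  have "char (distr ?p borel real) u = (\<integral>n. iexp (u * real n) \<partial>?p)"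
    unfolding char_def by (subst integral_distr) auto
  also have "\<dots> = (\<integral>n. (l ^ n / fact n * exp (- l)) *\<^sub>R iexp (u * real n) \<partial>count_space UNIV)"
    using assms unfolding measure_pmf_eq_density
    by (subst integral_density) auto
  also have "\<dots> = (\<Sum>n. (l ^ n / fact n * exp (- l)) *\<^sub>R iexp (u * real n))"
  proof (rule integral_count_space_nat)
    have "summable (\<lambda>n. l ^ n / fact n * exp (- l))"
      using summable_exp[of l] by (intro summable_mult2) (simp add: divide_inverse mult.commute)
    then show "integrable (count_space UNIV) (\<lambda>n. (l ^ n / fact n * exp (- l)) *\<^sub>R iexp (u * real n))"
      using assms unfolding integrable_count_space_nat_iff by simp
  qed
  also have "\<dots> = exp (- of_real l) * exp (of_real l * iexp u)"
  proof (rule sums_unique[symmetric])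
    have "(\<lambda>n. exp (- of_real l) * ((of_real l * iexp u) ^ n /\<^sub>R fact n)) sums (exp (- of_real l) * exp (of_real l * iexp u))"
      by (intro sums_mult exp_converges)
    moreover have "exp (- of_real l) * ((of_real l * iexp u) ^ n /\<^sub>R fact n) =
      (l ^ n / fact n * exp (- l)) *\<^sub>R iexp (u * real n)" for n
    proof -
      have "iexp u ^ n = iexp (u * real n)"
        by (simp add: exp_of_nat_mult[symmetric] mult_ac)
      moreover have "exp (- of_real l) = complex_of_real (exp (- l))"
        by (metis exp_of_real of_real_minus)
      ultimately have "exp (- of_real l) * ((of_real l * iexp u) ^ n /\<^sub>R fact n) =
        of_real (exp (- l)) * ((of_real l ^ n * iexp (u * real n)) /\<^sub>R fact n)"
        by (simp only: power_mult_distrib)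
      also have "\<dots> = (l ^ n / fact n * exp (- l)) *\<^sub>R iexp (u * real n)"
        by (simp add: scaleR_conv_of_real divide_inverse mult_ac)
      finally show ?thesis .
    qed
    ultimately show "(\<lambda>n. (l ^ n / fact n * exp (- l)) *\<^sub>R iexp (u * real n)) sums
      (exp (- of_real l) * exp (of_real l * iexp u))" by (simp only:)
  qed
  also have "\<dots> = exp (of_real l * (iexp u - 1))"
    by (simp add: algebra_simps flip: exp_add)
  finally show ?thesis .
qed

text \<open>A Poisson law convolved with its mirror image: the two exponents are conjugate, so twice
  the real part remains. It is also the compound Poisson law of rate \<open>2 * l\<close> with
  Rademacher jumps, which links \<open>l = 1\<close> to the parameter 2 in (d).\<close>

lemma exists_compound_poisson_rademacher:
  assumes l: "l > 0"
  shows "\<exists>M. real_distribution M \<and> (\<forall>u. char M u = of_real (exp (l * (2 * (cos u - 1)))))"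
proof -
  define A where "A = distr (measure_pmf (poisson_pmf l)) borel real"
  have A: "real_distribution A"
    unfolding A_def by (rule real_distribution_distr_borel) (auto intro: prob_space_measure_pmf)
  interpret A: real_distribution A by fact
  define M where "M = convolution A (distr A borel uminus)"
  have A': "real_distribution (distr A borel uminus)"
    by (rule real_distribution_distr_borel) (auto intro: A.prob_space_axioms)
  have "char M u = of_real (exp (l * (2 * (cos u - 1))))" for u
  proof -
    have "char M u = exp (of_real l * (iexp u - 1)) * cnj (exp (of_real l * (iexp u - 1)))"
      unfolding M_def char_convolution(2)[OF A A'] char_minus[OF A] by (simp add: A_def char_poisson[OF l])
    also have "\<dots> = exp (of_real l * (iexp u - 1) + cnj (of_real l * (iexp u - 1)))"
      by (simp only: exp_cnj[symmetric] exp_add)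
    also have "of_real l * (iexp u - 1) + cnj (of_real l * (iexp u - 1)) = of_real (l * (2 * (cos u - 1)))"
      by (simp add: complex_eq_iff Re_exp Im_exp)
    finally show ?thesis by (simp only: exp_of_real)
  qed
  moreover have "real_distribution M"
    unfolding M_def by (rule char_convolution(1)[OF A A'])
  ultimately show ?thesis by blast
qed

section \<open>Series of orthogonal random variables\<close>

text \<open>Almost sure and mean square convergence of the series use only orthogonality and the
  quadratic decay of the variances. Independence is kept for the characteristic function of the
  sum.\<close>

locale orthogonal_sequence = prob_space Q for Q :: "'b measure" +
  fixes X :: "nat \<Rightarrow> 'b \<Rightarrow> real" and K :: real
  assumes X_meas [measurable]: "X k \<in> borel_measurable Q"
    and X_sq: "integrable Q (\<lambda>\<omega>. (X k \<omega>)\<^sup>2)"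
    and X_orth: "i \<noteq> j \<Longrightarrow> expectation (\<lambda>\<omega>. X i \<omega> * X j \<omega>) = 0"
    and X_var: "expectation (\<lambda>\<omega>. (X k \<omega>)\<^sup>2) \<le> K / (real (Suc k))\<^sup>2"
    and K_nonneg: "K \<ge> 0"
begin

lemma integrable_X_mult: "integrable Q (\<lambda>\<omega>. X i \<omega> * X j \<omega>)"
proof (rule Bochner_Integration.integrable_bound)
  show "integrable Q (\<lambda>\<omega>. (X i \<omega>)\<^sup>2 + (X j \<omega>)\<^sup>2)"
    by (intro Bochner_Integration.integrable_add X_sq)
  have "\<bar>x * y\<bar> \<le> x\<^sup>2 + y\<^sup>2" for x y :: real
    using sum_squares_bound[of "\<bar>x\<bar>" "\<bar>y\<bar>"] mult_nonneg_nonneg[of "\<bar>x\<bar>" "\<bar>y\<bar>"]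
    unfolding abs_mult power2_abs by (simp only: mult.assoc) linarith
  then show "AE \<omega> in Q. norm (X i \<omega> * X j \<omega>) \<le> norm ((X i \<omega>)\<^sup>2 + (X j \<omega>)\<^sup>2)"
    by simp
qed measurable

lemma expectation_sum_sq:
  assumes "finite A"
  shows "integrable Q (\<lambda>\<omega>. (\<Sum>i\<in>A. X i \<omega>)\<^sup>2)"
    and "expectation (\<lambda>\<omega>. (\<Sum>i\<in>A. X i \<omega>)\<^sup>2) = (\<Sum>i\<in>A. expectation (\<lambda>\<omega>. (X i \<omega>)\<^sup>2))"
proof -
  have eq: "(\<Sum>i\<in>A. X i \<omega>)\<^sup>2 = (\<Sum>i\<in>A. \<Sum>j\<in>A. X i \<omega> * X j \<omega>)" for \<omega>
    by (simp add: power2_eq_square sum_product)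
  show "integrable Q (\<lambda>\<omega>. (\<Sum>i\<in>A. X i \<omega>)\<^sup>2)"
    unfolding eq by (intro Bochner_Integration.integrable_sum integrable_X_mult)
  have "expectation (\<lambda>\<omega>. (\<Sum>i\<in>A. X i \<omega>)\<^sup>2) = (\<Sum>i\<in>A. \<Sum>j\<in>A. expectation (\<lambda>\<omega>. X i \<omega> * X j \<omega>))"
    unfolding eq by (simp add: integrable_X_mult Bochner_Integration.integral_sum)
  also have "\<dots> = (\<Sum>i\<in>A. \<Sum>j\<in>A. if j = i then expectation (\<lambda>\<omega>. (X i \<omega>)\<^sup>2) else 0)"
    by (intro sum.cong) (auto simp: X_orth power2_eq_square)
  finally show "expectation (\<lambda>\<omega>. (\<Sum>i\<in>A. X i \<omega>)\<^sup>2) = (\<Sum>i\<in>A. expectation (\<lambda>\<omega>. (X i \<omega>)\<^sup>2))"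
    using assms by simp
qed

lemma nn_integral_sum_sq_le:
  assumes "finite A" "\<And>i. i \<in> A \<Longrightarrow> expectation (\<lambda>\<omega>. (X i \<omega>)\<^sup>2) \<le> b i"
  shows "(\<integral>\<^sup>+\<omega>. ennreal ((\<Sum>i\<in>A. X i \<omega>)\<^sup>2) \<partial>Q) \<le> ennreal (sum b A)"
  using assms
  by (subst nn_integral_eq_integral) (auto simp: expectation_sum_sq intro!: ennreal_leI sum_mono)

abbreviation (input) S :: "nat \<Rightarrow> 'b \<Rightarrow> real" where
  "S n \<omega> \<equiv> \<Sum>i<n. X i \<omega>"

text \<open>Between consecutive cubes \<open>n\<^sup>3\<close> there are so few terms that crude bounds suffice: the block sums
  are absolutely summable, and the sums of the absolute values inside the blocks tend to \<open>0\<close>.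
  No maximal inequality is needed.\<close>

lemma AE_summable_X: "AE \<omega> in Q. summable (\<lambda>i. X i \<omega>)"
proof -
  define B where "B m = {Suc m ^ 3 ..< Suc (Suc m) ^ 3}" for m :: nat
  define x where "x m = real (Suc m)" for m
  have x: "x m \<ge> 1" for m by (simp add: x_def)
  have card: "real (card (B m)) \<le> 7 * (x m)\<^sup>2" for m
  proof -
    \<comment> \<open>With \<open>x = m + 1\<close> this is
      \<open>3 x^2 + 3 x + 1 \<le> 7 x^2\<close>.\<close>
    have "Suc (Suc m) ^ 3 - Suc m ^ 3 \<le> 7 * (Suc m)\<^sup>2"
      by (simp add: power2_eq_square power3_eq_cube algebra_simps)
    then have "real (Suc (Suc m) ^ 3 - Suc m ^ 3) \<le> real (7 * (Suc m)\<^sup>2)"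
      by (simp only: of_nat_le_iff)
    then show ?thesis
      by (simp only: B_def card_atLeastLessThan x_def of_nat_mult of_nat_power of_nat_numeral)
  qed
  \<comment> \<open>Indices in block \<open>m\<close> are at least of size \<open>x^3\<close>, so
    each variance is of order \<open>x^(-6)\<close>, against at most \<open>7 x^2\<close>
    terms.\<close>
  have var: "expectation (\<lambda>\<omega>. (X i \<omega>)\<^sup>2) \<le> K / (x m) ^ 6" if "i \<in> B m" for i m
  proof -
    have "Suc m ^ 3 \<le> Suc i" using that by (simp add: B_def)
    then have "x m ^ 3 \<le> real (Suc i)" unfolding x_def by (metis of_nat_le_iff of_nat_power)
    then have "(x m ^ 3)\<^sup>2 \<le> (real (Suc i))\<^sup>2" using x[of m] by (intro power_mono) auto
    then have "x m ^ 6 \<le> (real (Suc i))\<^sup>2" by (simp flip: power_mult)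
    then have "K / (real (Suc i))\<^sup>2 \<le> K / x m ^ 6"
      using x[of m] K_nonneg by (intro divide_left_mono) auto
    then show ?thesis using X_var[of i] by linarith
  qed
  have fin: "finite (B m)" for m by (simp add: B_def)
  have sumvar: "(\<Sum>i\<in>B m. expectation (\<lambda>\<omega>. (X i \<omega>)\<^sup>2)) \<le> real (card (B m)) * (K / x m ^ 6)" for m
    using sum_bounded_above[of "B m" _ "K / x m ^ 6", OF var] by simp
  \<comment> \<open>One majorant for both block quantities: the signed sums need
    \<open>1 + 7 * K\<close>, the sums of absolute values \<open>49 * K\<close>.\<close>
  define b where "b m = (1 + 49 * K) * inverse ((x m)\<^sup>2)" for m
  have "summable (\<lambda>m. inverse ((x m)\<^sup>2))"
    unfolding x_def using inverse_power_summable[of 2, where ?'a = real]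
    by (subst summable_Suc_iff[of "\<lambda>n. inverse ((real n)\<^sup>2)"]) simp_all
  then have b: "summable b" "\<And>m. b m \<ge> 0"
    unfolding b_def using K_nonneg by (auto intro!: summable_mult)
  have D: "(\<integral>\<^sup>+\<omega>. ennreal \<bar>\<Sum>i\<in>B m. X i \<omega>\<bar> \<partial>Q) \<le> ennreal (b m)" for m
  proof -
    have "expectation (\<lambda>\<omega>. (\<Sum>i\<in>B m. X i \<omega>)\<^sup>2) \<le> real (card (B m)) * (K / x m ^ 6)"
      using sumvar by (simp only: expectation_sum_sq(2)[OF fin])
    also have "\<dots> \<le> 7 * (x m)\<^sup>2 * (K / x m ^ 6)"
      using card[of m] x[of m] K_nonneg by (intro mult_right_mono) auto
    finally have 1: "expectation (\<lambda>\<omega>. (\<Sum>i\<in>B m. X i \<omega>)\<^sup>2) \<le> 7 * (x m)\<^sup>2 * (K / x m ^ 6)" .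
    \<comment> \<open>A weighted arithmetic-geometric inequality. The block variance is of order
      \<open>x^(-4)\<close>, so the weight \<open>x^2\<close> makes both terms of order
      \<open>x^(-2)\<close>.\<close>
    have "\<bar>y\<bar> \<le> inverse ((x m)\<^sup>2) + (x m)\<^sup>2 * y\<^sup>2" for y :: real
    proof -
      have "2 * (x m * \<bar>y\<bar>) * inverse (x m) \<le> (x m * \<bar>y\<bar>)\<^sup>2 + (inverse (x m))\<^sup>2"
        by (rule sum_squares_bound)
      moreover have "2 * (x m * \<bar>y\<bar>) * inverse (x m) = 2 * \<bar>y\<bar>"
        using x[of m] by simp
      ultimately show ?thesis by (simp add: power_mult_distrib power_inverse)
    qed
    then have "(\<integral>\<^sup>+\<omega>. ennreal \<bar>\<Sum>i\<in>B m. X i \<omega>\<bar> \<partial>Q) \<le>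
        (\<integral>\<^sup>+\<omega>. ennreal (inverse ((x m)\<^sup>2) + (x m)\<^sup>2 * (\<Sum>i\<in>B m. X i \<omega>)\<^sup>2) \<partial>Q)"
      by (intro nn_integral_mono ennreal_leI)
    also have "\<dots> = ennreal (inverse ((x m)\<^sup>2) + (x m)\<^sup>2 * expectation (\<lambda>\<omega>. (\<Sum>i\<in>B m. X i \<omega>)\<^sup>2))"
      by (subst nn_integral_eq_integral) (auto simp: B_def expectation_sum_sq(1) prob_space)
    also have "\<dots> \<le> ennreal (b m)"
    proof (rule ennreal_leI)
      have "(x m)\<^sup>2 * expectation (\<lambda>\<omega>. (\<Sum>i\<in>B m. X i \<omega>)\<^sup>2) \<le> (x m)\<^sup>2 * (7 * (x m)\<^sup>2 * (K / x m ^ 6))"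
        by (intro mult_left_mono 1) simp
      also have "\<dots> = 7 * K * inverse ((x m)\<^sup>2)"
        using x[of m] by (simp add: field_simps flip: power_add)
      also have "\<dots> \<le> 49 * K * inverse ((x m)\<^sup>2)"
        using K_nonneg by (intro mult_right_mono) auto
      finally show "inverse ((x m)\<^sup>2) + (x m)\<^sup>2 * expectation (\<lambda>\<omega>. (\<Sum>i\<in>B m. X i \<omega>)\<^sup>2) \<le> b m"
        by (simp add: b_def distrib_right)
    qed
    finally show ?thesis .
  qed
  have T: "(\<integral>\<^sup>+\<omega>. ennreal ((\<Sum>i\<in>B m. \<bar>X i \<omega>\<bar>)\<^sup>2) \<partial>Q) \<le> ennreal (b m)" for m
  proof -
    \<comment> \<open>Cauchy-Schwarz costs one more factor \<open>card (B m)\<close>; with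
      \<open>x^2 * x^2\<close> against \<open>x^(-6)\<close> the bound is still summable.\<close>
    have "(\<integral>\<^sup>+\<omega>. ennreal ((\<Sum>i\<in>B m. \<bar>X i \<omega>\<bar>)\<^sup>2) \<partial>Q) \<le>
        (\<integral>\<^sup>+\<omega>. ennreal ((\<Sum>i\<in>B m. (X i \<omega>)\<^sup>2) * card (B m)) \<partial>Q)"
      using sum_squared_le_sum_of_squares[of "\<lambda>i. \<bar>X i _\<bar>" "B m"]
      by (intro nn_integral_mono ennreal_leI) simp
    also have "\<dots> = ennreal ((\<Sum>i\<in>B m. expectation (\<lambda>\<omega>. (X i \<omega>)\<^sup>2)) * card (B m))"
      by (subst nn_integral_eq_integral) (auto simp: X_sq sum_nonneg Bochner_Integration.integral_sum)
    also have "\<dots> \<le> ennreal (b m)"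
    proof (rule ennreal_leI)
      have "(\<Sum>i\<in>B m. expectation (\<lambda>\<omega>. (X i \<omega>)\<^sup>2)) * card (B m) \<le>
          (card (B m) * (K / x m ^ 6)) * card (B m)"
        by (intro mult_right_mono sumvar) simp
      also have "\<dots> \<le> (7 * (x m)\<^sup>2 * (K / x m ^ 6)) * (7 * (x m)\<^sup>2)"
        using card[of m] x[of m] K_nonneg by (intro mult_mono mult_right_mono) auto
      also have "\<dots> = 49 * K * inverse ((x m)\<^sup>2)"
        using x[of m] by (simp add: field_simps flip: power_add)
      also have "\<dots> \<le> b m"
        using x[of m] by (simp add: b_def distrib_right)
      finally show "(\<Sum>i\<in>B m. expectation (\<lambda>\<omega>. (X i \<omega>)\<^sup>2)) * card (B m) \<le> b m" .
    qed
    finally show ?thesis .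
  qed
  have "AE \<omega> in Q. summable (\<lambda>m. \<bar>\<Sum>i\<in>B m. X i \<omega>\<bar>)"
    by (rule AE_summable_of_summable_integral[OF _ _ D b(2) b(1)]) auto
  moreover have "AE \<omega> in Q. summable (\<lambda>m. (\<Sum>i\<in>B m. \<bar>X i \<omega>\<bar>)\<^sup>2)"
    by (rule AE_summable_of_summable_integral[OF _ _ T b(2) b(1)]) auto
  ultimately show ?thesis
  proof eventually_elim
    case (elim \<omega>)
    define g where "g m = Suc m ^ 3" for m :: nat
    have mono: "strict_mono g"
      unfolding g_def by (intro strict_monoI power_strict_mono) auto
    have split: "(\<Sum>i<n. X i \<omega>) - (\<Sum>i<g m. X i \<omega>) = (\<Sum>i\<in>{g m..<n}. X i \<omega>)" if "g m \<le> n" for m n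
      using sum_diff_nat_ivl[of 0 "g m" n "\<lambda>i. X i \<omega>"] that by (simp add: lessThan_atLeast0)
    have blocks: "(\<Sum>i<g 0. X i \<omega>) + (\<Sum>j<m. \<Sum>i\<in>B j. X i \<omega>) = (\<Sum>i<g m. X i \<omega>)" for m
    proof (induction m)
      case (Suc m)
      have "g m \<le> g (Suc m)" using strict_mono_less_eq[OF mono] by simp
      from split[OF this] Suc show ?case by (simp add: B_def g_def)
    qed simp
    have "summable (\<lambda>m. \<Sum>i\<in>B m. X i \<omega>)"
      using elim(1) by (rule summable_rabs_cancel)
    then have "(\<lambda>m. (\<Sum>i<g 0. X i \<omega>) + (\<Sum>j<m. \<Sum>i\<in>B j. X i \<omega>)) \<longlonglongrightarrow> (\<Sum>i<g 0. X i \<omega>) + (\<Sum>m. \<Sum>i\<in>B m. X i \<omega>)"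
      by (intro tendsto_intros summable_LIMSEQ)
    then have 1: "(\<lambda>m. \<Sum>i<g m. X i \<omega>) \<longlonglongrightarrow> (\<Sum>i<g 0. X i \<omega>) + (\<Sum>m. \<Sum>i\<in>B m. X i \<omega>)"
      by (simp only: blocks)
    have "(\<lambda>m. sqrt ((\<Sum>i\<in>B m. \<bar>X i \<omega>\<bar>)\<^sup>2)) \<longlonglongrightarrow> sqrt 0"
      by (intro tendsto_real_sqrt summable_LIMSEQ_zero elim)
    then have 2: "(\<lambda>m. \<Sum>i\<in>B m. \<bar>X i \<omega>\<bar>) \<longlonglongrightarrow> 0"
      by (simp add: sum_nonneg)
    have "(\<lambda>n. \<Sum>i<n. X i \<omega>) \<longlonglongrightarrow> (\<Sum>i<g 0. X i \<omega>) + (\<Sum>m. \<Sum>i\<in>B m. X i \<omega>)"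
    proof (rule LIMSEQ_of_subseq_gaps[OF mono 1 2])
      fix m n assume mn: "g m \<le> n" "n < g (Suc m)"
      have "\<bar>\<Sum>i\<in>{g m..<n}. X i \<omega>\<bar> \<le> (\<Sum>i\<in>{g m..<n}. \<bar>X i \<omega>\<bar>)"
        by (rule sum_abs)
      also have "\<dots> \<le> (\<Sum>i\<in>B m. \<bar>X i \<omega>\<bar>)"
        using mn by (intro sum_mono2) (auto simp: B_def g_def)
      finally show "\<bar>(\<Sum>i<n. X i \<omega>) - (\<Sum>i<g m. X i \<omega>)\<bar> \<le> (\<Sum>i\<in>B m. \<bar>X i \<omega>\<bar>)"
        by (simp only: split[OF mn(1)])
    qed
    then show ?case by (auto simp: summable_def sums_def)
  qed
qed

abbreviation (input) Z :: "'b \<Rightarrow> real" where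
  "Z \<omega> \<equiv> \<Sum>i. X i \<omega>"

lemma AE_LIMSEQ_S: "AE \<omega> in Q. (\<lambda>n. S n \<omega>) \<longlonglongrightarrow> Z \<omega>"
  using AE_summable_X by eventually_elim (rule summable_LIMSEQ)

lemma summable_var_bound: "summable (\<lambda>k. K / (real (Suc k))\<^sup>2)"
proof -
  have "summable (\<lambda>m. inverse ((real (Suc m))\<^sup>2))"
    using inverse_power_summable[of 2, where ?'a = real]
    by (subst summable_Suc_iff[of "\<lambda>n. inverse ((real n)\<^sup>2)"]) simp_all
  then show ?thesis using summable_mult[of _ K] by (simp add: divide_inverse)
qed

text \<open>Fatou's lemma as the upper index grows: by orthogonality the second moment of a finite
  block is a sum of variances. The case \<open>n = 0\<close> shows that the limit is square
  integrable.\<close>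

lemma nn_integral_tail_le:
  "(\<integral>\<^sup>+\<omega>. ennreal ((S n \<omega> - Z \<omega>)\<^sup>2) \<partial>Q) \<le> ennreal (\<Sum>k. K / (real (Suc (k + n)))\<^sup>2)"
proof (rule nn_integral_le_of_AE_lim)
  show "AE \<omega> in Q. (\<lambda>m. (S n \<omega> - S m \<omega>)\<^sup>2) \<longlonglongrightarrow> (S n \<omega> - Z \<omega>)\<^sup>2"
    using AE_LIMSEQ_S by eventually_elim (intro tendsto_intros)
  show "\<forall>\<^sub>F m in sequentially. (\<integral>\<^sup>+\<omega>. ennreal ((S n \<omega> - S m \<omega>)\<^sup>2) \<partial>Q) \<le> ennreal (\<Sum>k. K / (real (Suc (k + n)))\<^sup>2)"
    using eventually_ge_at_top[of n]
  proof eventually_elim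
    case (elim m)
    have "(S n \<omega> - S m \<omega>)\<^sup>2 = (\<Sum>i\<in>{n..<m}. X i \<omega>)\<^sup>2" for \<omega>
      using sum_diff_nat_ivl[of 0 n m "\<lambda>i. X i \<omega>"] elim
      by (subst power2_commute) (simp add: lessThan_atLeast0)
    then have "(\<integral>\<^sup>+\<omega>. ennreal ((S n \<omega> - S m \<omega>)\<^sup>2) \<partial>Q) \<le> ennreal (\<Sum>i\<in>{n..<m}. K / (real (Suc i))\<^sup>2)"
      by (simp only:) (intro nn_integral_sum_sq_le X_var finite_atLeastLessThan)
    also have "(\<Sum>i\<in>{n..<m}. K / (real (Suc i))\<^sup>2) = (\<Sum>k<m - n. K / (real (Suc (k + n)))\<^sup>2)"
      using elim sum.shift_bounds_nat_ivl[of "\<lambda>i. K / (real (Suc i))\<^sup>2" 0 n "m - n"]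
      by (simp add: lessThan_atLeast0)
    also have "\<dots> \<le> (\<Sum>k. K / (real (Suc (k + n)))\<^sup>2)"
      using K_nonneg summable_var_bound
      by (intro sum_le_suminf) (auto simp: summable_iff_shift[of "\<lambda>k. K / (real (Suc k))\<^sup>2"] simp del: of_nat_Suc)
    finally show ?case by (auto simp: ennreal_leI)
  qed
qed measurable

lemma L2_LIMSEQ: "(\<lambda>n. \<integral>\<^sup>+\<omega>. ennreal ((S n \<omega> - Z \<omega>)\<^sup>2) \<partial>Q) \<longlonglongrightarrow> 0"
proof (rule tendsto_sandwich[OF _ _ tendsto_const])
  show "\<forall>\<^sub>F n in sequentially. (\<integral>\<^sup>+\<omega>. ennreal ((S n \<omega> - Z \<omega>)\<^sup>2) \<partial>Q) \<le> ennreal (\<Sum>k. K / (real (Suc (k + n)))\<^sup>2)"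
    by (intro always_eventually allI nn_integral_tail_le)
  show "(\<lambda>n. ennreal (\<Sum>k. K / (real (Suc (k + n)))\<^sup>2)) \<longlonglongrightarrow> 0"
    using tendsto_ennrealI[OF suminf_exist_split2[OF summable_var_bound]] by simp
qed simp

lemma integrable_Z_sq: "integrable Q (\<lambda>\<omega>. (Z \<omega>)\<^sup>2)"
proof (rule integrableI_bounded)
  have "(\<integral>\<^sup>+\<omega>. ennreal (norm ((Z \<omega>)\<^sup>2)) \<partial>Q) = (\<integral>\<^sup>+\<omega>. ennreal ((S 0 \<omega> - Z \<omega>)\<^sup>2) \<partial>Q)" by simp
  also have "\<dots> \<le> ennreal (\<Sum>k. K / (real (Suc (k + 0)))\<^sup>2)"
    by (rule nn_integral_tail_le)
  also have "\<dots> < \<infinity>" by simp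
  finally show "(\<integral>\<^sup>+\<omega>. ennreal (norm ((Z \<omega>)\<^sup>2)) \<partial>Q) < \<infinity>" .
qed measurable

end

section \<open>Existence of the law\<close>

text \<open>Only characteristic functions are known. Their quadratic bound gives second moments at
  most \<open>2 * l\<close>, their reality gives mean zero, and independence then gives
  orthogonality. The same lemma provides the existence of the laws and the series in (d).\<close>

lemma compound_poisson_series:
  fixes Y :: "nat \<Rightarrow> 'b \<Rightarrow> real"
  assumes Q: "prob_space Q" and indep: "prob_space.indep_vars Q (\<lambda>_. borel) Y UNIV"
    and char: "\<And>k u. char (distr Q borel (Y k)) u = of_real (exp (l * (2 * (cos u - 1))))" and l: "l \<ge> 0"
  shows "orthogonal_sequence Q (\<lambda>k \<omega>. c_nat k * Y k \<omega>) (2 * l)"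
    and "char (distr Q borel (\<lambda>\<omega>. \<Sum>k. c_nat k * Y k \<omega>)) u = of_real (exp (l * mu_exponent u))"
proof -
  interpret prob_space Q by fact
  have [measurable]: "Y k \<in> borel_measurable Q" for k
    using indep by (simp add: indep_vars_def2)
  have law: "real_distribution (distr Q borel (Y k))" for k
    by (rule real_distribution_distr_borel[OF Q]) measurable
  have "1 - Re (char (distr Q borel (Y k)) u) \<le> 2 * l * (u\<^sup>2 / 2)" for k u
  proof -
    have "1 + l * (2 * (cos u - 1)) \<le> exp (l * (2 * (cos u - 1)))"
      by (rule exp_ge_add_one_self)
    moreover have "2 * l * (1 - cos u) \<le> 2 * l * (u\<^sup>2 / 2)"
      using l by (intro mult_left_mono one_minus_cos_le) auto
    ultimately show ?thesis by (simp add: char algebra_simps)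
  qed
  then have "(\<integral>\<^sup>+x. ennreal (x\<^sup>2) \<partial>distr Q borel (Y k)) \<le> ennreal (2 * l)" for k
    using l by (intro second_moment_le_of_char law) auto
  then have nn: "(\<integral>\<^sup>+\<omega>. ennreal ((Y k \<omega>)\<^sup>2) \<partial>Q) \<le> ennreal (2 * l)" for k
    by (subst (asm) nn_integral_distr) auto
  have sq: "integrable Q (\<lambda>\<omega>. (Y k \<omega>)\<^sup>2)" for k
    using le_less_trans[OF nn[of k]] by (intro integrableI_bounded) auto
  have var: "expectation (\<lambda>\<omega>. (Y k \<omega>)\<^sup>2) \<le> 2 * l" for k
    using nn[of k] l by (subst (asm) nn_integral_eq_integral) (auto simp: sq)
  have int: "integrable Q (Y k)" for k
    by (rule square_integrable_imp_integrable[OF _ sq]) measurable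
  have "(\<integral>x. x \<partial>distr Q borel (Y k)) = 0" for k
    using law by (rule mean_zero_of_char_real) (simp add: char)
  then have mean: "expectation (Y k) = 0" for k
    by (subst (asm) integral_distr) auto
  show orth: "orthogonal_sequence Q (\<lambda>k \<omega>. c_nat k * Y k \<omega>) (2 * l)"
  proof
    show "(\<lambda>\<omega>. c_nat k * Y k \<omega>) \<in> borel_measurable Q" for k by measurable
    show "integrable Q (\<lambda>\<omega>. (c_nat k * Y k \<omega>)\<^sup>2)" for k
      using sq by (simp add: power_mult_distrib)
    show "expectation (\<lambda>\<omega>. c_nat i * Y i \<omega> * (c_nat j * Y j \<omega>)) = 0" if "i \<noteq> j" for i j
    proof -
      have "expectation (\<lambda>\<omega>. \<Prod>k\<in>{i, j}. Y k \<omega>) = (\<Prod>k\<in>{i, j}. expectation (Y k))"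
        by (intro indep_vars_lebesgue_integral int indep_vars_subset[OF indep]) auto
      then have "expectation (\<lambda>\<omega>. Y i \<omega> * Y j \<omega>) = 0"
        using that by (simp add: mean)
      moreover have "c_nat i * Y i \<omega> * (c_nat j * Y j \<omega>) = (c_nat i * c_nat j) * (Y i \<omega> * Y j \<omega>)" for \<omega>
        by (simp add: mult_ac)
      ultimately show ?thesis by (simp only: integral_mult_right_zero mult_zero_right)
    qed
    show "expectation (\<lambda>\<omega>. (c_nat k * Y k \<omega>)\<^sup>2) \<le> 2 * l / (real (Suc k))\<^sup>2" for k
    proof -
      have "(c_nat k)\<^sup>2 \<le> (1 / real (Suc k))\<^sup>2"
        using c_nat_le[of k] c_nat_pos[of k] by (intro power_mono) (auto simp: add.commute)
      then have "(c_nat k)\<^sup>2 * expectation (\<lambda>\<omega>. (Y k \<omega>)\<^sup>2) \<le> (1 / real (Suc k))\<^sup>2 * (2 * l)"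
        using l by (intro mult_mono var) auto
      then show ?thesis by (simp add: power_mult_distrib power_divide)
    qed
    show "0 \<le> 2 * l" using l by simp
  qed
  interpret orthogonal_sequence Q "\<lambda>k \<omega>. c_nat k * Y k \<omega>" "2 * l" by (rule orth)
  have "(\<lambda>n. char (distr Q borel (\<lambda>\<omega>. \<Sum>k<n. c_nat k * Y k \<omega>)) u) \<longlonglongrightarrow>
      char (distr Q borel (\<lambda>\<omega>. \<Sum>k. c_nat k * Y k \<omega>)) u"
    by (rule char_tendsto_of_AE_tendsto[OF Q _ _ AE_LIMSEQ_S]) measurable
  moreover have "char (distr Q borel (\<lambda>\<omega>. \<Sum>k<n. c_nat k * Y k \<omega>)) u =
      of_real (exp (l * (\<Sum>k<n. 2 * (cos (u * c_nat k) - 1))))" for n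
  proof -
    have "char (distr Q borel (\<lambda>\<omega>. \<Sum>k<n. c_nat k * Y k \<omega>)) u =
        (\<Prod>k<n. char (distr Q borel (\<lambda>\<omega>. c_nat k * Y k \<omega>)) u)"
      by (intro char_distr_sum indep_vars_compose2[where Y = "\<lambda>k x. c_nat k * x", OF indep_vars_subset[OF indep]]) auto
    also have "\<dots> = (\<Prod>k<n. char (distr Q borel (Y k)) (u * c_nat k))"
      by (simp add: char_def integral_distr mult_ac)
    also have "\<dots> = of_real (exp (l * (\<Sum>k<n. 2 * (cos (u * c_nat k) - 1))))"
      by (simp only: char of_real_prod[symmetric] exp_sum[OF finite_lessThan, symmetric] sum_distrib_left)
    finally show ?thesis .
  qed
  moreover have "(\<lambda>n. complex_of_real (exp (l * (\<Sum>k<n. 2 * (cos (u * c_nat k) - 1))))) \<longlonglongrightarrow> of_real (exp (l * mu_exponent u))"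
    using mu_exponent_sums[of u] unfolding sums_def by (intro tendsto_intros)
  ultimately show "char (distr Q borel (\<lambda>\<omega>. \<Sum>k. c_nat k * Y k \<omega>)) u = of_real (exp (l * mu_exponent u))"
    using LIMSEQ_unique by force
qed

text \<open>The joint law of all coordinates is the product measure itself, since collecting them is
  the identity map.\<close>

lemma indep_vars_PiM_coordinates:
  assumes "\<And>i. i \<in> I \<Longrightarrow> prob_space (N i)" "I \<noteq> {}"
  shows "prob_space.indep_vars (PiM I N) N (\<lambda>i \<omega>. \<omega> i) I"
proof -
  interpret P: prob_space "PiM I N" by (rule prob_space_PiM) fact
  have "distr (PiM I N) (PiM I N) (\<lambda>\<omega>. \<lambda>i\<in>I. \<omega> i) = distr (PiM I N) (PiM I N) (\<lambda>\<omega>. \<omega>)"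
    by (intro distr_cong) (auto simp: space_PiM PiE_iff extensional_def restrict_def fun_eq_iff)
  also have "\<dots> = PiM I N" by (rule distr_id)
  also have "\<dots> = PiM I (\<lambda>i. distr (PiM I N) (N i) (\<lambda>\<omega>. \<omega> i))"
    by (intro PiM_cong) (auto simp: distr_PiM_component assms)
  finally show ?thesis
    using assms by (subst P.indep_vars_iff_distr_eq_PiM') auto
qed

lemma exists_law_exp_mu_exponent:
  assumes "l > 0"
  shows "\<exists>M. real_distribution M \<and> (\<forall>u. char M u = of_real (exp (l * mu_exponent u)))"
proof -
  obtain N where N: "real_distribution N" "\<And>u. char N u = of_real (exp (l * (2 * (cos u - 1))))"
    using exists_compound_poisson_rademacher[OF assms] by blast
  interpret N: real_distribution N by fact
  define Q where "Q = PiM UNIV (\<lambda>_ :: nat. N)"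
  interpret Q: prob_space Q unfolding Q_def by (rule prob_space_PiM) (rule N.prob_space_axioms)
  have meas [measurable]: "(\<lambda>\<omega>. \<omega> k) \<in> borel_measurable Q" for k
    using measurable_component_singleton[of k UNIV "\<lambda>_. N"]
    unfolding Q_def measurable_cong_sets[OF refl N.events_eq_borel] by simp
  have "Q.indep_vars (\<lambda>_. N) (\<lambda>k \<omega>. \<omega> k) UNIV"
    unfolding Q_def by (rule indep_vars_PiM_coordinates) (auto intro: N.prob_space_axioms)
  then have "Q.indep_vars (\<lambda>_. borel) (\<lambda>k \<omega>. \<omega> k) UNIV"
    by (rule Q.indep_vars_compose2[where Y = "\<lambda>_ x. x"]) simp
  moreover have "distr Q borel (\<lambda>\<omega>. \<omega> k) = N" for k
  proof -
    have "distr Q borel (\<lambda>\<omega>. \<omega> k) = distr Q N (\<lambda>\<omega>. \<omega> k)"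
      by (intro distr_cong) auto
    also have "\<dots> = N"
      unfolding Q_def by (rule distr_PiM_component) (auto intro: N.prob_space_axioms)
    finally show ?thesis .
  qed
  ultimately have "char (distr Q borel (\<lambda>\<omega>. \<Sum>k. c_nat k * \<omega> k)) u = of_real (exp (l * mu_exponent u))" for u
    using assms N(2) by (intro compound_poisson_series(2) Q.prob_space_axioms) auto
  moreover have "real_distribution (distr Q borel (\<lambda>\<omega>. \<Sum>k. c_nat k * \<omega> k))"
    by (rule real_distribution_distr_borel) (auto intro: Q.prob_space_axioms)
  ultimately show ?thesis by blast
qed

lemma exists_triplet: "\<exists>\<mu>. has_lk_triplet \<mu> 0 0 M_meas"
proof -
  obtain \<mu> where \<mu>: "real_distribution \<mu>" "\<And>u. char \<mu> u = of_real (exp (1 * mu_exponent u))"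
    using exists_law_exp_mu_exponent[of 1] by auto
  have "\<exists>\<nu>. real_distribution \<nu> \<and> conv_power k \<nu> = \<mu>" if "k \<ge> 2" for k
  proof -
    have "1 / real k > 0" using that by simp
    from exists_law_exp_mu_exponent[OF this] obtain \<nu>
      where \<nu>: "real_distribution \<nu>" "\<And>u. char \<nu> u = of_real (exp (1 / k * mu_exponent u))"
      by blast
    have "conv_power k \<nu> = \<mu>"
    proof (rule Levy_uniqueness)
      show "real_distribution (conv_power k \<nu>)" by (rule char_conv_power) fact
      have "char (conv_power k \<nu>) u = char \<mu> u" for u
      proof -
        have "char (conv_power k \<nu>) u = of_real (exp (1 / k * mu_exponent u) ^ k)"
          by (simp only: char_conv_power(2)[OF \<nu>(1)] \<nu>(2) of_real_power)
        also have "exp (1 / k * mu_exponent u) ^ k = exp (1 * mu_exponent u)"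
          using that by (simp flip: exp_of_nat_mult)
        finally show ?thesis by (simp only: \<mu>(2))
      qed
      then show "char (conv_power k \<nu>) = char \<mu>" by blast
    qed fact
    then show ?thesis using \<nu>(1) by blast
  qed
  then have "infinitely_divisible \<mu>" using \<mu>(1) by (simp add: infinitely_divisible_def)
  moreover have "char \<mu> u = exp (lk_exponent 0 0 M_meas u)" for u
    by (simp only: \<mu>(2) lk_exponent_M_meas exp_of_real mult_1_left)
  ultimately show ?thesis
    using levy_measure_M_meas by (auto simp: has_lk_triplet_def)
qed

lemma has_lk_triplet_unique:
  assumes "has_lk_triplet \<mu> a v M" "has_lk_triplet \<nu> a v M"
  shows "\<mu> = \<nu>"
  using assms by (intro Levy_uniqueness) (auto simp: has_lk_triplet_def infinitely_divisible_def)

text \<open>Existence and uniqueness together make the definite description in \<open>lk_law\<close>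
  denote an actual law.\<close>

lemma has_lk_triplet_mu_law: "has_lk_triplet \<mu>_law 0 0 M_meas"
  unfolding \<mu>_law_def lk_law_def
  using exists_triplet has_lk_triplet_unique by (metis (mono_tags, lifting) theI)

lemma real_distribution_mu_law: "real_distribution \<mu>_law"
  using has_lk_triplet_mu_law by (simp add: has_lk_triplet_def infinitely_divisible_def)

lemma char_mu_law: "char \<mu>_law u = of_real (exp (mu_exponent u))"
  using has_lk_triplet_mu_law by (simp add: has_lk_triplet_def lk_exponent_M_meas exp_of_real)

lemma clog_exp_of_real:
  assumes "continuous_on UNIV g" "g 0 = 0" "\<And>u. f u = of_real (exp (g u))"
  shows "clog f = (\<lambda>u. complex_of_real (g u))"
  using assms by (intro clog_eqI) (auto intro: continuous_on_of_real simp: exp_of_real)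

lemma clog_cnj_char_mu_law: "clog (\<lambda>s. cnj (char \<mu>_law s)) = (\<lambda>s. of_real (mu_exponent s))"
  by (rule clog_exp_of_real) (auto simp: continuous_on_mu_exponent char_mu_law)

section \<open>Riemann sums of right-continuous functions\<close>

text \<open>A continuous function on the line with finitely many values is constant. This picks the
  right n-th root of a characteristic function.\<close>

lemma continuous_root_of_unity_eq_1:
  fixes f :: "real \<Rightarrow> complex"
  assumes "continuous_on UNIV f" "f 0 = 1" "n > 0" "\<And>x. f x ^ n = 1"
  shows "f x = 1"
proof -
  have "finite (f ` UNIV)"
    by (rule finite_subset[OF _ finite_roots_unity[of n, where ?'a = complex]]) (use assms in auto)
  then have "f constant_on UNIV"
    by (intro continuous_finite_range_constant assms) auto
  then show ?thesis using assms(2) by (metis UNIV_I constant_on_def)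
qed

text \<open>One-sided limits bound the function near each point, and bisection joins the local
  bounds.\<close>

lemma regulated_bounded:
  fixes f :: "real \<Rightarrow> real"
  assumes right: "\<And>t. 0 \<le> t \<Longrightarrow> \<exists>l. (f \<longlongrightarrow> l) (at_right t)"
    and left: "\<And>t. 0 < t \<Longrightarrow> \<exists>l. (f \<longlongrightarrow> l) (at_left t)" and "0 \<le> T"
  shows "\<exists>B. \<forall>t\<in>{0..T}. \<bar>f t\<bar> \<le> B"
proof -
  \<comment> \<open>The guard \<open>0 \<le> t\<close> is there because bisection also tests
    intervals reaching below \<open>0\<close>, where nothing is known about
    \<open>f\<close>.\<close>
  define P where "P x y \<longleftrightarrow> (\<exists>B. \<forall>t\<in>{x..y}. 0 \<le> t \<longrightarrow> \<bar>f t\<bar> \<le> B)" for x y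
  have bdd: "\<forall>\<^sub>F s in F. \<bar>f s\<bar> \<le> \<bar>l\<bar> + 1" if "(f \<longlongrightarrow> l) F" for l F
    using tendstoD[OF that, of 1] by (auto elim!: eventually_mono simp: dist_real_def)
  have "P 0 T"
    using \<open>0 \<le> T\<close>
  proof (induction rule: Bolzano)
    case (trans a b c)
    then obtain B1 B2 where "\<forall>t\<in>{a..b}. 0 \<le> t \<longrightarrow> \<bar>f t\<bar> \<le> B1" "\<forall>t\<in>{b..c}. 0 \<le> t \<longrightarrow> \<bar>f t\<bar> \<le> B2"
      unfolding P_def by blast
    then have "\<forall>t\<in>{a..c}. 0 \<le> t \<longrightarrow> \<bar>f t\<bar> \<le> max B1 B2"
      by (metis atLeastAtMost_iff le_max_iff_disj linear)
    then show ?case unfolding P_def by blast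
  next
    case (local x)
    obtain l where "(f \<longlongrightarrow> l) (at_right x)" using right local by blast
    from bdd[OF this] obtain r where r: "r > x" "\<And>y. x < y \<Longrightarrow> y < r \<Longrightarrow> \<bar>f y\<bar> \<le> \<bar>l\<bar> + 1"
      unfolding eventually_at_right_field by blast
    have "\<exists>q<x. \<exists>B. \<forall>y. q < y \<longrightarrow> y < x \<longrightarrow> 0 \<le> y \<longrightarrow> \<bar>f y\<bar> \<le> B"
    proof (cases "x = 0")
      case True
      \<comment> \<open>Left of \<open>0\<close> the guard makes the claim vacuous, so any negative
        \<open>q\<close> serves.\<close>
      then show ?thesis by (intro exI[of _ "-1"]) auto
    next
      case False
      then obtain l' where "(f \<longlongrightarrow> l') (at_left x)" using left local by force
      from bdd[OF this] show ?thesis unfolding eventually_at_left_field by blast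
    qed
    then obtain q B where q: "q < x" "\<And>y. q < y \<Longrightarrow> y < x \<Longrightarrow> 0 \<le> y \<Longrightarrow> \<bar>f y\<bar> \<le> B" by blast
    show ?case
    proof (intro exI[of _ "min (r - x) (x - q)"] conjI allI impI)
      show "0 < min (r - x) (x - q)" using r q by simp
      fix a b assume ab: "a \<le> x \<and> x \<le> b \<and> b - a < min (r - x) (x - q)"
      have "\<bar>f t\<bar> \<le> max B (max (\<bar>l\<bar> + 1) \<bar>f x\<bar>)" if "t \<in> {a..b}" "0 \<le> t" for t
      proof -
        consider "t < x" | "t = x" | "t > x" by linarith
        then show ?thesis
          using q(2)[of t] r(2)[of t] ab that by cases auto
      qed
      then show "P a b" unfolding P_def by blast
    qed
  qed
  then show ?thesis by (auto simp: P_def)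
qed

lemma tendsto_at_right_imp_seq:
  fixes f :: "real \<Rightarrow> real"
  assumes f: "(f \<longlongrightarrow> f s) (at_right s)" and x: "x \<longlonglongrightarrow> s" "\<And>n. s \<le> x n"
  shows "(\<lambda>n. f (x n)) \<longlonglongrightarrow> f s"
proof (rule tendstoI)
  fix e :: real assume "e > 0"
  from tendstoD[OF f this] obtain b where b: "b > s" "\<And>y. s < y \<Longrightarrow> y < b \<Longrightarrow> dist (f y) (f s) < e"
    unfolding eventually_at_right_field by blast
  have "\<forall>\<^sub>F n in sequentially. x n < b" using order_tendstoD(2)[OF x(1) b(1)] .
  then show "\<forall>\<^sub>F n in sequentially. dist (f (x n)) (f s) < e"
  proof eventually_elim
    case (elim n)
    then show ?case using b(2)[of "x n"] x(2)[of n] \<open>e > 0\<close> by (cases "x n = s") auto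
  qed
qed

text \<open>Sampling at right endpoints suits right-continuity: the step function takes at
  \<open>s\<close> the value of \<open>f\<close> at the next grid point, which approaches
  \<open>s\<close> from the right. The sums then converge by domination, although \<open>f\<close>
  may jump. \<open>Suc n\<close> cells avoid a division by zero.\<close>

lemma right_Riemann_sum_LIMSEQ:
  fixes f :: "real \<Rightarrow> real"
  assumes ab: "a < b" and bdd: "\<And>s. s \<in> {a..b} \<Longrightarrow> \<bar>f s\<bar> \<le> B"
    and right: "\<And>s. s \<in> {a..b} \<Longrightarrow> (f \<longlongrightarrow> f s) (at_right s)"
  defines "g \<equiv> \<lambda>n i. a + real i * ((b - a) / real (Suc n))"
  shows "set_integrable lborel {a<..b} f"
    and "(\<lambda>n. \<Sum>i<Suc n. (b - a) / real (Suc n) * f (g n (Suc i))) \<longlonglongrightarrow> (LINT s:{a<..b}|lborel. f s)"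
proof -
  define \<delta> where "\<delta> n = (b - a) / real (Suc n)" for n
  have \<delta>: "\<delta> n > 0" for n using ab by (simp add: \<delta>_def)
  have g: "g n i = a + real i * \<delta> n" for n i by (simp add: g_def \<delta>_def)
  have gb: "g n (Suc n) = b" for n using ab by (simp add: g_def)
  define h where "h n s = (\<Sum>i<Suc n. indicator {g n i<..g n (Suc i)} s * f (g n (Suc i)))" for n s
  \<comment> \<open>\<open>s\<close> rounded up to the grid; a grid point is left where it
    is.\<close>
  define c where "c n s = a + real_of_int \<lceil>(s - a) / \<delta> n\<rceil> * \<delta> n" for n s
  have c: "s \<le> c n s" "c n s \<le> s + \<delta> n" for n s
  proof -
    have "(s - a) / \<delta> n \<le> of_int \<lceil>(s - a) / \<delta> n\<rceil>" "of_int \<lceil>(s - a) / \<delta> n\<rceil> \<le> (s - a) / \<delta> n + 1"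
      by linarith+
    from mult_right_mono[OF this(1), of "\<delta> n"] mult_right_mono[OF this(2), of "\<delta> n"]
    show "s \<le> c n s" "c n s \<le> s + \<delta> n"
      unfolding c_def using \<delta>[of n] by (simp_all add: distrib_right)
  qed
  have h: "h n s = indicator {a<..b} s * f (c n s)" "s \<in> {a<..b} \<Longrightarrow> c n s \<in> {a..b}" for n s
  proof -
    define k where "k = \<lceil>(s - a) / \<delta> n\<rceil>"
    have ind: "s \<in> {g n i<..g n (Suc i)} \<longleftrightarrow> k = int (Suc i)" for i
    proof -
      have "k = int (Suc i) \<longleftrightarrow> real i < (s - a) / \<delta> n \<and> (s - a) / \<delta> n \<le> real (Suc i)"
        unfolding k_def ceiling_eq_iff by auto
      also have "\<dots> \<longleftrightarrow> s \<in> {g n i<..g n (Suc i)}"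
        unfolding g using \<delta>[of n] by (auto simp: pos_less_divide_eq pos_divide_le_eq)
      finally show ?thesis by simp
    qed
    have "h n s = indicator {a<..b} s * f (c n s) \<and> (s \<in> {a<..b} \<longrightarrow> c n s \<in> {a..b})"
    proof (cases "s \<in> {a<..b}")
      case True
      have "0 < (s - a) / \<delta> n" using True \<delta>[of n] by simp
      then have "k > 0" unfolding k_def by simp
      have "s - a \<le> real (Suc n) * \<delta> n" using True by (simp add: \<delta>_def)
      then have "k \<le> int (Suc n)" unfolding k_def ceiling_le_iff using \<delta>[of n] by (simp add: pos_divide_le_eq)
      define i where "i = nat k - 1"
      have i: "k = int (Suc i)" "i < Suc n" using \<open>k > 0\<close> \<open>k \<le> int (Suc n)\<close> by (auto simp: i_def)
      have ci: "c n s = g n (Suc i)" unfolding c_def k_def[symmetric] g i(1) by simp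
      have "h n s = (\<Sum>j<Suc n. if j = i then f (g n (Suc i)) else 0)"
        unfolding h_def by (intro sum.cong) (use ind i in \<open>auto simp: indicator_def simp del: greaterThanAtMost_iff\<close>)
      then have "h n s = f (c n s)" using i(2) ci by simp
      moreover have "c n s \<le> b"
      proof -
        have "g n (Suc i) \<le> g n (Suc n)"
          unfolding g using i(2) \<delta>[of n] by (intro add_left_mono mult_right_mono) auto
        then show ?thesis by (simp add: ci gb)
      qed
      ultimately show ?thesis using True c(1)[where s = s and n = n] by auto
    next
      case False
      have "s \<notin> {g n i<..g n (Suc i)}" if "i < Suc n" for i
      proof
        assume s: "s \<in> {g n i<..g n (Suc i)}"
        have "g n (Suc i) \<le> g n (Suc n)" "a \<le> g n i"
          unfolding g using that \<delta>[of n] by (auto intro!: add_left_mono mult_right_mono)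
        then show False using s False gb[of n] by auto
      qed
      then have "h n s = 0" unfolding h_def by (intro sum.neutral) auto
      then show ?thesis using False by (auto simp: indicator_def)
    qed
    then show "h n s = indicator {a<..b} s * f (c n s)" "s \<in> {a<..b} \<Longrightarrow> c n s \<in> {a..b}" by auto
  qed
  have [measurable]: "h n \<in> borel_measurable borel" for n
    unfolding h_def by measurable
  have \<delta>0: "\<delta> \<longlonglongrightarrow> 0" unfolding \<delta>_def by real_asymp
  have lim: "(\<lambda>n. h n s) \<longlonglongrightarrow> indicator {a<..b} s * f s" for s
  proof (cases "s \<in> {a<..b}")
    case True
    have "(\<lambda>n. c n s) \<longlonglongrightarrow> s"
    proof (rule tendsto_sandwich[OF _ _ tendsto_const])
      show "(\<lambda>n. s + \<delta> n) \<longlonglongrightarrow> s" using tendsto_add[OF tendsto_const \<delta>0, of s] by simp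
    qed (use c in auto)
    moreover have "(f \<longlongrightarrow> f s) (at_right s)" using True by (intro right) auto
    ultimately have "(\<lambda>n. f (c n s)) \<longlonglongrightarrow> f s"
      using tendsto_at_right_imp_seq[where f = f and s = s and x = "\<lambda>n. c n s"] c(1) by blast
    then show ?thesis unfolding h(1) by (intro tendsto_intros)
  qed (simp add: h(1))
  \<comment> \<open>Measurability of \<open>f\<close> on the interval is not assumed; it is
    inherited from the step functions.\<close>
  have meas [measurable]: "(\<lambda>s. indicator {a<..b} s * f s) \<in> borel_measurable borel"
    by (rule borel_measurable_LIMSEQ_real[OF lim]) measurable
  have int1: "integrable lborel (indicator {a<..b} :: real \<Rightarrow> real)"
    using ab by (simp add: emeasure_lborel_Ioc)
  have B: "B \<ge> 0" using bdd[of a] ab by (smt (verit) atLeastAtMost_iff)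
  have "integrable lborel (\<lambda>s. indicator {a<..b} s * f s)"
    by (rule Bochner_Integration.integrable_bound[OF integrable_mult_left[OF int1, of B]])
      (use bdd B in \<open>auto split: split_indicator\<close>)
  then show "set_integrable lborel {a<..b} f" by (simp add: set_integrable_def)
  have "(\<lambda>n. \<integral>s. h n s \<partial>lborel) \<longlonglongrightarrow> (\<integral>s. indicator {a<..b} s * f s \<partial>lborel)"
  proof (rule integral_dominated_convergence[where w = "\<lambda>s. indicator {a<..b} s * B"])
    show "integrable lborel (\<lambda>s. indicator {a<..b} s * B)" using int1 by (intro integrable_mult_left)
    show "AE s in lborel. norm (h n s) \<le> indicator {a<..b} s * B" for n
      unfolding h(1) using bdd h(2) by (auto split: split_indicator)
  qed (use lim in auto)
  moreover have "(\<integral>s. h n s \<partial>lborel) = (\<Sum>i<Suc n. (b - a) / real (Suc n) * f (g n (Suc i)))" for n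
  proof -
    have "has_bochner_integral lborel (h n) (\<Sum>i<Suc n. \<delta> n * f (g n (Suc i)))"
      unfolding h_def
    proof (intro has_bochner_integral_sum has_bochner_integral_mult_left)
      fix i
      have "g n i \<le> g n (Suc i)" "g n (Suc i) - g n i = \<delta> n"
        unfolding g using \<delta>[of n] by (auto simp: algebra_simps)
      then show "has_bochner_integral lborel (indicator {g n i<..g n (Suc i)} :: real \<Rightarrow> real) (\<delta> n)"
        using has_bochner_integral_real_indicator[of "{g n i<..g n (Suc i)}" lborel]
        by (simp add: emeasure_lborel_Ioc measure_def)
    qed
    then show ?thesis by (simp add: has_bochner_integral_iff \<delta>_def)
  qed
  ultimately show "(\<lambda>n. \<Sum>i<Suc n. (b - a) / real (Suc n) * f (g n (Suc i))) \<longlonglongrightarrow> (LINT s:{a<..b}|lborel. f s)"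
    by (simp only: set_lebesgue_integral_def real_scaleR_def)
qed

section \<open>The random integral\<close>

text \<open>The integral of \<open>s^2 * exp (- s)\<close> over \<open>[a, \<infinity>)\<close>.
  Times \<open>mu_variance\<close> it bounds the second moment of the random integral beyond
  \<open>a\<close>, because the time change \<open>1 - exp (- s)\<close> has density
  \<open>exp (- s)\<close>.\<close>

definition tail_sq_exp :: "real \<Rightarrow> real" where
  "tail_sq_exp a = (a\<^sup>2 + 2 * a + 2) * exp (- a)"

lemma tail_sq_exp_nonneg: "a \<ge> 0 \<Longrightarrow> tail_sq_exp a \<ge> 0"
  by (simp add: tail_sq_exp_def)

lemma has_bochner_integral_sq_exp:
  "has_bochner_integral lborel (\<lambda>s. indicator {a..} s * (s\<^sup>2 * exp (- s))) (tail_sq_exp a)"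
proof -
  have "has_bochner_integral lborel (\<lambda>s. indicator {a..} s * (s\<^sup>2 * exp (- s))) (0 - (- tail_sq_exp a))"
  proof (rule has_bochner_integral_FTC_atLeast)
    show "((\<lambda>s. - tail_sq_exp s) has_field_derivative s\<^sup>2 * exp (- s)) (at s)" for s
      unfolding tail_sq_exp_def by (auto intro!: derivative_eq_intros simp: algebra_simps)
    show "((\<lambda>s. - tail_sq_exp s) \<longlongrightarrow> 0) at_top"
      unfolding tail_sq_exp_def by real_asymp
  qed auto
  then show ?thesis by simp
qed

locale mu_levy_process = prob_space P for P :: "'p measure" +
  fixes Y :: "real \<Rightarrow> 'p \<Rightarrow> real"
  assumes levy: "levy_process P Y" and law1: "distr P borel (Y 1) = \<mu>_law"
begin

lemmas levy_conds = levy[unfolded levy_process_def]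

lemma Y_meas [measurable (raw)]: "t \<ge> 0 \<Longrightarrow> Y t \<in> borel_measurable P"
  using levy_conds[THEN conjunct2, THEN conjunct1] by blast

lemma Y_0: "\<omega> \<in> space P \<Longrightarrow> Y 0 \<omega> = 0"
  using levy_conds[THEN conjunct2, THEN conjunct2, THEN conjunct1] by blast

lemma Y_right: "\<omega> \<in> space P \<Longrightarrow> t \<ge> 0 \<Longrightarrow> ((\<lambda>s. Y s \<omega>) \<longlongrightarrow> Y t \<omega>) (at_right t)"
  by (rule levy_conds[THEN conjunct2, THEN conjunct2, THEN conjunct2, THEN conjunct2, THEN conjunct2, THEN conjunct2, THEN bspec, THEN conjunct1, rule_format])

lemma Y_left: "\<omega> \<in> space P \<Longrightarrow> t > 0 \<Longrightarrow> \<exists>l. ((\<lambda>s. Y s \<omega>) \<longlongrightarrow> l) (at_left t)"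
  by (rule levy_conds[THEN conjunct2, THEN conjunct2, THEN conjunct2, THEN conjunct2, THEN conjunct2, THEN conjunct2, THEN bspec, THEN conjunct2, rule_format])

lemma Y_stationary: "s \<ge> 0 \<Longrightarrow> h \<ge> 0 \<Longrightarrow> distr P borel (\<lambda>\<omega>. Y (s + h) \<omega> - Y s \<omega>) = distr P borel (Y h)"
  by (rule levy_conds[THEN conjunct2, THEN conjunct2, THEN conjunct2, THEN conjunct2, THEN conjunct1, rule_format])

lemma Y_indep:
  assumes "0 \<le> t 0" "\<And>i. i < n \<Longrightarrow> t i \<le> t (Suc i)"
  shows "indep_vars (\<lambda>_. borel) (\<lambda>i \<omega>. Y (t (Suc i)) \<omega> - Y (t i) \<omega>) {..<n}"
proof -
  have "\<forall>n (t :: nat \<Rightarrow> real). 0 \<le> t 0 \<and> (\<forall>i<n. t i \<le> t (Suc i)) \<longrightarrow>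
      indep_vars (\<lambda>_. borel) (\<lambda>i \<omega>. Y (t (Suc i)) \<omega> - Y (t i) \<omega>) {..<n}"
    using levy unfolding levy_process_def by (elim conjE)
  then show ?thesis using assms by simp
qed

section \<open>The laws of the process at fixed times\<close>

abbreviation (input) phi :: "real \<Rightarrow> real \<Rightarrow> complex" where
  "phi h \<equiv> char (distr P borel (Y h))"

text \<open>Independence gives the product and stationarity reduces each factor to the length of its
  interval. Unit weights give \<open>phi_power\<close>; the grid points as weights give the sums
  approximating the random integral.\<close>

lemma char_weighted_increments:
  assumes t: "0 \<le> t 0" "\<And>i. i < n \<Longrightarrow> t i \<le> t (Suc i)"
  shows "char (distr P borel (\<lambda>\<omega>. \<Sum>i<n. w i * (Y (t (Suc i)) \<omega> - Y (t i) \<omega>))) u =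
    (\<Prod>i<n. phi (t (Suc i) - t i) (u * w i))"
proof -
  have t0: "t i \<ge> 0" if "i \<le> n" for i
    using that by (induction i) (use t in \<open>auto intro: order_trans\<close>)
  have "char (distr P borel (\<lambda>\<omega>. \<Sum>i<n. w i * (Y (t (Suc i)) \<omega> - Y (t i) \<omega>))) u =
      (\<Prod>i<n. char (distr P borel (\<lambda>\<omega>. w i * (Y (t (Suc i)) \<omega> - Y (t i) \<omega>))) u)"
    by (intro char_distr_sum indep_vars_compose2[where Y = "\<lambda>i x. w i * x", OF Y_indep] t) auto
  also have "\<dots> = (\<Prod>i<n. phi (t (Suc i) - t i) (u * w i))"
  proof (rule prod.cong[OF refl])
    fix i assume "i \<in> {..<n}"
    then have i: "t i \<ge> 0" "t (Suc i) \<ge> 0" "t i \<le> t (Suc i)" using t0 t by auto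
    have [measurable]: "Y (t i) \<in> borel_measurable P" "Y (t (Suc i)) \<in> borel_measurable P"
      using i by (auto intro: Y_meas)
    have "char (distr P borel (\<lambda>\<omega>. w i * (Y (t (Suc i)) \<omega> - Y (t i) \<omega>))) u =
      char (distr P borel (\<lambda>\<omega>. Y (t (Suc i)) \<omega> - Y (t i) \<omega>)) (u * w i)"
      by (simp add: char_def integral_distr mult_ac)
    then show "char (distr P borel (\<lambda>\<omega>. w i * (Y (t (Suc i)) \<omega> - Y (t i) \<omega>))) u = phi (t (Suc i) - t i) (u * w i)"
      using Y_stationary[of "t i" "t (Suc i) - t i"] i by simp
  qed
  finally show ?thesis .
qed

lemma phi_power:
  assumes "h \<ge> 0"
  shows "phi (real m * h) u = phi h u ^ m"
proof -
  have "distr P borel (Y (real m * h)) = distr P borel (\<lambda>\<omega>. \<Sum>i<m. 1 * (Y (real (Suc i) * h) \<omega> - Y (real i * h) \<omega>))"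
  proof (rule distr_cong)
    fix \<omega> assume "\<omega> \<in> space P"
    then show "Y (real m * h) \<omega> = (\<Sum>i<m. 1 * (Y (real (Suc i) * h) \<omega> - Y (real i * h) \<omega>))"
      using sum_lessThan_telescope[of "\<lambda>i. Y (real i * h) \<omega>" m] by (simp add: Y_0)
  qed auto
  also have "char \<dots> u = (\<Prod>i<m. phi (real (Suc i) * h - real i * h) (u * 1))"
    using assms by (intro char_weighted_increments) (auto intro: mult_right_mono)
  also have "\<dots> = phi h u ^ m"
    by (simp add: algebra_simps)
  finally show ?thesis .
qed

lemma real_distribution_Y: "h \<ge> 0 \<Longrightarrow> real_distribution (distr P borel (Y h))"
  by (rule real_distribution_distr_borel[OF prob_space_axioms Y_meas])

text \<open>The quotient of the two sides is a continuous function of \<open>u\<close> whose values are \<open>n\<close>-th roots of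
  unity.\<close>

lemma phi_inverse_nat:
  assumes "n > 0"
  shows "phi (1 / real n) u = of_real (exp (mu_exponent u / real n))"
proof -
  interpret D: real_distribution "distr P borel (Y (1 / real n))"
    by (rule real_distribution_Y) simp
  define f where "f u = phi (1 / real n) u / of_real (exp (mu_exponent u / real n))" for u
  have "f u = 1"
  proof (rule continuous_root_of_unity_eq_1)
    show "continuous_on UNIV f"
      unfolding f_def using D.isCont_char assms
      by (intro continuous_intros continuous_on_mu_exponent) (auto intro: continuous_at_imp_continuous_on)
    show "f 0 = 1" using D.char_zero by (simp add: f_def)
    show "f x ^ n = 1" for x
    proof -
      have "phi (1 / real n) x ^ n = of_real (exp (mu_exponent x))"
        using phi_power[of "1 / real n" n x] assms by (simp add: law1 char_mu_law)
      moreover have "exp (mu_exponent x / real n) ^ n = exp (mu_exponent x)"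
        using assms by (simp flip: exp_of_nat_mult)
      ultimately show ?thesis by (simp only: f_def power_divide of_real_power[symmetric]) simp
    qed
  qed fact
  then show ?thesis by (simp add: f_def)
qed

text \<open>Rational times follow from the times \<open>1/n\<close> by taking powers;
  right-continuity of the paths and dominated convergence extend the formula to real
  \<open>h\<close>.\<close>

lemma phi_eq:
  assumes h: "h \<ge> 0"
  shows "phi h u = of_real (exp (h * mu_exponent u))"
proof -
  \<comment> \<open>Rounding up keeps \<open>x k\<close> at or above \<open>h\<close>, the side on
    which the paths are continuous.\<close>
  define m where "m k = nat \<lfloor>h * real (Suc k)\<rfloor> + 1" for k
  define x where "x k = real (m k) * (1 / real (Suc k))" for k
  have m: "h * real (Suc k) \<le> real (m k)" "real (m k) \<le> h * real (Suc k) + 1" for k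
  proof -
    have "\<lfloor>h * real (Suc k)\<rfloor> \<ge> 0" using h by simp
    then have "real (m k) = of_int \<lfloor>h * real (Suc k)\<rfloor> + 1" unfolding m_def by simp
    then show "h * real (Suc k) \<le> real (m k)" "real (m k) \<le> h * real (Suc k) + 1" by linarith+
  qed
  have x: "h \<le> x k" "x k \<le> h + 1 / real (Suc k)" for k
  proof -
    have "h * N \<le> M \<Longrightarrow> h \<le> M * (1 / N)" "M \<le> h * N + 1 \<Longrightarrow> M * (1 / N) \<le> h + 1 / N" if "N > 0" for M N :: real
      using that by (simp_all add: pos_le_divide_eq pos_divide_le_eq distrib_right)
    then show "h \<le> x k" "x k \<le> h + 1 / real (Suc k)"
      unfolding x_def using m[of k] by (simp_all only: of_nat_0_less_iff zero_less_Suc)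
  qed
  have lim: "x \<longlonglongrightarrow> h"
  proof (rule tendsto_sandwich[OF _ _ tendsto_const])
    show "(\<lambda>k. h + 1 / real (Suc k)) \<longlonglongrightarrow> h" by real_asymp
  qed (use x in auto)
  have 1: "(\<lambda>k. phi (x k) u) \<longlonglongrightarrow> phi h u"
  proof -
    have x0: "0 \<le> x k" for k using h x(1)[of k] by linarith
    have "AE \<omega> in P. (\<lambda>k. Y (x k) \<omega>) \<longlonglongrightarrow> Y h \<omega>"
    proof (rule AE_I2)
      fix \<omega> assume "\<omega> \<in> space P"
      from tendsto_at_right_imp_seq[OF Y_right[OF this h] lim x(1)]
      show "(\<lambda>k. Y (x k) \<omega>) \<longlonglongrightarrow> Y h \<omega>" .
    qed
    from char_tendsto_of_AE_tendsto[of P "\<lambda>k. Y (x k)" "Y h", OF prob_space_axioms Y_meas[OF x0] Y_meas[OF h] this]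
    show ?thesis .
  qed
  have 2: "phi (x k) u = of_real (exp (x k * mu_exponent u))" for k
  proof -
    have "phi (x k) u = of_real (exp (mu_exponent u / real (Suc k))) ^ m k"
      unfolding x_def by (simp only: phi_power[OF divide_nonneg_nonneg[OF zero_le_one of_nat_0_le_iff]] phi_inverse_nat[OF zero_less_Suc])
    also have "\<dots> = of_real (exp (real (m k) * (mu_exponent u / real (Suc k))))"
      unfolding exp_of_nat_mult by (rule of_real_power[symmetric])
    also have "real (m k) * (mu_exponent u / real (Suc k)) = x k * mu_exponent u"
      by (simp add: x_def)
    finally show ?thesis .
  qed
  have "(\<lambda>k. complex_of_real (exp (x k * mu_exponent u))) \<longlonglongrightarrow> of_real (exp (h * mu_exponent u))"
    by (intro tendsto_intros lim)
  then show ?thesis by (rule LIMSEQ_unique[OF 1[unfolded 2]])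
qed

section \<open>The random integral over a bounded interval\<close>

abbreviation (input) K :: "real \<Rightarrow> 'p \<Rightarrow> real" where
  "K \<equiv> K_integral_upto Y"

context
  fixes a b :: real assumes ab: "0 \<le> a" "a < b"
begin

definition grid :: "nat \<Rightarrow> nat \<Rightarrow> real" where
  "grid n i = a + real i * ((b - a) / real (Suc n))"

lemma grid_0: "grid n 0 = a" and grid_Suc_n: "grid n (Suc n) = b"
  using ab by (simp_all add: grid_def)

lemma grid_Suc: "grid n (Suc i) = grid n i + (b - a) / real (Suc n)"
proof -
  have "a + real (Suc i) * d = a + real i * d + d" for d by (simp add: algebra_simps)
  then show ?thesis unfolding grid_def .
qed

lemma grid_nonneg: "grid n i \<ge> 0"
  using ab by (simp add: grid_def)

text \<open>Summation by parts: the integral is a limit of sums over increments with weights taken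
  at the left endpoint, since the path is evaluated at the right endpoint in the Riemann sums.\<close>

lemma K_diff_LIMSEQ:
  assumes \<omega>: "\<omega> \<in> space P"
  shows "(\<lambda>n. \<Sum>i<Suc n. grid n i * (Y (1 - exp (- grid n (Suc i))) \<omega> - Y (1 - exp (- grid n i)) \<omega>))
    \<longlonglongrightarrow> K b \<omega> - K a \<omega>"
proof -
  define g where "g s = Y (1 - exp (- s)) \<omega>" for s
  \<comment> \<open>The time change sends \<open>[0, \<infinity>)\<close> into
    \<open>[0, 1]\<close>, so a single bound for the path on \<open>[0, 1]\<close> suffices.\<close>
  have "\<exists>B. \<forall>t\<in>{0..1}. \<bar>Y t \<omega>\<bar> \<le> B"
  proof (rule regulated_bounded)
    show "\<exists>l. ((\<lambda>t. Y t \<omega>) \<longlongrightarrow> l) (at_right t)" if "0 \<le> t" for t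
      using Y_right[OF \<omega> that] by (rule exI)
    show "\<exists>l. ((\<lambda>t. Y t \<omega>) \<longlongrightarrow> l) (at_left t)" if "0 < t" for t
      using Y_left[OF \<omega> that] .
  qed simp
  then obtain B where B: "\<And>t. t \<in> {0..1} \<Longrightarrow> \<bar>Y t \<omega>\<bar> \<le> B" by blast
  have bdd: "\<bar>g s\<bar> \<le> B" if "s \<ge> 0" for s
    unfolding g_def using that by (intro B) auto
  have right: "(g \<longlongrightarrow> g s) (at_right s)" if "s \<ge> 0" for s
    unfolding g_def
  proof (rule filterlim_compose[OF Y_right[OF \<omega>]])
    \<comment> \<open>The time change is strictly increasing, so approach from the right stays
      approach from the right.\<close>
    show "filterlim (\<lambda>s. 1 - exp (- s)) (at_right (1 - exp (- s))) (at_right s)"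
      unfolding filterlim_at
      by (intro conjI tendsto_intros) (auto simp: eventually_at_filter)
  qed (use that in simp)
  have int0: "set_integrable lborel {0<..b} g"
    using ab by (intro right_Riemann_sum_LIMSEQ(1)[of 0 b g B] bdd right) auto
  \<comment> \<open>The definition integrates over a closed interval and the Riemann sums over a
    half-open one; the point \<open>0\<close> is a null set.\<close>
  have 0: "(LINT s:{0..c}|lborel. g s) = (LINT s:{0<..c}|lborel. g s)" if "c \<in> {0..b}" for c
  proof -
    have "has_bochner_integral lborel (indicator {0 :: real} :: real \<Rightarrow> real) (measure lborel {0 :: real})"
      by (rule has_bochner_integral_real_indicator) auto
    from has_bochner_integral_mult_left[OF this, of "g 0"]
    have "has_bochner_integral lborel (\<lambda>s :: real. indicator {0} s * g 0) (0 * g 0)" by simp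
    moreover have "(\<lambda>s :: real. indicator {0} s * g 0) = (\<lambda>s. indicator {0} s *\<^sub>R g s)"
      by (auto split: split_indicator)
    ultimately have null: "set_integrable lborel {0} g" "(LINT s:{0}|lborel. g s) = 0"
      by (simp_all add: set_integrable_def set_lebesgue_integral_def has_bochner_integral_iff)
    have "{0..c} = {0} \<union> {0<..c}" using that by auto
    then have "(LINT s:{0..c}|lborel. g s) = (LINT s:{0} \<union> {0<..c}|lborel. g s)" by simp
    also have "\<dots> = (LINT s:{0}|lborel. g s) + (LINT s:{0<..c}|lborel. g s)"
      by (intro set_integral_Un null set_integrable_subset[OF int0]) (use that in auto)
    finally show ?thesis by (simp add: null)
  qed
  have "(LINT s:{0<..b}|lborel. g s) = (LINT s:{0<..a} \<union> {a<..b}|lborel. g s)"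
    using ab by (intro arg_cong[where f = "\<lambda>A. set_lebesgue_integral lborel A g"]) auto
  also have "\<dots> = (LINT s:{0<..a}|lborel. g s) + (LINT s:{a<..b}|lborel. g s)"
    by (intro set_integral_Un set_integrable_subset[OF int0]) (use ab in auto)
  finally have K: "K b \<omega> - K a \<omega> = b * g b - a * g a - (LINT s:{a<..b}|lborel. g s)"
    using ab by (simp add: K_integral_upto_def 0 flip: g_def)
  have "(\<lambda>n. b * g b - a * g a - (\<Sum>i<Suc n. (b - a) / real (Suc n) * g (grid n (Suc i)))) \<longlonglongrightarrow> K b \<omega> - K a \<omega>"
    unfolding K grid_def
    by (intro tendsto_diff tendsto_const right_Riemann_sum_LIMSEQ(2)[of a b g B] bdd right) (use ab in auto)
  moreover have "b * g b - a * g a - (\<Sum>i<Suc n. (b - a) / real (Suc n) * g (grid n (Suc i))) =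
     (\<Sum>i<Suc n. grid n i * (g (grid n (Suc i)) - g (grid n i)))" for n
  proof -
    \<comment> \<open>Abel summation: writing the left endpoint as the right one minus the step
      width splits off a telescoping sum and leaves the Riemann sum.\<close>
    have "(\<Sum>i<Suc n. grid n i * (g (grid n (Suc i)) - g (grid n i))) =
      (\<Sum>i<Suc n. (grid n (Suc i) * g (grid n (Suc i)) - grid n i * g (grid n i)) - (b - a) / real (Suc n) * g (grid n (Suc i)))"
      unfolding grid_Suc by (intro sum.cong) (auto simp: algebra_simps)
    also have "\<dots> = (\<Sum>i<Suc n. grid n (Suc i) * g (grid n (Suc i)) - grid n i * g (grid n i)) - (\<Sum>i<Suc n. (b - a) / real (Suc n) * g (grid n (Suc i)))"
      by (rule sum_subtractf)
    also have "(\<Sum>i<Suc n. grid n (Suc i) * g (grid n (Suc i)) - grid n i * g (grid n i)) = b * g b - a * g a"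
      unfolding sum_lessThan_telescope[of "\<lambda>i. grid n i * g (grid n i)" "Suc n"] grid_0 grid_Suc_n ..
    finally show ?thesis by simp
  qed
  ultimately show ?thesis by (simp only: g_def)
qed

lemma K_diff_meas: "(\<lambda>\<omega>. K b \<omega> - K a \<omega>) \<in> borel_measurable P"
proof (rule borel_measurable_LIMSEQ_real[OF K_diff_LIMSEQ])
  fix n
  have [measurable]: "Y (1 - exp (- grid n i)) \<in> borel_measurable P" for i
    using grid_nonneg[of n i] by (intro Y_meas) auto
  show "(\<lambda>\<omega>. \<Sum>i<Suc n. grid n i * (Y (1 - exp (- grid n (Suc i))) \<omega> - Y (1 - exp (- grid n i)) \<omega>)) \<in> borel_measurable P"
    by measurable
qed

text \<open>Over a cell of width \<open>d\<close> starting at \<open>s\<close> the time change grows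
  by \<open>exp (- s) * (1 - exp (- d))\<close>. The sum is therefore
  \<open>(1 - exp (- d)) / d\<close> times a left Riemann sum, and moving to right endpoints costs
  only \<open>d * (f a - f b)\<close>.\<close>

lemma exponent_Riemann:
  shows "set_integrable lborel {a<..b} (\<lambda>s. mu_exponent (u * s) * exp (- s))"
    and "(\<lambda>n. \<Sum>i<Suc n. ((1 - exp (- grid n (Suc i))) - (1 - exp (- grid n i))) * mu_exponent (u * grid n i))
    \<longlonglongrightarrow> (LINT s:{a<..b}|lborel. mu_exponent (u * s) * exp (- s))"
proof -
  define f where "f s = mu_exponent (u * s) * exp (- s)" for s
  have bdd: "\<bar>f s\<bar> \<le> mu_variance * ((u * b)\<^sup>2 / 2) * 1" if "s \<in> {a..b}" for s
  proof -
    have "s\<^sup>2 \<le> b\<^sup>2" using that ab by (intro power_mono) auto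
    then have "mu_variance * ((u * s)\<^sup>2 / 2) \<le> mu_variance * ((u * b)\<^sup>2 / 2)"
      unfolding power_mult_distrib by (intro mult_left_mono divide_right_mono) (auto simp: mu_variance_nonneg)
    then have "\<bar>mu_exponent (u * s)\<bar> \<le> mu_variance * ((u * b)\<^sup>2 / 2)"
      using mu_exponent_bound[of "u * s"] mu_exponent_nonpos[of "u * s"] by simp
    then show ?thesis unfolding f_def abs_mult using that ab by (intro mult_mono) auto
  qed
  have "isCont mu_exponent v" for v using continuous_on_mu_exponent by (simp add: continuous_on_eq_continuous_at)
  then have "isCont f s" for s
    unfolding f_def by (intro continuous_intros isCont_o2[of _ "\<lambda>s. u * s" mu_exponent]) auto
  then have right: "(f \<longlongrightarrow> f s) (at_right s)" for s
    using isCont_def tendsto_within_subset by blast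
  note R = right_Riemann_sum_LIMSEQ[OF ab(2) bdd right]
  show "set_integrable lborel {a<..b} (\<lambda>s. mu_exponent (u * s) * exp (- s))"
    using R(1) by (simp add: f_def[abs_def])
  define d where "d n = (b - a) / real (Suc n)" for n
  have d: "d n > 0" for n using ab by (simp add: d_def)
  have "(\<lambda>n. (1 - exp (- d n)) / d n * ((\<Sum>i<Suc n. d n * f (grid n (Suc i))) + d n * (f a - f b))) \<longlonglongrightarrow>
      1 * ((LINT s:{a<..b}|lborel. f s) + 0 * (f a - f b))"
  proof (intro tendsto_mult tendsto_add tendsto_const)
    show "(\<lambda>n. (1 - exp (- d n)) / d n) \<longlonglongrightarrow> 1"
      unfolding d_def using ab by real_asymp
    show "d \<longlonglongrightarrow> 0" unfolding d_def by real_asymp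
    show "(\<lambda>n. \<Sum>i<Suc n. d n * f (grid n (Suc i))) \<longlonglongrightarrow> (LINT s:{a<..b}|lborel. f s)"
      using R(2) by (simp only: grid_def d_def)
  qed
  moreover have "(1 - exp (- d n)) / d n * ((\<Sum>i<Suc n. d n * f (grid n (Suc i))) + d n * (f a - f b)) =
      (\<Sum>i<Suc n. ((1 - exp (- grid n (Suc i))) - (1 - exp (- grid n i))) * mu_exponent (u * grid n i))" for n
  proof -
    have "(\<Sum>i<Suc n. d n * f (grid n (Suc i))) - (\<Sum>i<Suc n. d n * f (grid n i)) = d n * f b - d n * f a"
      unfolding sum_subtractf[symmetric] sum_lessThan_telescope[of "\<lambda>i. d n * f (grid n i)" "Suc n"]
        grid_0 grid_Suc_n ..
    then have "(\<Sum>i<Suc n. d n * f (grid n (Suc i))) + d n * (f a - f b) = (\<Sum>i<Suc n. d n * f (grid n i))"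
      by (simp only: right_diff_distrib)
    then have "(1 - exp (- d n)) / d n * ((\<Sum>i<Suc n. d n * f (grid n (Suc i))) + d n * (f a - f b)) =
       (\<Sum>i<Suc n. (1 - exp (- d n)) / d n * (d n * f (grid n i)))"
      by (simp only: sum_distrib_left)
    also have "\<dots> = (\<Sum>i<Suc n. ((1 - exp (- grid n (Suc i))) - (1 - exp (- grid n i))) * mu_exponent (u * grid n i))"
    proof (rule sum.cong[OF refl])
      fix i
      have "exp (- grid n (Suc i)) = exp (- grid n i) * exp (- d n)"
        unfolding grid_Suc d_def[symmetric] by (simp flip: exp_add)
      then show "(1 - exp (- d n)) / d n * (d n * f (grid n i)) =
        ((1 - exp (- grid n (Suc i))) - (1 - exp (- grid n i))) * mu_exponent (u * grid n i)"
        using d[of n] by (simp add: f_def) (simp add: algebra_simps)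
    qed
    finally show ?thesis .
  qed
  ultimately show "(\<lambda>n. \<Sum>i<Suc n. ((1 - exp (- grid n (Suc i))) - (1 - exp (- grid n i))) * mu_exponent (u * grid n i))
    \<longlonglongrightarrow> (LINT s:{a<..b}|lborel. mu_exponent (u * s) * exp (- s))"
    by (simp add: f_def)
qed

lemma char_K_diff:
  "char (distr P borel (\<lambda>\<omega>. K b \<omega> - K a \<omega>)) u = of_real (exp (LINT s:{a<..b}|lborel. mu_exponent (u * s) * exp (- s)))"
proof -
  let ?R = "\<lambda>n \<omega>. \<Sum>i<Suc n. grid n i * (Y (1 - exp (- grid n (Suc i))) \<omega> - Y (1 - exp (- grid n i)) \<omega>)"
  let ?E = "\<lambda>n. \<Sum>i<Suc n. ((1 - exp (- grid n (Suc i))) - (1 - exp (- grid n i))) * mu_exponent (u * grid n i)"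
  have meas [measurable]: "Y (1 - exp (- grid n i)) \<in> borel_measurable P" for n i
    using grid_nonneg[of n i] by (intro Y_meas) auto
  have 1: "(\<lambda>n. char (distr P borel (?R n)) u) \<longlonglongrightarrow> char (distr P borel (\<lambda>\<omega>. K b \<omega> - K a \<omega>)) u"
    by (rule char_tendsto_of_AE_tendsto[OF prob_space_axioms _ K_diff_meas])
      (auto intro!: AE_I2 K_diff_LIMSEQ simp del: sum.lessThan_Suc)
  have 2: "char (distr P borel (?R n)) u = of_real (exp (?E n))" for n
  proof -
    have mono: "1 - exp (- grid n i) \<le> 1 - exp (- grid n (Suc i))" for i
      using ab by (simp add: grid_Suc)
    have "char (distr P borel (?R n)) u =
        (\<Prod>i<Suc n. phi ((1 - exp (- grid n (Suc i))) - (1 - exp (- grid n i))) (u * grid n i))"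
      using char_weighted_increments[of "\<lambda>i. 1 - exp (- grid n i)" "Suc n" "grid n" u] mono grid_nonneg[of n 0]
      by (simp del: sum.lessThan_Suc prod.lessThan_Suc)
    also have "\<dots> = (\<Prod>i<Suc n. of_real (exp (((1 - exp (- grid n (Suc i))) - (1 - exp (- grid n i))) * mu_exponent (u * grid n i))))"
      using mono by (intro prod.cong refl phi_eq) simp
    also have "\<dots> = of_real (exp (?E n))"
      by (simp only: exp_sum[OF finite_lessThan] of_real_prod)
    finally show ?thesis .
  qed
  have "(\<lambda>n. complex_of_real (exp (?E n))) \<longlonglongrightarrow> of_real (exp (LINT s:{a<..b}|lborel. mu_exponent (u * s) * exp (- s)))"
    by (intro tendsto_intros exponent_Riemann(2))
  then show ?thesis by (rule LIMSEQ_unique[OF 1[unfolded 2]])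
qed

text \<open>The exponent \<open>J\<close> satisfies \<open>1 - exp J \<le> - J\<close>, and
  \<open>- J\<close> is at most quadratic in \<open>u\<close>. The bound depends on \<open>a\<close>
  only, which makes the integrals Cauchy in mean square.\<close>

lemma K_diff_second_moment: "(\<integral>\<^sup>+\<omega>. ennreal ((K b \<omega> - K a \<omega>)\<^sup>2) \<partial>P) \<le> ennreal (mu_variance * tail_sq_exp a)"
proof -
  have "(\<integral>\<^sup>+x. ennreal (x\<^sup>2) \<partial>distr P borel (\<lambda>\<omega>. K b \<omega> - K a \<omega>)) \<le> ennreal (mu_variance * tail_sq_exp a)"
  proof (rule second_moment_le_of_char)
    show "real_distribution (distr P borel (\<lambda>\<omega>. K b \<omega> - K a \<omega>))"
      by (rule real_distribution_distr_borel[OF prob_space_axioms K_diff_meas])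
    show "mu_variance * tail_sq_exp a \<ge> 0" using ab tail_sq_exp_nonneg mu_variance_nonneg by simp
    fix u
    define J where "J = (LINT s:{a<..b}|lborel. mu_exponent (u * s) * exp (- s))"
    have "- J = (\<integral>s. indicator {a<..b} s * (- mu_exponent (u * s) * exp (- s)) \<partial>lborel)"
      by (simp add: J_def set_lebesgue_integral_def)
    also have "\<dots> \<le> (\<integral>s. indicator {a..} s * (s\<^sup>2 * exp (- s)) * (mu_variance * (u\<^sup>2 / 2)) \<partial>lborel)"
    proof (rule integral_mono)
      show "integrable lborel (\<lambda>s. indicator {a<..b} s * (- mu_exponent (u * s) * exp (- s)))"
        using exponent_Riemann(1)[of u] by (simp add: set_integrable_def)
      show "integrable lborel (\<lambda>s. indicator {a..} s * (s\<^sup>2 * exp (- s)) * (mu_variance * (u\<^sup>2 / 2)))"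
        using has_bochner_integral_sq_exp[of a] by (intro integrable_mult_left) (simp add: has_bochner_integral_iff)
      fix s
      have "- mu_exponent (u * s) * exp (- s) \<le> mu_variance * ((u * s)\<^sup>2 / 2) * exp (- s)"
        by (intro mult_right_mono mu_exponent_bound) simp
      also have "\<dots> = s\<^sup>2 * exp (- s) * (mu_variance * (u\<^sup>2 / 2))" by (simp add: power_mult_distrib)
      finally show "indicator {a<..b} s * (- mu_exponent (u * s) * exp (- s)) \<le> indicator {a..} s * (s\<^sup>2 * exp (- s)) * (mu_variance * (u\<^sup>2 / 2))"
        using mu_variance_nonneg by (auto split: split_indicator)
    qed
    also have "\<dots> = tail_sq_exp a * (mu_variance * (u\<^sup>2 / 2))"
      using has_bochner_integral_sq_exp[of a] by (simp add: has_bochner_integral_iff)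
    finally have "- J \<le> mu_variance * tail_sq_exp a * (u\<^sup>2 / 2)" by (simp add: mult_ac)
    moreover have "1 + J \<le> exp J" by (rule exp_ge_add_one_self)
    ultimately show "1 - Re (char (distr P borel (\<lambda>\<omega>. K b \<omega> - K a \<omega>)) u) \<le> mu_variance * tail_sq_exp a * (u\<^sup>2 / 2)"
      unfolding char_K_diff J_def[symmetric] Re_complex_of_real by linarith
  qed
  then show ?thesis
    using K_diff_meas by (subst (asm) nn_integral_distr) auto
qed

end

end

section \<open>The limit over the half-line\<close>

context mu_levy_process
begin

lemma K_0: "\<omega> \<in> space P \<Longrightarrow> K 0 \<omega> = 0"
proof -
  have "AE s in lborel. indicator {0..0 :: real} s *\<^sub>R Y (1 - exp (- s)) \<omega> = 0"
    using AE_lborel_singleton[of 0] by eventually_elim auto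
  then show "K 0 \<omega> = 0"
    by (simp add: K_integral_upto_def set_lebesgue_integral_def integral_eq_zero_AE)
qed

lemma K_meas:
  assumes "b \<ge> 0"
  shows "K b \<in> borel_measurable P"
proof (cases "b = 0")
  case True
  have "(\<lambda>\<omega>. 0 :: real) \<in> borel_measurable P" by simp
  then show ?thesis using K_0 by (subst measurable_cong[where g = "\<lambda>\<omega>. 0"]) (auto simp: True)
next
  case False
  then show ?thesis
    using K_diff_meas[of 0 b] assms K_0 by (subst measurable_cong[where g = "\<lambda>\<omega>. K b \<omega> - K 0 \<omega>"]) auto
qed

lemma char_K:
  assumes "b > 0"
  shows "char (distr P borel (K b)) u = of_real (exp (LINT s:{0<..b}|lborel. mu_exponent (u * s) * exp (- s)))"
proof -
  have "distr P borel (K b) = distr P borel (\<lambda>\<omega>. K b \<omega> - K 0 \<omega>)"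
    by (intro distr_cong) (auto simp: K_0)
  then show ?thesis using char_K_diff[of 0 b u] assms by simp
qed

text \<open>The limit along integers, written as a telescoping series so that measurability is that
  of an infinite sum. Its value on the null set of divergence does not affect the law.\<close>

definition V :: "'p \<Rightarrow> real" where
  "V \<omega> = (\<Sum>n. K (real (Suc n)) \<omega> - K (real n) \<omega>)"

lemma V_meas [measurable]: "V \<in> borel_measurable P"
  unfolding V_def by (intro borel_measurable_suminf K_diff_meas) auto

text \<open>The expected absolute increments are at most \<open>1/w + w * v\<close> with
  \<open>v\<close> the second moment bound. For \<open>w = (n + 1)^2\<close> the first term is
  summable, and the second is because \<open>tail_sq_exp\<close> decays exponentially.\<close>

lemma K_nat_LIMSEQ: "AE \<omega> in P. (\<lambda>n. K (real n) \<omega>) \<longlonglongrightarrow> V \<omega>"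
proof -
  define D where "D n \<omega> = K (real (Suc n)) \<omega> - K (real n) \<omega>" for n \<omega>
  define w where "w n = (real (Suc n))\<^sup>2" for n
  define b where "b n = 1 / w n + w n * (mu_variance * tail_sq_exp (real n))" for n
  have [measurable]: "D n \<in> borel_measurable P" for n
    unfolding D_def by (rule K_diff_meas) auto
  have w: "w n > 0" for n by (simp add: w_def)
  have le: "(\<integral>\<^sup>+\<omega>. ennreal \<bar>D n \<omega>\<bar> \<partial>P) \<le> ennreal (b n)" for n
  proof -
    have "\<bar>y\<bar> \<le> 1 / w n + w n * y\<^sup>2" for y :: real
    proof -
      have "2 * \<bar>y\<bar> = 2 * (real (Suc n) * \<bar>y\<bar>) * (1 / real (Suc n))" by simp
      also have "\<dots> \<le> (real (Suc n) * \<bar>y\<bar>)\<^sup>2 + (1 / real (Suc n))\<^sup>2"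
        by (rule sum_squares_bound)
      also have "\<dots> = 1 / w n + w n * y\<^sup>2"
        by (simp add: w_def power_mult_distrib power_divide del: of_nat_Suc)
      finally show ?thesis by linarith
    qed
    then have "(\<integral>\<^sup>+\<omega>. ennreal \<bar>D n \<omega>\<bar> \<partial>P) \<le> (\<integral>\<^sup>+\<omega>. ennreal (1 / w n) + ennreal (w n) * ennreal ((D n \<omega>)\<^sup>2) \<partial>P)"
      using w[of n] by (intro nn_integral_mono) (simp add: ennreal_leI flip: ennreal_mult'' ennreal_plus)
    also have "\<dots> = ennreal (1 / w n) + ennreal (w n) * (\<integral>\<^sup>+\<omega>. ennreal ((D n \<omega>)\<^sup>2) \<partial>P)"
      by (subst nn_integral_add) (auto simp: nn_integral_cmult emeasure_space_1)
    also have "\<dots> \<le> ennreal (1 / w n) + ennreal (w n) * ennreal (mu_variance * tail_sq_exp (real n))"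
      unfolding D_def by (intro add_left_mono mult_left_mono K_diff_second_moment) auto
    also have "\<dots> = ennreal (b n)"
      using w[of n] mu_variance_nonneg tail_sq_exp_nonneg[of "real n"]
      by (simp add: b_def flip: ennreal_mult'' ennreal_plus)
    finally show ?thesis .
  qed
  have "summable b"
  proof (rule summable_comparison_test_bigo)
    show "summable (\<lambda>n. norm (inverse (real n ^ 2)))"
      using inverse_power_summable[of 2, where ?'a = real] by simp
    have "(\<lambda>n. 1 / (real (Suc n))\<^sup>2 + (real (Suc n))\<^sup>2 * (v * ((real n ^ 2 + 2 * real n + 2) * exp (- real n)))) \<in> O(\<lambda>n. inverse (real n ^ 2))" for v
      by real_asymp
    then show "b \<in> O(\<lambda>n. inverse (real n ^ 2))"
      unfolding b_def w_def tail_sq_exp_def by simp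
  qed
  moreover have "b n \<ge> 0" for n
    using w[of n] mu_variance_nonneg tail_sq_exp_nonneg[of "real n"] by (simp add: b_def)
  ultimately have "AE \<omega> in P. summable (\<lambda>n. \<bar>D n \<omega>\<bar>)"
    by (intro AE_summable_of_summable_integral[OF _ _ le]) auto
  then have "AE \<omega> in P. \<omega> \<in> space P \<and> summable (\<lambda>n. \<bar>D n \<omega>\<bar>)"
    using AE_space by eventually_elim simp
  then show ?thesis
  proof eventually_elim
    case (elim \<omega>)
    have "summable (\<lambda>i. D i \<omega>)"
      by (rule summable_rabs_cancel[OF conjunct2[OF elim]])
    then have "(\<lambda>n. \<Sum>i<n. D i \<omega>) \<longlonglongrightarrow> (\<Sum>i. D i \<omega>)"
      by (rule summable_LIMSEQ)
    moreover have "(\<Sum>i<n. D i \<omega>) = K (real n) \<omega>" for n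
      using sum_lessThan_telescope[of "\<lambda>i. K (real i) \<omega>" n] elim by (simp add: D_def K_0)
    ultimately show ?case by (simp add: V_def D_def)
  qed
qed

lemma V_second_moment:
  assumes "b \<ge> 0"
  shows "(\<integral>\<^sup>+\<omega>. ennreal ((K b \<omega> - V \<omega>)\<^sup>2) \<partial>P) \<le> ennreal (mu_variance * tail_sq_exp b)"
proof (rule nn_integral_le_of_AE_lim)
  have [measurable]: "K b \<in> borel_measurable P" "K (real n) \<in> borel_measurable P" for n
    using assms by (auto intro: K_meas)
  show "(\<lambda>\<omega>. (K b \<omega> - K (real n) \<omega>)\<^sup>2) \<in> borel_measurable P" for n by measurable
  show "AE \<omega> in P. (\<lambda>n. (K b \<omega> - K (real n) \<omega>)\<^sup>2) \<longlonglongrightarrow> (K b \<omega> - V \<omega>)\<^sup>2"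
    using K_nat_LIMSEQ by eventually_elim (intro tendsto_intros)
  show "\<forall>\<^sub>F n in sequentially. (\<integral>\<^sup>+\<omega>. ennreal ((K b \<omega> - K (real n) \<omega>)\<^sup>2) \<partial>P) \<le> ennreal (mu_variance * tail_sq_exp b)"
    using eventually_gt_at_top[of "nat \<lceil>b\<rceil>"]
  proof eventually_elim
    case (elim n)
    then have "b < real n" by linarith
    from K_diff_second_moment[OF assms this] show ?case by (simp add: power2_commute)
  qed
qed

text \<open>Chebyshev's inequality. The moment bound holds for every real \<open>b\<close>, so
  convergence along all of \<open>at_top\<close> follows, not only along integers.\<close>

lemma is_K_integral_V: "is_K_integral P Y V"
  unfolding is_K_integral_def
proof (intro conjI allI impI V_meas)
  fix e :: real assume e: "e > 0"
  show "((\<lambda>b. measure P {\<omega>\<in>space P. \<bar>K b \<omega> - V \<omega>\<bar> > e}) \<longlongrightarrow> 0) at_top"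
  proof (rule tendsto_sandwich[OF _ _ tendsto_const])
    show "\<forall>\<^sub>F b in at_top. measure P {\<omega>\<in>space P. \<bar>K b \<omega> - V \<omega>\<bar> > e} \<le> mu_variance * tail_sq_exp b / e\<^sup>2"
      using eventually_ge_at_top[of 0]
    proof eventually_elim
      case (elim b)
      have [measurable]: "K b \<in> borel_measurable P" using elim by (rule K_meas)
      let ?A = "{\<omega>\<in>space P. \<bar>K b \<omega> - V \<omega>\<bar> > e}"
      have "ennreal (e\<^sup>2 * measure P ?A) = (\<integral>\<^sup>+\<omega>. ennreal (e\<^sup>2) * indicator ?A \<omega> \<partial>P)"
        by (subst nn_integral_cmult_indicator) (auto simp: ennreal_mult emeasure_eq_measure)
      also have "\<dots> \<le> (\<integral>\<^sup>+\<omega>. ennreal ((K b \<omega> - V \<omega>)\<^sup>2) \<partial>P)"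
      proof (intro nn_integral_mono)
        fix \<omega>
        have "e\<^sup>2 \<le> (K b \<omega> - V \<omega>)\<^sup>2" if "e < \<bar>K b \<omega> - V \<omega>\<bar>"
          using that e by (subst abs_le_square_iff[symmetric]) auto
        then show "ennreal (e\<^sup>2) * indicator ?A \<omega> \<le> ennreal ((K b \<omega> - V \<omega>)\<^sup>2)"
          by (auto split: split_indicator intro: ennreal_leI)
      qed
      also have "\<dots> \<le> ennreal (mu_variance * tail_sq_exp b)" by (rule V_second_moment[OF elim])
      finally have "e\<^sup>2 * measure P ?A \<le> mu_variance * tail_sq_exp b"
        using mu_variance_nonneg tail_sq_exp_nonneg[OF elim] by (subst (asm) ennreal_le_iff) auto
      then show ?case using e by (simp add: pos_le_divide_eq mult.commute)
    qed
    have "((\<lambda>b. v * ((b\<^sup>2 + 2 * b + 2) * exp (- b)) / e\<^sup>2) \<longlongrightarrow> 0) at_top" for v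
      using e by real_asymp
    then show "((\<lambda>b. mu_variance * tail_sq_exp b / e\<^sup>2) \<longlongrightarrow> 0) at_top"
      unfolding tail_sq_exp_def by simp
  qed simp
qed

lemma exponent_LIMSEQ:
  "(\<lambda>n. LINT s:{0<..real n}|lborel. mu_exponent (u * s) * exp (- s)) \<longlonglongrightarrow> - (u * tanh u)"
proof -
  let ?f = "\<lambda>s. mu_exponent (u * s) * exp (- s)"
  have L: "has_bochner_integral lborel (\<lambda>s. indicator {0..} s * ?f s) (- (u * tanh u))"
    using laplace_mu_exponent[of 1 u] by simp
  have "(\<lambda>n. \<integral>s. indicator {0<..real n} s * ?f s \<partial>lborel) \<longlonglongrightarrow> (\<integral>s. indicator {0..} s * ?f s \<partial>lborel)"
  proof (rule integral_dominated_convergence[where w = "\<lambda>s. \<bar>indicator {0..} s * ?f s\<bar>"])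
    \<comment> \<open>At \<open>0\<close> the two indicators differ for every \<open>n\<close>, so
      this point is removed as a null set.\<close>
    show "AE s in lborel. (\<lambda>n. indicator {0<..real n} s * ?f s) \<longlonglongrightarrow> indicator {0..} s * ?f s"
      using AE_lborel_singleton[of 0]
    proof eventually_elim
      case (elim s)
      have "\<forall>\<^sub>F n in sequentially. s \<le> real n"
        by (rule eventually_mono[OF eventually_ge_at_top[of "nat \<lceil>s\<rceil>"]]) linarith
      then have "\<forall>\<^sub>F n in sequentially. indicator {0<..real n} s * ?f s = indicator {0..} s * ?f s"
        by (rule eventually_mono) (use elim in \<open>auto simp: indicator_def\<close>)
      then show ?case by (rule tendsto_eventually)
    qed
    show "integrable lborel (\<lambda>s. \<bar>indicator {0..} s * ?f s\<bar>)"
      using L by (intro integrable_abs) (simp add: has_bochner_integral_iff)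
    show "AE s in lborel. norm (indicator {0<..real n} s * ?f s) \<le> \<bar>indicator {0..} s * ?f s\<bar>" for n
      by (auto split: split_indicator)
  qed auto
  then show ?thesis
    using L by (simp add: set_lebesgue_integral_def has_bochner_integral_iff)
qed

text \<open>Stated for an arbitrary version \<open>W\<close> of the limit: any limit in probability
  has the limit of the characteristic functions at integer times.\<close>

lemma char_K_integral:
  assumes W: "is_K_integral P Y W"
  shows "char (distr P borel W) u = of_real (exp (- (u * tanh u)))"
proof -
  have [measurable]: "W \<in> borel_measurable P" using W by (simp add: is_K_integral_def)
  have [measurable]: "K (real n) \<in> borel_measurable P" for n by (rule K_meas) simp
  have "(\<lambda>n. char (distr P borel (K (real n))) u) \<longlonglongrightarrow> char (distr P borel W) u"
  proof (rule LIMSEQ_I)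
    fix r :: real assume r: "r > 0"
    \<comment> \<open>Makes \<open>\<bar>u\<bar> * e\<close> at most \<open>r / 2\<close>, the added
      1 covering \<open>u = 0\<close>; the other half comes from twice a probability below
      \<open>r / 4\<close>.\<close>
    define e where "e = r / (2 * (\<bar>u\<bar> + 1))"
    have e: "e > 0" using r by (simp add: e_def)
    have "\<bar>u\<bar> * e \<le> r / 2"
    proof -
      have "\<bar>u\<bar> * e = r / 2 * (\<bar>u\<bar> / (\<bar>u\<bar> + 1))" by (simp add: e_def)
      also have "\<dots> \<le> r / 2 * 1" using r by (intro mult_left_mono) (auto simp: divide_le_eq)
      finally show ?thesis by simp
    qed
    have "((\<lambda>b. measure P {\<omega>\<in>space P. \<bar>K b \<omega> - W \<omega>\<bar> > e}) \<longlongrightarrow> 0) at_top"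
      using W e by (simp add: is_K_integral_def)
    then have "(\<lambda>n. measure P {\<omega>\<in>space P. \<bar>K (real n) \<omega> - W \<omega>\<bar> > e}) \<longlonglongrightarrow> 0"
      by (rule filterlim_compose) (rule filterlim_real_sequentially)
    from order_tendstoD(2)[OF this, of "r / 4"]
    obtain N where N: "\<And>n. n \<ge> N \<Longrightarrow> measure P {\<omega>\<in>space P. \<bar>K (real n) \<omega> - W \<omega>\<bar> > e} < r / 4"
      using r unfolding eventually_sequentially by auto
    show "\<exists>no. \<forall>n\<ge>no. norm (char (distr P borel (K (real n))) u - char (distr P borel W) u) < r"
    proof (intro exI[of _ N] allI impI)
      fix n assume "n \<ge> N"
      have "norm (char (distr P borel (K (real n))) u - char (distr P borel W) u) \<le>
          \<bar>u\<bar> * e + 2 * measure P {\<omega>\<in>space P. \<bar>K (real n) \<omega> - W \<omega>\<bar> > e}"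
        using e by (intro norm_char_diff_le prob_space_axioms) auto
      then show "norm (char (distr P borel (K (real n))) u - char (distr P borel W) u) < r"
        using N[OF \<open>n \<ge> N\<close>] \<open>\<bar>u\<bar> * e \<le> r / 2\<close> by linarith
    qed
  qed
  moreover have "(\<lambda>n. char (distr P borel (K (real n))) u) \<longlonglongrightarrow> of_real (exp (- (u * tanh u)))"
  proof (rule Lim_transform_eventually)
    show "(\<lambda>n. complex_of_real (exp (LINT s:{0<..real n}|lborel. mu_exponent (u * s) * exp (- s)))) \<longlonglongrightarrow> of_real (exp (- (u * tanh u)))"
      by (intro tendsto_intros exponent_LIMSEQ)
    show "\<forall>\<^sub>F n in sequentially. of_real (exp (LINT s:{0<..real n}|lborel. mu_exponent (u * s) * exp (- s))) = char (distr P borel (K (real n))) u"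
      using eventually_gt_at_top[of 0] by eventually_elim (simp add: char_K)
  qed
  ultimately show ?thesis by (rule LIMSEQ_unique)
qed

lemma clog_char_K_integral:
  assumes "is_K_integral P Y W"
  shows "clog (char (distr P borel W)) = (\<lambda>u. of_real (- (u * tanh u)))"
proof (rule clog_exp_of_real)
  show "continuous_on UNIV (\<lambda>u :: real. - (u * tanh u))"
    by (intro continuous_intros) (simp add: cosh_real_nonzero)
qed (simp_all add: char_K_integral[OF assms])

end

lemma clog_char_K_integral_of_levy_process:
  assumes "levy_process P Y" "distr P borel (Y 1) = \<mu>_law"
  shows "\<exists>V. is_K_integral P Y V"
    and "is_K_integral P Y W \<Longrightarrow> clog (char (distr P borel W)) = (\<lambda>u. of_real (- (u * tanh u)))"
proof -
  interpret prob_space P using assms by (simp add: levy_process_def)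
  interpret mu_levy_process P Y by unfold_locales fact+
  show "\<exists>V. is_K_integral P Y V" using is_K_integral_V by blast
  show "clog (char (distr P borel W)) = (\<lambda>u. of_real (- (u * tanh u)))" if "is_K_integral P Y W"
    using that by (rule clog_char_K_integral)
qed

section \<open>The random series\<close>

text \<open>Needed for the shift from the indices \<open>{1..}\<close> of (d) to all naturals.
  Injectivity lets a family of events over \<open>J\<close> be carried to the image of
  \<open>J\<close> by the inverse map.\<close>

lemma (in prob_space) indep_vars_reindex:
  assumes "inj_on f I" "indep_vars M' X (f ` I)"
  shows "indep_vars (\<lambda>i. M' (f i)) (\<lambda>i. X (f i)) I"
  unfolding indep_vars_def2 indep_sets_def
proof (intro conjI ballI allI impI)
  fix i assume "i \<in> I"
  then show "random_variable (M' (f i)) (X (f i))"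
    using assms(2) by (auto simp: indep_vars_def2)
next
  fix i assume "i \<in> I"
  then show "{X (f i) -` A \<inter> space M |A. A \<in> sets (M' (f i))} \<subseteq> events"
    using assms(2) by (auto simp: indep_vars_def2 indep_sets_def)
next
  fix J A assume J: "J \<subseteq> I" "J \<noteq> {}" "finite J" and A: "A \<in> (\<Pi> j\<in>J. {X (f j) -` A \<inter> space M |A. A \<in> sets (M' (f j))})"
  define A' where "A' = A \<circ> inv_into J f"
  have inj: "inj_on f J" using assms(1) J(1) by (rule inj_on_subset)
  have A': "A' (f j) = A j" if "j \<in> J" for j using that inj by (simp add: A'_def)
  have "prob (\<Inter>k\<in>f ` J. A' k) = (\<Prod>k\<in>f ` J. prob (A' k))"
    using assms(2) unfolding indep_vars_def2
    by (intro indep_setsD[where I = "f ` I"]) (use J A A' in auto)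
  then show "prob (\<Inter>j\<in>J. A j) = (\<Prod>j\<in>J. prob (A j))"
    using A' inj by (simp add: prod.reindex)
qed

text \<open>The factor \<open>exp (\<i> u Y)\<close> is expanded over the events \<open>N = n\<close>, on each of which it is a
  product of finitely many functions of the independent variables.\<close>

lemma char_compound_poisson_rademacher:
  fixes N :: "'a \<Rightarrow> nat" and r :: "nat \<Rightarrow> 'a \<Rightarrow> real"
  assumes P: "prob_space P" and l: "l > 0"
    and indep: "prob_space.indep_vars P (\<lambda>_. borel) (\<lambda>j \<omega>. if j = 0 then real (N \<omega>) else r j \<omega>) UNIV"
    and N: "distr P (count_space UNIV) N = measure_pmf (poisson_pmf l)"
    and r: "\<And>j. j \<ge> 1 \<Longrightarrow> measure P {\<omega>\<in>space P. r j \<omega> = 1} = 1 / 2"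
      "\<And>j. j \<ge> 1 \<Longrightarrow> measure P {\<omega>\<in>space P. r j \<omega> = - 1} = 1 / 2"
  shows "char (distr P borel (\<lambda>\<omega>. \<Sum>j=1..N \<omega>. r j \<omega>)) u = of_real (exp (l * (cos u - 1)))"
proof -
  interpret prob_space P by fact
  have rv: "(\<lambda>\<omega>. if j = 0 then real (N \<omega>) else r j \<omega>) \<in> borel_measurable P" for j :: nat
    using indep by (simp add: indep_vars_def2)
  have r_meas: "r j \<in> borel_measurable P" if "j \<ge> 1" for j
    using rv[of j] that by simp
  have realN: "(\<lambda>\<omega>. real (N \<omega>)) \<in> borel_measurable P"
    using rv[of 0] by simp
  \<comment> \<open>Only \<open>real (N \<omega>)\<close> is known to be measurable; images of sets
    of naturals are countable, hence Borel, and this recovers \<open>N\<close>.\<close>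
  have N_meas [measurable]: "N \<in> measurable P (count_space UNIV)"
  proof (rule measurableI)
    fix A :: "nat set"
    have "N -` A \<inter> space P = (\<lambda>\<omega>. real (N \<omega>)) -` (real ` A) \<inter> space P" by auto
    also have "\<dots> \<in> sets P"
      by (rule measurable_sets[OF realN]) (auto intro: sets.countable)
    finally show "N -` A \<inter> space P \<in> sets P" .
  qed simp
  have sum_meas: "(\<lambda>\<omega>. \<Sum>j=1..n. r j \<omega>) \<in> borel_measurable P" for n
    by (intro borel_measurable_sum r_meas) auto
  have Y_meas [measurable]: "(\<lambda>\<omega>. \<Sum>j=1..N \<omega>. r j \<omega>) \<in> borel_measurable P"
    by (rule measurable_compose_countable[OF sum_meas N_meas])
  let ?Y = "\<lambda>\<omega>. \<Sum>j=1..N \<omega>. r j \<omega>"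
  \<comment> \<open>Index \<open>0\<close> contributes the indicator of the event that the count is
    \<open>n\<close>, the other indices one exponential factor each.\<close>
  define G where "G n j x = (if j = 0 then of_bool (x = real n) else iexp (u * x))" for n j :: nat and x :: real
  have [measurable]: "G n j \<in> borel_measurable borel" for n j
    unfolding G_def by (cases "j = 0") (simp_all, measurable)
  define E where "E n = expectation (\<lambda>\<omega>. \<Prod>j\<in>{..n}. G n j (if j = 0 then real (N \<omega>) else r j \<omega>))" for n
  have norm_G: "norm (G n j x) \<le> 1" for n j x by (simp add: G_def)
  have prod_G: "(\<Prod>j\<in>{..n}. G n j (if j = 0 then real (N \<omega>) else r j \<omega>)) =
      (if N \<omega> = n then iexp (u * ?Y \<omega>) else 0)" for n \<omega>
  proof -
    have "{..n} = insert 0 {1..n}" by auto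
    then have "(\<Prod>j\<in>{..n}. G n j (if j = 0 then real (N \<omega>) else r j \<omega>)) =
        of_bool (N \<omega> = n) * (\<Prod>j=1..n. iexp (u * r j \<omega>))"
      by (simp add: G_def)
    also have "(\<Prod>j=1..n. iexp (u * r j \<omega>)) = iexp (u * (\<Sum>j=1..n. r j \<omega>))"
      by (simp add: exp_sum sum_distrib_left flip: exp_sum)
    finally show ?thesis by simp
  qed
  have G0: "expectation (\<lambda>\<omega>. G n 0 (real (N \<omega>))) = of_real (l ^ n / fact n * exp (- l))" for n
  proof -
    have "expectation (\<lambda>\<omega>. G n 0 (real (N \<omega>))) = (\<integral>\<omega>. of_real (indicator (N -` {n} \<inter> space P) \<omega>) \<partial>P)"
      by (intro Bochner_Integration.integral_cong) (auto simp: G_def indicator_def)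
    also have "\<dots> = of_real (measure P (N -` {n} \<inter> space P))"
      by (subst integral_complex_of_real) simp
    also have "measure P (N -` {n} \<inter> space P) = measure (distr P (count_space UNIV) N) {n}"
      by (simp add: measure_distr)
    also have "\<dots> = l ^ n / fact n * exp (- l)"
      using l by (simp add: N measure_pmf_single)
    finally show ?thesis .
  qed
  have Gj: "expectation (\<lambda>\<omega>. G n j (r j \<omega>)) = of_real (cos u)" if j: "j \<ge> 1" for n j
  proof -
    have [measurable]: "r j \<in> borel_measurable P" using j by (rule r_meas)
    let ?A = "{\<omega>\<in>space P. r j \<omega> = 1}" and ?B = "{\<omega>\<in>space P. r j \<omega> = - 1}"
    have "prob (?A \<union> ?B) = prob ?A + prob ?B"
      by (intro finite_measure_Union) auto
    \<comment> \<open>The masses at \<open>1\<close> and \<open>- 1\<close> add up to one, so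
      \<open>r j\<close> is almost surely one of the two values.\<close>
    then have "prob (?A \<union> ?B) = 1" using r[OF j] by simp
    then have "AE \<omega> in P. \<omega> \<in> ?A \<union> ?B"
      by (intro AE_prob_1)
    then have "AE \<omega> in P. G n j (r j \<omega>) = indicator ?A \<omega> *\<^sub>R iexp u + indicator ?B \<omega> *\<^sub>R iexp (- u)"
      by eventually_elim (use j in \<open>auto simp: G_def\<close>)
    then have "expectation (\<lambda>\<omega>. G n j (r j \<omega>)) = expectation (\<lambda>\<omega>. indicator ?A \<omega> *\<^sub>R iexp u + indicator ?B \<omega> *\<^sub>R iexp (- u))"
      by (intro integral_cong_AE) auto
    also have "\<dots> = prob ?A *\<^sub>R iexp u + prob ?B *\<^sub>R iexp (- u)"
      by (subst Bochner_Integration.integral_add) (auto simp: emeasure_eq_measure)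
    also have "\<dots> = of_real (cos u)"
      unfolding r(1)[OF j] r(2)[OF j] by (simp add: complex_eq_iff Re_exp Im_exp)
    finally show ?thesis .
  qed
  have E: "E n = of_real ((l * cos u) ^ n / fact n * exp (- l))" for n
  proof -
    have "E n = (\<Prod>j\<in>{..n}. expectation (\<lambda>\<omega>. G n j (if j = 0 then real (N \<omega>) else r j \<omega>)))"
      unfolding E_def
    proof (rule indep_vars_lebesgue_integral)
      show "indep_vars (\<lambda>_. borel) (\<lambda>j \<omega>. G n j (if j = 0 then real (N \<omega>) else r j \<omega>)) {..n}"
        by (rule indep_vars_compose2[OF indep_vars_subset[OF indep]]) auto
      show "integrable P (\<lambda>\<omega>. G n j (if j = 0 then real (N \<omega>) else r j \<omega>))" for j
        using measurable_compose[OF rv[of j], of "G n j"] norm_G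
        by (intro integrable_const_bound[of _ 1]) auto
    qed simp
    also have "{..n} = insert 0 {1..n}" by auto
    also have "(\<Prod>j\<in>insert 0 {1..n}. expectation (\<lambda>\<omega>. G n j (if j = 0 then real (N \<omega>) else r j \<omega>))) =
        expectation (\<lambda>\<omega>. G n 0 (real (N \<omega>))) * (\<Prod>j=1..n. expectation (\<lambda>\<omega>. G n j (r j \<omega>)))"
      by simp
    also have "\<dots> = of_real (l ^ n / fact n * exp (- l)) * (\<Prod>j=1..n. of_real (cos u))"
      unfolding G0 by (intro arg_cong2[where f = "(*)"] refl prod.cong Gj) auto
    also have "\<dots> = of_real ((l * cos u) ^ n / fact n * exp (- l))"
      by (simp add: power_mult_distrib)
    finally show ?thesis .
  qed
  have int: "integrable P (\<lambda>\<omega>. if N \<omega> = n then iexp (u * ?Y \<omega>) else 0)" for n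
  proof (rule integrable_const_bound[of _ 1])
    show "(\<lambda>\<omega>. if N \<omega> = n then iexp (u * ?Y \<omega>) else 0) \<in> borel_measurable P" by measurable
  qed auto
  \<comment> \<open>Cutting off at \<open>N \<omega> < k\<close> makes the expansion finite; each
    path is eventually untouched by the cutoff.\<close>
  have "(\<lambda>k. \<integral>\<omega>. (if N \<omega> < k then iexp (u * ?Y \<omega>) else 0) \<partial>P) \<longlonglongrightarrow> (\<integral>\<omega>. iexp (u * ?Y \<omega>) \<partial>P)"
  proof (rule integral_dominated_convergence[where w = "\<lambda>_. 1"])
    show "AE \<omega> in P. (\<lambda>k. if N \<omega> < k then iexp (u * ?Y \<omega>) else 0) \<longlonglongrightarrow> iexp (u * ?Y \<omega>)"
    proof (rule AE_I2)
      fix \<omega>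
      show "(\<lambda>k. if N \<omega> < k then iexp (u * ?Y \<omega>) else 0) \<longlonglongrightarrow> iexp (u * ?Y \<omega>)"
        by (rule tendsto_eventually, rule eventually_mono[OF eventually_gt_at_top[of "N \<omega>"]]) simp
    qed
    show "(\<lambda>\<omega>. iexp (u * ?Y \<omega>)) \<in> borel_measurable P" by measurable
    show "(\<lambda>\<omega>. if N \<omega> < k then iexp (u * ?Y \<omega>) else 0) \<in> borel_measurable P" for k by measurable
  qed auto
  moreover have "(\<integral>\<omega>. (if N \<omega> < k then iexp (u * ?Y \<omega>) else 0) \<partial>P) = (\<Sum>n<k. E n)" for k
  proof -
    have "(if N \<omega> < k then iexp (u * ?Y \<omega>) else 0) = (\<Sum>n<k. if N \<omega> = n then iexp (u * ?Y \<omega>) else 0)" for \<omega>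
      by (subst sum.delta') auto
    then have "(\<integral>\<omega>. (if N \<omega> < k then iexp (u * ?Y \<omega>) else 0) \<partial>P) =
        (\<integral>\<omega>. (\<Sum>n<k. if N \<omega> = n then iexp (u * ?Y \<omega>) else 0) \<partial>P)"
      by (simp only:)
    also have "\<dots> = (\<Sum>n<k. \<integral>\<omega>. (if N \<omega> = n then iexp (u * ?Y \<omega>) else 0) \<partial>P)"
      by (intro Bochner_Integration.integral_sum int)
    finally show ?thesis unfolding E_def prod_G .
  qed
  moreover have "char (distr P borel ?Y) u = (\<integral>\<omega>. iexp (u * ?Y \<omega>) \<partial>P)"
    unfolding char_def by (rule integral_distr) measurable
  ultimately have "E sums char (distr P borel ?Y) u"
    by (simp only: sums_def)
  moreover have "E sums of_real (exp (l * cos u) * exp (- l))"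
  proof -
    have "(\<lambda>n. (l * cos u) ^ n / fact n * exp (- l)) sums (exp (l * cos u) * exp (- l))"
      using sums_mult2[OF exp_converges[of "l * cos u"], of "exp (- l)"] by (simp add: divide_inverse mult.commute)
    then show ?thesis unfolding E by (rule sums_of_real)
  qed
  ultimately have "char (distr P borel ?Y) u = of_real (exp (l * cos u) * exp (- l))"
    by (rule sums_unique2)
  then show "char (distr P borel ?Y) u = of_real (exp (l * (cos u - 1)))"
    by (simp add: right_diff_distrib exp_diff exp_minus divide_inverse)
qed

lemma random_series_law:
  fixes N :: "'a \<Rightarrow> nat" and r :: "nat \<Rightarrow> 'a \<Rightarrow> real" and Y :: "nat \<Rightarrow> 'b \<Rightarrow> real"
  assumes P: "prob_space P"
    and indep: "prob_space.indep_vars P (\<lambda>_. borel) (\<lambda>j \<omega>. if j = 0 then real (N \<omega>) else r j \<omega>) UNIV"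
    and N: "distr P (count_space UNIV) N = measure_pmf (poisson_pmf 2)"
    and r: "\<And>j. j \<ge> 1 \<Longrightarrow> measure P {\<omega>\<in>space P. r j \<omega> = 1} = 1 / 2"
      "\<And>j. j \<ge> 1 \<Longrightarrow> measure P {\<omega>\<in>space P. r j \<omega> = - 1} = 1 / 2"
    and Q: "prob_space Q" and indep_Y: "prob_space.indep_vars Q (\<lambda>_. borel) Y {1..}"
    and Y: "\<And>n. n \<ge> 1 \<Longrightarrow> distr Q borel (Y n) = distr P borel (\<lambda>\<omega>. \<Sum>j=1..N \<omega>. r j \<omega>)"
  defines "S \<equiv> \<lambda>n \<omega>. \<Sum>k=1..n. c_seq (int k) * Y k \<omega>"
    and "X \<equiv> \<lambda>\<omega>. \<Sum>n. c_seq (int (Suc n)) * Y (Suc n) \<omega>"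
  shows "(AE \<omega> in Q. (\<lambda>n. S n \<omega>) \<longlonglongrightarrow> X \<omega>) \<and>
    weak_conv_m (\<lambda>n. distr Q borel (S n)) (distr Q borel X) \<and>
    integrable Q (\<lambda>\<omega>. (X \<omega>)\<^sup>2) \<and> (\<forall>n. integrable Q (\<lambda>\<omega>. (S n \<omega>)\<^sup>2)) \<and>
    (\<lambda>n. \<integral>\<^sup>+\<omega>. ennreal ((S n \<omega> - X \<omega>)\<^sup>2) \<partial>Q) \<longlonglongrightarrow> 0 \<and>
    distr Q borel X = \<mu>_law"
proof -
  interpret Q: prob_space Q by fact
  have image: "range Suc = {1..}"
    by (auto simp: image_iff intro: Suc_le_D)
  have indep': "Q.indep_vars (\<lambda>_. borel) (\<lambda>k. Y (Suc k)) UNIV"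
    using Q.indep_vars_reindex[of Suc UNIV "\<lambda>_. borel" Y] indep_Y unfolding image by simp
  \<comment> \<open>Poisson parameter 2 gives the exponent \<open>2 * (cos u - 1)\<close>, the case
    \<open>l = 1\<close> of the general series.\<close>
  have char: "char (distr Q borel (Y (Suc k))) u = of_real (exp (1 * (2 * (cos u - 1))))" for k u
    using char_compound_poisson_rademacher[OF P _ indep N r, of u] Y[of "Suc k"] by simp
  note series = compound_poisson_series[OF Q indep' char, simplified]
  interpret orthogonal_sequence Q "\<lambda>k \<omega>. c_nat k * Y (Suc k) \<omega>" 2
    by (rule series(1))
  have S: "S = (\<lambda>n \<omega>. \<Sum>k<n. c_nat k * Y (Suc k) \<omega>)"
    unfolding S_def by (simp add: c_nat_def sum.atLeast1_atMost_eq del: of_nat_Suc)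
  have X: "X = (\<lambda>\<omega>. \<Sum>k. c_nat k * Y (Suc k) \<omega>)"
    unfolding X_def c_nat_def ..
  have [measurable]: "S n \<in> borel_measurable Q" "X \<in> borel_measurable Q" for n
    unfolding S X using X_meas by (intro borel_measurable_sum borel_measurable_suminf; simp)+
  have lim: "AE \<omega> in Q. (\<lambda>n. S n \<omega>) \<longlonglongrightarrow> X \<omega>"
    unfolding S X by (rule AE_LIMSEQ_S)
  have law_X: "real_distribution (distr Q borel X)"
    by (rule real_distribution_distr_borel[OF Q]) measurable
  have "weak_conv_m (\<lambda>n. distr Q borel (S n)) (distr Q borel X)"
  proof (rule levy_continuity)
    show "real_distribution (distr Q borel (S n))" for n
      by (rule real_distribution_distr_borel[OF Q]) measurable
    show "(\<lambda>n. char (distr Q borel (S n)) u) \<longlonglongrightarrow> char (distr Q borel X) u" for u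
      by (rule char_tendsto_of_AE_tendsto[OF Q _ _ lim]) measurable
  qed (rule law_X)
  moreover have "integrable Q (\<lambda>\<omega>. (X \<omega>)\<^sup>2)"
    unfolding X by (rule integrable_Z_sq)
  moreover have "integrable Q (\<lambda>\<omega>. (S n \<omega>)\<^sup>2)" for n
    unfolding S by (rule expectation_sum_sq(1)) simp
  moreover have "(\<lambda>n. \<integral>\<^sup>+\<omega>. ennreal ((S n \<omega> - X \<omega>)\<^sup>2) \<partial>Q) \<longlonglongrightarrow> 0"
    unfolding S X by (rule L2_LIMSEQ)
  moreover have "distr Q borel X = \<mu>_law"
  proof (rule Levy_uniqueness[OF law_X real_distribution_mu_law])
    show "char (distr Q borel X) = char \<mu>_law"
      unfolding X by (intro ext) (simp add: series(2) char_mu_law)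
  qed
  ultimately show ?thesis using lim by blast
qed

lemma laplace_clog_cnj_char_mu_law:
  assumes t: "t > 0"
  shows "laplace_exists (clog (\<lambda>s. cnj (char \<mu>_law s))) t"
    and "\<i> * of_real (t\<^sup>2) * laplace (clog (\<lambda>s. cnj (char \<mu>_law s))) t = tan (1 / (\<i> * complex_of_real t))"
proof -
  have L: "has_bochner_integral lborel (\<lambda>s. indicator {0..} s * (mu_exponent s * exp (- t * s))) (- (1 / t\<^sup>2 * tanh (1 / t)))"
    using laplace_mu_exponent[OF t, of 1] by simp
  show "laplace_exists (clog (\<lambda>s. cnj (char \<mu>_law s))) t"
    unfolding clog_cnj_char_mu_law by (rule laplace_of_real(1)[OF L])
  show "\<i> * of_real (t\<^sup>2) * laplace (clog (\<lambda>s. cnj (char \<mu>_law s))) t = tan (1 / (\<i> * complex_of_real t))"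
    unfolding clog_cnj_char_mu_law laplace_of_real(2)[OF L] tan_one_over_imaginary
    using t by simp
qed

lemma laplace_char_m_meas_cosh:
  assumes w: "w > 1"
  shows "laplace_exists (\<lambda>x. char m_meas x - of_real (tanh 1 * cosh x)) w"
    and "of_real (w\<^sup>2 - 1) * laplace (\<lambda>x. char m_meas x - of_real (tanh 1 * cosh x)) w
      = - \<i> * tan (1 / (\<i> * complex_of_real w))"
proof -
  let ?g = "\<lambda>x. (\<Sum>n. 2 * m_weight n * cos (x * c_nat n)) - tanh 1 * cosh x"
  have g: "(\<lambda>x. char m_meas x - of_real (tanh 1 * cosh x)) = (\<lambda>x. of_real (?g x))"
    by (simp add: char_m_meas)
  have L: "has_bochner_integral lborel (\<lambda>x. indicator {0..} x * (?g x * exp (- w * x))) (- (tanh (1 / w) / (w\<^sup>2 - 1)))"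
    using has_bochner_integral_minus[OF laplace_char_m_meas[OF w]] by (simp add: algebra_simps)
  have "w\<^sup>2 - 1 \<noteq> 0" using one_less_power[OF w, of 2] by simp
  then have "complex_of_real (w\<^sup>2 - 1) \<noteq> 0" by (simp only: of_real_eq_0_iff not_False_eq_True)
  then have "of_real (w\<^sup>2 - 1) * complex_of_real (- (tanh (1 / w) / (w\<^sup>2 - 1))) = - of_real (tanh (1 / w))"
    by (simp only: of_real_minus of_real_divide) simp
  then show "of_real (w\<^sup>2 - 1) * laplace (\<lambda>x. char m_meas x - of_real (tanh 1 * cosh x)) w
      = - \<i> * tan (1 / (\<i> * complex_of_real w))"
    unfolding g laplace_of_real(2)[OF L] tan_one_over_imaginary by simp
  show "laplace_exists (\<lambda>x. char m_meas x - of_real (tanh 1 * cosh x)) w"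
    unfolding g by (rule laplace_of_real(1)[OF L])
qed

theorem theorem1:
  shows
    \<comment> \<open>(a)\<close>
    "(finite_measure m_meas \<and>
      measure m_meas UNIV = tanh 1 \<and> \<bar>tanh 1 - (0.76159 :: real)\<bar> < 0.000005 \<and>
      (\<forall>t::real. t \<noteq> 0 \<longrightarrow>
         integrable m_meas (\<lambda>x. (1 + \<i> * of_real t * of_real x) / (\<i> * of_real t - of_real x)) \<and>
         (LINT x|m_meas. (1 + \<i> * of_real t * of_real x) / (\<i> * of_real t - of_real x))
            = tan (1 / (\<i> * complex_of_real t)) \<and>
         tan (1 / (\<i> * complex_of_real t)) = - \<i> * of_real (tanh (1 / t))))
     \<and>
     \<comment> \<open>(b)\<close>
     ((\<integral>\<^sup>+x\<in>-{0}. ennreal (min (x\<^sup>2) 1) \<partial>M_meas) < \<infinity> \<and>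
      has_lk_triplet \<mu>_law 0 0 M_meas \<and>
      (\<forall>t::real. t > 0 \<longrightarrow>
         laplace_exists (clog (\<lambda>s. cnj (char \<mu>_law s))) t \<and>
         \<i> * of_real (t\<^sup>2) * laplace (clog (\<lambda>s. cnj (char \<mu>_law s))) t
            = tan (1 / (\<i> * complex_of_real t)) \<and>
         tan (1 / (\<i> * complex_of_real t)) = - \<i> * of_real (tanh (1 / t))) \<and>
      (\<forall>(P :: 'p measure) Y. levy_process P Y \<and> distr P borel (Y 1) = \<mu>_law \<longrightarrow>
         (\<exists>V. is_K_integral P Y V) \<and>
         (\<forall>V. is_K_integral P Y V \<longrightarrow>
            (\<forall>t::real. t > 0 \<longrightarrow>
               \<i> * of_real (t\<^sup>2) * laplace (clog (\<lambda>s. cnj (char \<mu>_law s))) t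
                 = \<i> * of_real t * clog (char (distr P borel V)) (- inverse t) \<and>
               \<i> * of_real t * clog (char (distr P borel V)) (- inverse t)
                 = tan (1 / (\<i> * complex_of_real t))))))
     \<and>
     \<comment> \<open>(c)\<close>
     (\<forall>w::real. w > 1 \<longrightarrow>
        laplace_exists (\<lambda>x. char m_meas x - of_real (tanh 1 * cosh x)) w \<and>
        of_real (w\<^sup>2 - 1) * laplace (\<lambda>x. char m_meas x - of_real (tanh 1 * cosh x)) w
           = - \<i> * tan (1 / (\<i> * complex_of_real w)) \<and>
        - \<i> * tan (1 / (\<i> * complex_of_real w)) = - of_real (tanh (1 / w)))
     \<and>
     \<comment> \<open>(d): the sequence \<open>N, r 1, r 2, \<dots>\<close> is independent; the \<open>Y n\<close> with \<open>n \<ge> 1\<close> are i.i.d. copies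
       of \<open>\<Sum>j=1..N. r j\<close>, possibly on another probability space.\<close>
     (\<forall>(P :: 'a measure) (N :: 'a \<Rightarrow> nat) (r :: nat \<Rightarrow> 'a \<Rightarrow> real)
        (Q :: 'b measure) (Y :: nat \<Rightarrow> 'b \<Rightarrow> real).
        prob_space P \<and>
        prob_space.indep_vars P (\<lambda>_. borel) (\<lambda>j \<omega>. if j = 0 then real (N \<omega>) else r j \<omega>) UNIV \<and>
        distr P (count_space UNIV) N = measure_pmf (poisson_pmf 2) \<and>
        (\<forall>j\<ge>1. measure P {\<omega>\<in>space P. r j \<omega> = 1} = 1 / 2 \<and>
               measure P {\<omega>\<in>space P. r j \<omega> = -1} = 1 / 2) \<and>
        prob_space Q \<and>
        prob_space.indep_vars Q (\<lambda>_. borel) Y {1..} \<and>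
        (\<forall>n\<ge>1. distr Q borel (Y n) = distr P borel (\<lambda>\<omega>. \<Sum>j=1..N \<omega>. r j \<omega>)) \<longrightarrow>
        (let S = (\<lambda>n \<omega>. \<Sum>k=1..n. c_seq (int k) * Y k \<omega>);
             X = (\<lambda>\<omega>. \<Sum>n. c_seq (int (Suc n)) * Y (Suc n) \<omega>) in
           (AE \<omega> in Q. (\<lambda>n. S n \<omega>) \<longlonglongrightarrow> X \<omega>) \<and>
           weak_conv_m (\<lambda>n. distr Q borel (S n)) (distr Q borel X) \<and>
           integrable Q (\<lambda>\<omega>. (X \<omega>)\<^sup>2) \<and> (\<forall>n. integrable Q (\<lambda>\<omega>. (S n \<omega>)\<^sup>2)) \<and>
           (\<lambda>n. \<integral>\<^sup>+\<omega>. ennreal ((S n \<omega> - X \<omega>)\<^sup>2) \<partial>Q) \<longlonglongrightarrow> 0 \<and>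
           distr Q borel X = \<mu>_law))"
proof (intro conjI allI impI, goal_cases)
  show "finite_measure m_meas" by (rule finite_measure_m_meas)
  show "measure m_meas UNIV = tanh 1" by (rule measure_m_meas)
  show "\<bar>tanh 1 - (0.76159 :: real)\<bar> < 0.000005" by (rule tanh_1_approx)
next
  fix t :: real assume "t \<noteq> 0"
  from has_bochner_integral_m_meas_tan[OF this]
  show "integrable m_meas (\<lambda>x. (1 + \<i> * of_real t * of_real x) / (\<i> * of_real t - of_real x))"
    and "(LINT x|m_meas. (1 + \<i> * of_real t * of_real x) / (\<i> * of_real t - of_real x)) = tan (1 / (\<i> * complex_of_real t))"
    unfolding tan_one_over_imaginary by (simp_all add: has_bochner_integral_iff)
next
  show "(\<integral>\<^sup>+x\<in>-{0}. ennreal (min (x\<^sup>2) 1) \<partial>M_meas) < \<infinity>"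
    using nn_integral_min_M_meas by (simp only: min.commute)
  show "has_lk_triplet \<mu>_law 0 0 M_meas" by (rule has_lk_triplet_mu_law)
next
  fix t :: real assume "t > 0"
  show "laplace_exists (clog (\<lambda>s. cnj (char \<mu>_law s))) t"
    by (rule laplace_clog_cnj_char_mu_law(1)) fact
  show "\<i> * of_real (t\<^sup>2) * laplace (clog (\<lambda>s. cnj (char \<mu>_law s))) t = tan (1 / (\<i> * complex_of_real t))"
    by (rule laplace_clog_cnj_char_mu_law(2)) fact
next
  fix P :: "'p measure" and Y assume "levy_process P Y \<and> distr P borel (Y 1) = \<mu>_law"
  then show "\<exists>V. is_K_integral P Y V"
    using clog_char_K_integral_of_levy_process(1) by blast
next
  fix P :: "'p measure" and Y V and t :: real
  assume Y: "levy_process P Y \<and> distr P borel (Y 1) = \<mu>_law" and V: "is_K_integral P Y V" and t: "t > 0"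
  have "clog (char (distr P borel V)) = (\<lambda>u. of_real (- (u * tanh u)))"
    using Y V clog_char_K_integral_of_levy_process(2) by blast
  \<comment> \<open>At \<open>u = - 1/t\<close> the even function \<open>u * tanh u\<close> has the
    value \<open>tanh (1/t) / t\<close>.\<close>
  then show "\<i> * of_real t * clog (char (distr P borel V)) (- inverse t) = tan (1 / (\<i> * complex_of_real t))"
    unfolding tan_one_over_imaginary using t by (simp add: inverse_eq_divide)
  then show "\<i> * of_real (t\<^sup>2) * laplace (clog (\<lambda>s. cnj (char \<mu>_law s))) t =
      \<i> * of_real t * clog (char (distr P borel V)) (- inverse t)"
    by (simp only: laplace_clog_cnj_char_mu_law(2)[OF t])
next
  fix w :: real assume "w > 1"
  show "laplace_exists (\<lambda>x. char m_meas x - of_real (tanh 1 * cosh x)) w"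
    by (rule laplace_char_m_meas_cosh(1)) fact
  show "of_real (w\<^sup>2 - 1) * laplace (\<lambda>x. char m_meas x - of_real (tanh 1 * cosh x)) w = - \<i> * tan (1 / (\<i> * complex_of_real w))"
    by (rule laplace_char_m_meas_cosh(2)) fact
  show "- \<i> * tan (1 / (\<i> * complex_of_real w)) = - of_real (tanh (1 / w))"
    unfolding tan_one_over_imaginary by simp
next
  \<comment> \<open>The goal of part (d).\<close>
  case (18 P N r Q Y)
  then have P: "prob_space P"
    and indep: "prob_space.indep_vars P (\<lambda>_. borel) (\<lambda>j \<omega>. if j = 0 then real (N \<omega>) else r j \<omega>) UNIV"
    and N: "distr P (count_space UNIV) N = measure_pmf (poisson_pmf 2)"
    and r: "\<And>j. j \<ge> 1 \<Longrightarrow> measure P {\<omega>\<in>space P. r j \<omega> = 1} = 1 / 2"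
      "\<And>j. j \<ge> 1 \<Longrightarrow> measure P {\<omega>\<in>space P. r j \<omega> = - 1} = 1 / 2"
    and Q: "prob_space Q" and Y: "prob_space.indep_vars Q (\<lambda>_. borel) Y {1..}"
      "\<And>n. n \<ge> 1 \<Longrightarrow> distr Q borel (Y n) = distr P borel (\<lambda>\<omega>. \<Sum>j=1..N \<omega>. r j \<omega>)"
    by blast+
  show ?case
    unfolding Let_def by (rule random_series_law[OF P indep N r Q Y])
\<comment> \<open>What remains are the copies of the tangent identity in (a) and (b).\<close>
qed (rule tan_one_over_imaginary)+

end
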